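(* Let $\mathbb{B}$ be a real Banach space, let $A:\mathcal{D}(A)\subset\mathbb{B}\to\mathbb{B}$ be a linear closed densely defined (possibly unbounded) operator generating a strongly continuous semigroup $\Psi(s):\mathbb{B}\to\mathbb{B}$, $s\ge0$, of linear bounded operators, let $B:\mathbb{R}^m\to\mathbb{B}$ and $C:\mathbb{B}\to\mathbb{R}^k$ be linear bounded operators, let $\gamma\in L^\infty(\mathbb{R};\mathbb{R}^m)$, and let $\tilde u:[t^0,+\infty)\times\mathbb{R}^k\to\mathbb{R}^m$ be a measurable function. Consider the system $$\dot x(t)=Ax(t)+B(u(t)+\gamma(t)),\quad t>t^0,\quad x(t^0)=x^0,\qquad y(t)=Cx(t),\qquad u(t)=\tilde u(t,y(t)).\qquad(\ast)$$ If $\mathrm{range}(B)\subset\mathcal{D}(A)$ and $\tilde u$ satisfies the Filippov Condition, then, for any $x^0\in\mathcal{D}(A)$, the system $(\ast)$ has an Utkin solution $x:[t^0,t^0+T)\to\mathcal{D}(A)$, $0<T\le+\infty$, which is defined, at least, locally in time and satisfies the differential equation $\dot x(t)=Ax(t)+B(u_{\rm eq}(t)+\gamma(t))$ almost everywhere. If, additionally, the function $\Phi(s)=C\Psi(s)AB$ belongs to $L^\infty((0,+\infty);\mathbb{R}^{k\times m})$ and $\operatorname{ess\,sup}_{t,y}\|\tilde u(t,y)\|<+\infty$, then $T=+\infty$.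
   Context: $\|\cdot\|$ is the Euclidean norm and $\mathcal{B}(r)\subset\mathbb{R}^k$ is the open ball of radius $r>0$ centered at $0$. Filippov Condition for $\tilde u$: $\tilde u$ is measurable and for any $\alpha,r>0$ there exists $m_{\alpha,r}\in L^1((-\alpha,\alpha);\mathbb{R})$ such that $\|\tilde u(t,y)\|\le m_{\alpha,r}(t)$ for almost all $t\in(-\alpha,\alpha)$ (in the time domain of $\tilde u$) and almost all $y\in\mathcal{B}(r)$. Filippov regularization: $K[\tilde u](t,y)=\bigcap_{\delta>0}\bigcap_{\mu(M)=0}\overline{\mathrm{co}}\,\tilde u(t,y+\mathcal{B}(\delta)\setminus M)$, where $\overline{\mathrm{co}}$ is the convex closure and the intersections are over all $\delta>0$ and all $M\subset\mathbb{R}^k$ of Lebesgue measure zero. Utkin solution of the first (resp. second) kind of $(\ast)$: a continuous function $x:[t^0,t^0+T)\to\mathbb{B}$, $0<T\le+\infty$, with $x(t^0)=x^0$, satisfying $$x(t)=\Psi(t-t^0)x^0+\int_{t^0}^t\Psi(t-\tau)B(u_{\rm eq}(\tau)+\gamma(\tau))\,d\tau$$ (Bochner integral) with some $u_{\rm eq}\in L^1((t^0,t^0+T);\mathbb{R}^m)$ such that $u_{\rm eq}(t)\in U(t,Cx(t))$ for almost all $t\in(t^0,t^0+T)$, where $U=K[\tilde u]$ (resp. $U=(K[\tilde u_1],\dots,K[\tilde u_m])^\top$, the product set, for $\tilde u=(\tilde u_1,\dots,\tilde u_m)^\top$). When $T=+\infty$, integrability of $u_{\rm eq}$ is understood locally,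 on bounded intervals. *)

theory Defs
  imports "HOL-Analysis.Analysis" "HOL-Probability.Essential_Supremum"
begin

text \<open>The library's \<^const>\<open>has_bochner_integral\<close> needs a second-countable codomain, i.e. a separable
  Banach space. The following version works in arbitrary Banach spaces. Strong measurability has to
  be required explicitly there, since a Borel function need not be almost everywhere separably valued.\<close>

definition strongly_measurable :: "'a measure \<Rightarrow> ('a \<Rightarrow> 'b::real_normed_vector) \<Rightarrow> bool" where
  "strongly_measurable M f \<longleftrightarrow>
    (\<exists>s. (\<forall>i::nat. simple_function M (s i)) \<and> (AE x in M. (\<lambda>i. s i x) \<longlonglongrightarrow> f x))"

definition has_strong_bochner_integral ::
    "'a measure \<Rightarrow> ('a \<Rightarrow> 'b::real_normed_vector) \<Rightarrow> 'b \<Rightarrow> bool" where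
  "has_strong_bochner_integral M f I \<longleftrightarrow>
    strongly_measurable M f \<and>
    (\<exists>s. (\<forall>i::nat. Bochner_Integration.simple_bochner_integrable M (s i)) \<and>
      (\<lambda>i. \<integral>\<^sup>+x. norm (f x - s i x) \<partial>M) \<longlonglongrightarrow> 0 \<and>
      (\<lambda>i. Bochner_Integration.simple_bochner_integral M (s i)) \<longlonglongrightarrow> I)"

lemma has_strong_bochner_integral_iff_has_bochner_integral:
  fixes f :: "'a \<Rightarrow> 'b::{banach, second_countable_topology}"
  assumes "complete_measure M"
  shows "has_strong_bochner_integral M f I \<longleftrightarrow> has_bochner_integral M f I"
proof
  assume R: "has_bochner_integral M f I"
  then have f: "f \<in> borel_measurable M"
    by (rule borel_measurable_has_bochner_integral)
  obtain s where s: "\<And>i. simple_function M (s i)"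
      "\<And>x. x \<in> space M \<Longrightarrow> (\<lambda>i. s i x) \<longlonglongrightarrow> f x"
    using borel_measurable_implies_sequence_metric[OF f, of 0] by blast
  then have "strongly_measurable M f"
    unfolding strongly_measurable_def by (intro exI[of _ s]) auto
  with R show "has_strong_bochner_integral M f I"
    unfolding has_strong_bochner_integral_def by (auto elim!: has_bochner_integral.cases)
next
  assume L: "has_strong_bochner_integral M f I"
  then obtain s where s: "\<And>i::nat. simple_function M (s i)"
      "AE x in M. (\<lambda>i. s i x) \<longlonglongrightarrow> f x"
    by (auto simp: has_strong_bochner_integral_def strongly_measurable_def)
  interpret complete_measure M by fact
  define g where "g x = lim (\<lambda>i. s i x)" for x
  have "g \<in> borel_measurable M"
    unfolding g_def using s(1) by (intro borel_measurable_lim_metric borel_measurable_simple_function)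
  moreover have "AE x in M. g x = f x"
    using s(2) by eventually_elim (auto simp: g_def limI)
  ultimately have "f \<in> borel_measurable M"
  proof (intro borel_measurableI)
    fix S :: "'b set" assume g: "g \<in> borel_measurable M" and eq: "AE x in M. g x = f x" and S: "open S"
    have m: "g -` S \<inter> space M \<in> sets M"
      using g S by (auto intro: measurable_sets)
    have ae: "AE x in M. x \<in> g -` S \<inter> space M \<longleftrightarrow> x \<in> f -` S \<inter> space M"
      using eq by eventually_elim auto
    show "f -` S \<inter> space M \<in> sets M"
      by (rule in_sets_AE[OF ae m]) auto
  qed
  with L show "has_bochner_integral M f I"
    by (auto simp: has_strong_bochner_integral_def intro: has_bochner_integral.intros)
qed

definition Linfty :: "'a measure \<Rightarrow> ('a \<Rightarrow> 'b::real_normed_vector) \<Rightarrow> bool" where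
  "Linfty M f \<longleftrightarrow> f \<in> borel_measurable M \<and> esssup M (\<lambda>x. ereal (norm (f x))) < \<infinity>"

definition closed_densely_defined_operator :: "'b::real_normed_vector set \<Rightarrow> ('b \<Rightarrow> 'b) \<Rightarrow> bool" where
  "closed_densely_defined_operator D A \<longleftrightarrow>
    subspace D \<and>
    (\<forall>x\<in>D. \<forall>y\<in>D. A (x + y) = A x + A y) \<and> (\<forall>c. \<forall>x\<in>D. A (c *\<^sub>R x) = c *\<^sub>R A x) \<and>
    closed {(x, A x) | x. x \<in> D} \<and> closure D = UNIV"

text \<open>Only the values of the semigroup at nonnegative times matter, and only the values of an
  unbounded operator on its domain.\<close>

definition C0_semigroup :: "(real \<Rightarrow> 'b::real_normed_vector \<Rightarrow>\<^sub>L 'b) \<Rightarrow> bool" where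
  "C0_semigroup \<Psi> \<longleftrightarrow>
    \<Psi> 0 = id_blinfun \<and> (\<forall>s\<ge>0. \<forall>t\<ge>0. \<Psi> (s + t) = \<Psi> s o\<^sub>L \<Psi> t) \<and>
    (\<forall>x. ((\<lambda>s. \<Psi> s x) \<longlongrightarrow> x) (at_right 0))"

definition generates ::
    "'b::real_normed_vector set \<Rightarrow> ('b \<Rightarrow> 'b) \<Rightarrow> (real \<Rightarrow> 'b \<Rightarrow>\<^sub>L 'b) \<Rightarrow> bool" where
  "generates D A \<Psi> \<longleftrightarrow>
    D = {x. \<exists>z. ((\<lambda>h. (\<Psi> h x - x) /\<^sub>R h) \<longlongrightarrow> z) (at_right 0)} \<and>
    (\<forall>x\<in>D. ((\<lambda>h. (\<Psi> h x - x) /\<^sub>R h) \<longlongrightarrow> A x) (at_right 0))"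

definition filippov_condition ::
    "real \<Rightarrow> (real \<Rightarrow> 'k::euclidean_space \<Rightarrow> 'm::euclidean_space) \<Rightarrow> bool" where
  "filippov_condition t\<^sub>0 u \<longleftrightarrow>
    (\<lambda>(t, y). u t y) \<in> borel_measurable (lebesgue_on ({t\<^sub>0..} \<times> UNIV)) \<and>
    (\<forall>\<alpha>>0. \<forall>r>0. \<exists>\<mu>::real \<Rightarrow> real. set_integrable lebesgue {-\<alpha><..<\<alpha>} \<mu> \<and>
      (AE t in lebesgue. -\<alpha> < t \<and> t < \<alpha> \<and> t\<^sub>0 \<le> t \<longrightarrow>
        (AE y in lebesgue. y \<in> ball 0 r \<longrightarrow> norm (u t y) \<le> \<mu> t)))"

definition filippov_regularization ::
    "(real \<Rightarrow> 'k::euclidean_space \<Rightarrow> 'm::euclidean_space) \<Rightarrow> real \<Rightarrow> 'k \<Rightarrow> 'm set" where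
  "filippov_regularization u t y =
    (\<Inter>\<delta>\<in>{0<..}. \<Inter>M\<in>null_sets lebesgue. closure (convex hull (u t ` (((+) y ` ball 0 \<delta>) - M))))"

definition utkin_first_kind ::
    "(real \<Rightarrow> real^'k \<Rightarrow> real^'m) \<Rightarrow> real \<Rightarrow> real^'k \<Rightarrow> (real^'m) set" where
  "utkin_first_kind u t y = filippov_regularization u t y"

definition utkin_second_kind ::
    "(real \<Rightarrow> real^'k \<Rightarrow> real^'m) \<Rightarrow> real \<Rightarrow> real^'k \<Rightarrow> (real^'m) set" where
  "utkin_second_kind u t y = {v. \<forall>i. v $ i \<in> filippov_regularization (\<lambda>t y. u t y $ i) t y}"

text \<open>The lifespan \<open>T\<close> may be infinite. Restricting integrability to times below an arbitrary
  real \<open>b\<close> gives integrability on the whole interval if \<open>T\<close> is finite, and local integrability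
  if \<open>T = \<infinity>\<close>.\<close>

definition utkin_solution ::
    "(real \<Rightarrow> real^'k \<Rightarrow> (real^'m) set) \<Rightarrow> (real \<Rightarrow> 'b::banach \<Rightarrow>\<^sub>L 'b) \<Rightarrow>
     ((real^'m) \<Rightarrow>\<^sub>L 'b) \<Rightarrow> ('b \<Rightarrow>\<^sub>L (real^'k)) \<Rightarrow> (real \<Rightarrow> real^'m) \<Rightarrow> real \<Rightarrow> 'b \<Rightarrow>
     ereal \<Rightarrow> (real \<Rightarrow> 'b) \<Rightarrow> (real \<Rightarrow> real^'m) \<Rightarrow> bool" where
  "utkin_solution U \<Psi> B C \<gamma> t\<^sub>0 x\<^sub>0 T x u\<^sub>e\<^sub>q \<longleftrightarrow>
    0 < T \<and>
    continuous_on {t. t\<^sub>0 \<le> t \<and> ereal t < ereal t\<^sub>0 + T} x \<and>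
    x t\<^sub>0 = x\<^sub>0 \<and>
    (\<forall>b. set_integrable lebesgue {t. t\<^sub>0 < t \<and> t < b \<and> ereal t < ereal t\<^sub>0 + T} u\<^sub>e\<^sub>q) \<and>
    (AE t in lebesgue. t\<^sub>0 < t \<and> ereal t < ereal t\<^sub>0 + T \<longrightarrow> u\<^sub>e\<^sub>q t \<in> U t (C (x t))) \<and>
    (\<forall>t. t\<^sub>0 \<le> t \<and> ereal t < ereal t\<^sub>0 + T \<longrightarrow>
      (\<exists>I. has_strong_bochner_integral (lebesgue_on {t\<^sub>0..t})
              (\<lambda>\<tau>. \<Psi> (t - \<tau>) (B (u\<^sub>e\<^sub>q \<tau> + \<gamma> \<tau>))) I \<and>
           x t = \<Psi> (t - t\<^sub>0) x\<^sub>0 + I))"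

end

theory Submission
  imports Defs "HOL-Complex_Analysis.Great_Picard"
begin

text \<open>The output \<open>y = C x\<close> of a mild solution satisfies a finite-dimensional Volterra equation
\[ y(t) = C \Psi(t - t_0) x_0 + \int_{t_0}^t C \Psi(t - \tau) B\, (v(\tau) + \gamma(\tau))\, d\tau, \]
and conversely an input \<open>v\<close> that solves this equation with \<open>v(\<tau>) \<in> K[u](\<tau>, y(\<tau>))\<close> yields a
mild solution whose output is \<open>y\<close>. The infinite-dimensional state therefore only enters through
the continuous kernel \<open>C \<Psi>(s) B\<close>, and the discontinuous feedback only through a Volterra inclusion in
Euclidean space. Every solution of the first kind is one of the second kind, because
\<open>K[u](t, y)\<close> is contained in the product of the sets \<open>K[u\<^sub>i](t, y)\<close>; so it suffices to treat \<open>K[u]\<close>.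

The inclusion (lemma \<open>inclusion_solution_exists\<close> of locale \<open>volterra\<close>) is solved by smoothing and delaying.
The feedback at \<open>(t, y)\<close> is replaced by its average over the ball of radius \<open>r\<^sub>n\<close> around \<open>y\<close>, which lies in every
set \<open>closure (convex hull u(t, ball \<setminus> M))\<close> with \<open>M\<close> null, and the output is read with delay \<open>r\<^sub>n\<close>, so that
the equation can be solved step by step (\<open>delay_equation\<close>). All inputs \<open>v\<^sub>n\<close> are dominated
by one majorant, so the outputs are equicontinuous and a subsequence converges pointwise. The inputs
themselves only converge after passing to convex combinations of their tails: these can be
chosen to converge almost everywhere (\<open>dominated_midpoints_converge\<close>, the Hilbert space argument for closest points).
Since the sets \<open>K[u]\<close> are closed and convex and the equation is linear in the input, both
the inclusion and the equation survive the limit.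

For the state, the Bochner integral of \<open>\<Psi>(t - \<tau>) B v(\<tau>)\<close> is built from Riemann-like sums in the kernel. The
pairs \<open>(\<Psi>(s) B w, \<Psi>(s) A B w)\<close> lie in the closed graph of \<open>A\<close>, hence so does the pair of
integrals (\<open>mild_integral\<close>); this gives both \<open>x(t) \<in> D\<close> and a formula for \<open>A x(t)\<close>. Subtracting \<open>B\<close> applied to
the primitive of \<open>v\<close> leaves a function that is differentiable everywhere (\<open>mild_minus_jump_derivative\<close>), and
the primitive is differentiable almost everywhere by Lebesgue's theorem, proved here from the
Vitali covering theorem.

The Filippov condition gives a majorant on a unit time interval as long as the output stays in a
ball, hence a local solution. An essentially bounded feedback has a constant majorant for all times
and all outputs, and the same construction gives a solution on the whole half line.\<close>

section \<open>Strong Bochner integrals\<close>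

abbreviation simple_integrable :: "'a measure \<Rightarrow> ('a \<Rightarrow> 'b::real_vector) \<Rightarrow> bool" where
  "simple_integrable \<equiv> Bochner_Integration.simple_bochner_integrable"

abbreviation simple_integral :: "'a measure \<Rightarrow> ('a \<Rightarrow> 'b::real_vector) \<Rightarrow> 'b" where
  "simple_integral \<equiv> Bochner_Integration.simple_bochner_integral"

lemma AE_eq_borel_measurable:
  fixes f g :: "'a \<Rightarrow> 'b::topological_space"
  assumes "complete_measure M" and g: "g \<in> borel_measurable M" and eq: "AE x in M. g x = f x"
  shows "f \<in> borel_measurable M"
proof -
  interpret complete_measure M by fact
  show ?thesis
  proof (rule borel_measurableI)
    fix S :: "'b set" assume "open S"
    then have m: "g -` S \<inter> space M \<in> sets M"
      using g by (auto intro: measurable_sets)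
    have ae: "AE x in M. x \<in> g -` S \<inter> space M \<longleftrightarrow> x \<in> f -` S \<inter> space M"
      using eq by eventually_elim auto
    show "f -` S \<inter> space M \<in> sets M"
      by (rule in_sets_AE[OF ae m]) auto
  qed
qed

lemma ennreal_tendsto_0_le:
  fixes f g :: "'a \<Rightarrow> ennreal"
  assumes "(g \<longlongrightarrow> 0) F" "\<And>i. f i \<le> g i"
  shows "(f \<longlongrightarrow> 0) F"
  by (rule tendsto_sandwich[OF _ _ tendsto_const assms(1)]) (use assms(2) in auto)

text \<open>The norms of the approximating simple functions are real functions, so
the theory of separable codomains applies to their limit; completeness absorbs the exceptional null set.
Additivity of the nonnegative integral, and with it every estimate below, rests on this measurability.\<close>

lemma strongly_measurable_norm:
  fixes f :: "'a \<Rightarrow> 'b::real_normed_vector"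
  assumes "complete_measure M" and "strongly_measurable M f"
  shows "(\<lambda>x. norm (f x)) \<in> borel_measurable M"
proof -
  obtain s where s: "\<And>i::nat. simple_function M (s i)" "AE x in M. (\<lambda>i. s i x) \<longlonglongrightarrow> f x"
    using assms(2) by (auto simp: strongly_measurable_def)
  have "(\<lambda>x. norm (s i x)) \<in> borel_measurable M" for i
    using simple_function_compose1[OF s(1)] by (rule borel_measurable_simple_function)
  then have "(\<lambda>x. lim (\<lambda>i. norm (s i x))) \<in> borel_measurable M"
    by (intro borel_measurable_lim_metric)
  moreover have "AE x in M. lim (\<lambda>i. norm (s i x)) = norm (f x)"
    using s(2) by eventually_elim (auto intro!: limI tendsto_norm)
  ultimately show ?thesis
    by (rule AE_eq_borel_measurable[OF assms(1)])
qed

lemma strongly_measurable_simple: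
  "simple_function M f \<Longrightarrow> strongly_measurable M f"
  unfolding strongly_measurable_def by (intro exI[of _ "\<lambda>_. f"]) auto

lemma strongly_measurable_compose2:
  assumes "strongly_measurable M f" "strongly_measurable M g"
    and p: "\<And>s t x y. s \<longlonglongrightarrow> x \<Longrightarrow> t \<longlonglongrightarrow> y \<Longrightarrow> (\<lambda>i. p (s i) (t i)) \<longlonglongrightarrow> p x y"
  shows "strongly_measurable M (\<lambda>x. p (f x) (g x))"
proof -
  obtain s t where s: "\<And>i::nat. simple_function M (s i)" "AE x in M. (\<lambda>i. s i x) \<longlonglongrightarrow> f x"
    and t: "\<And>i::nat. simple_function M (t i)" "AE x in M. (\<lambda>i. t i x) \<longlonglongrightarrow> g x"
    using assms(1,2) by (auto simp: strongly_measurable_def)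
  have "AE x in M. (\<lambda>i. p (s i x) (t i x)) \<longlonglongrightarrow> p (f x) (g x)"
    using s(2) t(2) by eventually_elim (rule p)
  moreover have "simple_function M (\<lambda>x. p (s i x) (t i x))" for i
    using s(1) t(1) by (rule simple_function_compose2)
  ultimately show ?thesis
    unfolding strongly_measurable_def by (intro exI[of _ "\<lambda>i x. p (s i x) (t i x)"]) auto
qed

lemma strongly_measurable_diff:
  "strongly_measurable M f \<Longrightarrow> strongly_measurable M g \<Longrightarrow> strongly_measurable M (\<lambda>x. f x - g x)"
  by (rule strongly_measurable_compose2[where p = "(-)"]) (auto intro: tendsto_diff)

lemma strongly_measurable_bounded_linear:
  assumes "bounded_linear T" "strongly_measurable M f"
  shows "strongly_measurable M (\<lambda>x. T (f x))"
  using strongly_measurable_compose2[OF assms(2,2), of "\<lambda>x _. T x"]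
    bounded_linear.tendsto[OF assms(1)] by blast

lemma simple_bochner_integrable_simple_function:
  "simple_integrable M s \<Longrightarrow> simple_function M s"
  by (auto elim: Bochner_Integration.simple_bochner_integrable.cases)

lemma has_strong_bochner_integralE:
  assumes "has_strong_bochner_integral M f I"
  obtains s where "\<And>i::nat. simple_integrable M (s i)"
    "(\<lambda>i. \<integral>\<^sup>+x. norm (f x - s i x) \<partial>M) \<longlonglongrightarrow> 0"
    "(\<lambda>i. simple_integral M (s i)) \<longlonglongrightarrow> I"
  using assms unfolding has_strong_bochner_integral_def by auto

lemma has_strong_bochner_integral_simple:
  assumes "simple_integrable M s"
  shows "has_strong_bochner_integral M s (simple_integral M s)"
  unfolding has_strong_bochner_integral_def
  by (intro conjI strongly_measurable_simple simple_bochner_integrable_simple_function assms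
      exI[of _ "\<lambda>_. s"]) (use assms in auto)

lemma norm_simple_bochner_integral_diff_le:
  fixes s t :: "'a \<Rightarrow> 'b::real_normed_vector"
  assumes s: "simple_integrable M s"
    and t: "simple_integrable M t"
  shows "ennreal (norm (simple_integral M s
      - simple_integral M t)) \<le> (\<integral>\<^sup>+x. norm (s x - t x) \<partial>M)"
proof -
  have st: "simple_integrable M (\<lambda>x. s x - t x)"
    using s t by (rule simple_bochner_integrable_compose2[where p = "(-)", rotated]) simp
  have n: "simple_integrable M (\<lambda>x. norm (s x - t x))"
    using st st by (rule simple_bochner_integrable_compose2[where p = "\<lambda>x _. norm x", rotated]) simp
  have "norm (simple_integral M s
      - simple_integral M t)
      \<le> simple_integral M (\<lambda>x. norm (s x - t x))"
    using simple_bochner_integral_norm_bound[OF st] by (simp add: simple_bochner_integral_diff s t)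
  then show ?thesis
    by (subst simple_bochner_integral_eq_nn_integral[OF n, symmetric]) (auto intro: ennreal_leI)
qed

lemma nn_integral_norm_triangle:
  fixes f g h :: "'a \<Rightarrow> 'b::real_normed_vector"
  assumes M: "complete_measure M"
    and "strongly_measurable M f" "strongly_measurable M g" "strongly_measurable M h"
  shows "(\<integral>\<^sup>+x. norm (f x - h x) \<partial>M) \<le> (\<integral>\<^sup>+x. norm (f x - g x) \<partial>M) + (\<integral>\<^sup>+x. norm (g x - h x) \<partial>M)"
proof -
  have [measurable]: "(\<lambda>x. norm (f x - g x)) \<in> borel_measurable M"
      "(\<lambda>x. norm (g x - h x)) \<in> borel_measurable M"
    using assms by (auto intro!: strongly_measurable_norm strongly_measurable_diff)
  have "(\<integral>\<^sup>+x. norm (f x - h x) \<partial>M)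
      \<le> (\<integral>\<^sup>+x. ennreal (norm (f x - g x)) + ennreal (norm (g x - h x)) \<partial>M)"
  proof (rule nn_integral_mono)
    fix x
    have "norm (f x - h x) \<le> norm (f x - g x) + norm (g x - h x)"
      using norm_triangle_ineq[of "f x - g x" "g x - h x"] by simp
    then show "ennreal (norm (f x - h x)) \<le> ennreal (norm (f x - g x)) + ennreal (norm (g x - h x))"
      by (simp flip: ennreal_plus)
  qed
  also have "\<dots> = (\<integral>\<^sup>+x. norm (f x - g x) \<partial>M) + (\<integral>\<^sup>+x. norm (g x - h x) \<partial>M)"
    by (rule nn_integral_add) auto
  finally show ?thesis .
qed

text \<open>Passing to the limit in the triangle inequality for integrals of simple functions. This
single estimate yields uniqueness and dominated convergence.\<close>

lemma has_strong_bochner_integral_dist_le: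
  fixes f g :: "'a \<Rightarrow> 'b::real_normed_vector"
  assumes M: "complete_measure M"
    and f: "has_strong_bochner_integral M f I" and g: "has_strong_bochner_integral M g J"
  shows "ennreal (norm (I - J)) \<le> (\<integral>\<^sup>+x. norm (f x - g x) \<partial>M)"
proof -
  obtain s where s: "\<And>i::nat. simple_integrable M (s i)"
      "(\<lambda>i. \<integral>\<^sup>+x. norm (f x - s i x) \<partial>M) \<longlonglongrightarrow> 0"
      "(\<lambda>i. simple_integral M (s i)) \<longlonglongrightarrow> I"
    using f by (rule has_strong_bochner_integralE) blast
  obtain t where t: "\<And>i::nat. simple_integrable M (t i)"
      "(\<lambda>i. \<integral>\<^sup>+x. norm (g x - t i x) \<partial>M) \<longlonglongrightarrow> 0"
      "(\<lambda>i. simple_integral M (t i)) \<longlonglongrightarrow> J"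
    using g by (rule has_strong_bochner_integralE) blast
  have sm: "strongly_measurable M f" "strongly_measurable M g"
    "strongly_measurable M (s i)" "strongly_measurable M (t i)" for i
    using f g s(1) t(1) by (auto simp: has_strong_bochner_integral_def
        intro!: strongly_measurable_simple simple_bochner_integrable_simple_function)
  let ?a = "\<lambda>i. \<integral>\<^sup>+x. norm (f x - s i x) \<partial>M" and ?b = "\<lambda>i. \<integral>\<^sup>+x. norm (g x - t i x) \<partial>M"
  let ?c = "\<integral>\<^sup>+x. norm (f x - g x) \<partial>M"
  let ?S = "\<lambda>i. simple_integral M (s i)"
  let ?T = "\<lambda>i. simple_integral M (t i)"
  have "ennreal (norm (?S i - ?T i)) \<le> ?a i + (?c + ?b i)" for i
  proof -
    have "ennreal (norm (?S i - ?T i)) \<le> (\<integral>\<^sup>+x. norm (s i x - t i x) \<partial>M)"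
      by (rule norm_simple_bochner_integral_diff_le[OF s(1) t(1)])
    also have "\<dots> \<le> (\<integral>\<^sup>+x. norm (s i x - f x) \<partial>M) + (\<integral>\<^sup>+x. norm (f x - t i x) \<partial>M)"
      by (rule nn_integral_norm_triangle[OF M sm(3,1,4)])
    also have "\<dots> \<le> (\<integral>\<^sup>+x. norm (s i x - f x) \<partial>M) + (?c + ?b i)"
      by (intro add_left_mono nn_integral_norm_triangle[OF M sm(1,2,4)])
    finally show ?thesis by (simp add: norm_minus_commute)
  qed
  moreover have "(\<lambda>i. ?a i + (?c + ?b i)) \<longlonglongrightarrow> 0 + (?c + 0)"
    by (intro tendsto_add tendsto_const s t)
  moreover have "(\<lambda>i. ennreal (norm (?S i - ?T i))) \<longlonglongrightarrow> ennreal (norm (I - J))"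
    by (intro tendsto_ennrealI tendsto_norm tendsto_diff s t)
  ultimately show ?thesis
    by (intro LIMSEQ_le[where X = "\<lambda>i. ennreal (norm (?S i - ?T i))"]) auto
qed

lemma has_strong_bochner_integral_unique:
  fixes f :: "'a \<Rightarrow> 'b::real_normed_vector"
  assumes M: "complete_measure M"
    and "has_strong_bochner_integral M f I" "has_strong_bochner_integral M f J"
  shows "I = J"
  using has_strong_bochner_integral_dist_le[OF assms] by simp

lemma complete_measure_lebesgue: "complete_measure (lebesgue :: 'a::euclidean_space measure)"
  ..

lemma has_strong_bochner_integral_cong:
  assumes f: "has_strong_bochner_integral M f I" and eq: "\<And>x. x \<in> space M \<Longrightarrow> f x = g x"
  shows "has_strong_bochner_integral M g I"
proof -
  have "strongly_measurable M g"
  proof -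
    obtain s where s: "\<And>i::nat. simple_function M (s i)" "AE x in M. (\<lambda>i. s i x) \<longlonglongrightarrow> f x"
      using f by (auto simp: has_strong_bochner_integral_def strongly_measurable_def)
    have "AE x in M. (\<lambda>i. s i x) \<longlonglongrightarrow> g x"
      using s(2) AE_space by eventually_elim (simp add: eq)
    with s(1) show ?thesis by (auto simp: strongly_measurable_def)
  qed
  moreover have "(\<integral>\<^sup>+x. norm (f x - s x) \<partial>M) = (\<integral>\<^sup>+x. norm (g x - s x) \<partial>M)" for s
    by (rule nn_integral_cong) (simp add: eq)
  ultimately show ?thesis
    using f unfolding has_strong_bochner_integral_def by simp
qed

lemma has_strong_bochner_integral_diff:
  fixes f g :: "'a \<Rightarrow> 'b::real_normed_vector"
  assumes M: "complete_measure M"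
    and f: "has_strong_bochner_integral M f I" and g: "has_strong_bochner_integral M g J"
  shows "has_strong_bochner_integral M (\<lambda>x. f x - g x) (I - J)"
proof -
  obtain s where s: "\<And>i::nat. simple_integrable M (s i)"
      "(\<lambda>i. \<integral>\<^sup>+x. norm (f x - s i x) \<partial>M) \<longlonglongrightarrow> 0"
      "(\<lambda>i. simple_integral M (s i)) \<longlonglongrightarrow> I"
    using f by (rule has_strong_bochner_integralE) blast
  obtain t where t: "\<And>i::nat. simple_integrable M (t i)"
      "(\<lambda>i. \<integral>\<^sup>+x. norm (g x - t i x) \<partial>M) \<longlonglongrightarrow> 0"
      "(\<lambda>i. simple_integral M (t i)) \<longlonglongrightarrow> J"
    using g by (rule has_strong_bochner_integralE) blast
  have sm: "strongly_measurable M f" "strongly_measurable M g"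
    "strongly_measurable M (s i)" "strongly_measurable M (t i)" for i
    using f g s(1) t(1) by (auto simp: has_strong_bochner_integral_def
        intro!: strongly_measurable_simple simple_bochner_integrable_simple_function)
  have [measurable]: "(\<lambda>x. norm (f x - s i x)) \<in> borel_measurable M"
      "(\<lambda>x. norm (g x - t i x)) \<in> borel_measurable M" for i
    using sm by (auto intro!: strongly_measurable_norm[OF M] strongly_measurable_diff)
  have le: "(\<integral>\<^sup>+x. norm (f x - g x - (s i x - t i x)) \<partial>M)
      \<le> (\<integral>\<^sup>+x. norm (f x - s i x) \<partial>M) + (\<integral>\<^sup>+x. norm (g x - t i x) \<partial>M)" for i
  proof -
    have "norm (f x - g x - (s i x - t i x)) \<le> norm (f x - s i x) + norm (g x - t i x)" for x
      using norm_triangle_ineq4[of "f x - s i x" "g x - t i x"] by (simp add: algebra_simps)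
    then have "(\<integral>\<^sup>+x. norm (f x - g x - (s i x - t i x)) \<partial>M)
      \<le> (\<integral>\<^sup>+x. ennreal (norm (f x - s i x)) + ennreal (norm (g x - t i x)) \<partial>M)"
      by (intro nn_integral_mono) (auto simp flip: ennreal_plus)
    then show ?thesis by (simp add: nn_integral_add)
  qed
  have "(\<lambda>i. (\<integral>\<^sup>+x. norm (f x - s i x) \<partial>M) + (\<integral>\<^sup>+x. norm (g x - t i x) \<partial>M)) \<longlonglongrightarrow> 0"
    using tendsto_add[OF s(2) t(2)] by simp
  then have "(\<lambda>i. \<integral>\<^sup>+x. norm (f x - g x - (s i x - t i x)) \<partial>M) \<longlonglongrightarrow> 0"
    by (rule ennreal_tendsto_0_le) (use le in simp)
  moreover have "simple_integrable M (\<lambda>x. s i x - t i x)" for i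
    using s(1) t(1) by (rule simple_bochner_integrable_compose2[where p = "(-)", rotated]) simp
  moreover have "(\<lambda>i. simple_integral M (\<lambda>x. s i x - t i x)) \<longlonglongrightarrow> I - J"
    by (auto simp: simple_bochner_integral_diff s(1) t(1) intro!: tendsto_diff s t)
  ultimately show ?thesis
    unfolding has_strong_bochner_integral_def
    by (intro conjI strongly_measurable_diff sm exI[of _ "\<lambda>i x. s i x - t i x"]) auto
qed

lemma has_strong_bochner_integral_bounded_linear:
  fixes f :: "'a \<Rightarrow> 'b::real_normed_vector" and T :: "'b \<Rightarrow> 'c::real_normed_vector"
  assumes M: "complete_measure M" and T: "bounded_linear T"
    and f: "has_strong_bochner_integral M f I"
  shows "has_strong_bochner_integral M (\<lambda>x. T (f x)) (T I)"
proof -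
  interpret T: bounded_linear T by fact
  obtain s where s: "\<And>i::nat. simple_integrable M (s i)"
      "(\<lambda>i. \<integral>\<^sup>+x. norm (f x - s i x) \<partial>M) \<longlonglongrightarrow> 0"
      "(\<lambda>i. simple_integral M (s i)) \<longlonglongrightarrow> I"
    using f by (rule has_strong_bochner_integralE) blast
  have sm: "strongly_measurable M f" "strongly_measurable M (s i)" for i
    using f s(1) by (auto simp: has_strong_bochner_integral_def
        intro!: strongly_measurable_simple simple_bochner_integrable_simple_function)
  have [measurable]: "(\<lambda>x. norm (f x - s i x)) \<in> borel_measurable M" for i
    using sm by (auto intro!: strongly_measurable_norm[OF M] strongly_measurable_diff)
  obtain K where K: "K > 0" "\<And>x i. norm (T (f x) - T (s i x)) \<le> norm (f x - s i x) * K"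
    using T.pos_bounded by (auto simp: T.diff[symmetric])
  have le: "(\<integral>\<^sup>+x. norm (T (f x) - T (s i x)) \<partial>M) \<le> ennreal K * (\<integral>\<^sup>+x. norm (f x - s i x) \<partial>M)" for i
  proof -
    have "(\<integral>\<^sup>+x. norm (T (f x) - T (s i x)) \<partial>M) \<le> (\<integral>\<^sup>+x. ennreal K * norm (f x - s i x) \<partial>M)"
      using K by (intro nn_integral_mono) (auto simp: ac_simps ennreal_mult[symmetric])
    then show ?thesis by (simp add: nn_integral_cmult)
  qed
  have "(\<lambda>i. ennreal K * (\<integral>\<^sup>+x. norm (f x - s i x) \<partial>M)) \<longlonglongrightarrow> 0"
    using ennreal_tendsto_cmult[OF _ s(2), of "ennreal K"] by simp
  then have "(\<lambda>i. \<integral>\<^sup>+x. norm (T (f x) - T (s i x)) \<partial>M) \<longlonglongrightarrow> 0"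
    by (rule ennreal_tendsto_0_le) (use le in simp)
  moreover have "simple_integrable M (\<lambda>x. T (s i x))" for i
    using s(1) s(1) by (rule simple_bochner_integrable_compose2[where p = "\<lambda>x _. T x", rotated])
      (simp add: T.zero)
  moreover have "(\<lambda>i. simple_integral M (\<lambda>x. T (s i x))) \<longlonglongrightarrow> T I"
    by (subst simple_bochner_integral_linear[OF T.linear_axioms s(1)]) (intro T.tendsto s)
  ultimately show ?thesis
    unfolding has_strong_bochner_integral_def
    by (intro conjI strongly_measurable_bounded_linear[OF T] sm exI[of _ "\<lambda>i x. T (s i x)"]) auto
qed

text \<open>Dominated convergence needs only the scalar theorem, applied to the norms of the differences, once the integrals of
the terms and of the limit are known to exist.\<close>

lemma has_strong_bochner_integral_tendsto:
  fixes f :: "nat \<Rightarrow> 'a \<Rightarrow> 'b::real_normed_vector" and m :: "'a \<Rightarrow> real"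
  assumes M: "complete_measure M"
    and f: "\<And>n. has_strong_bochner_integral M (f n) (I n)"
    and g: "has_strong_bochner_integral M g J"
    and m: "integrable M m" and bound: "\<And>n. AE x in M. norm (f n x - g x) \<le> m x"
    and lim: "AE x in M. (\<lambda>n. f n x) \<longlonglongrightarrow> g x"
  shows "I \<longlonglongrightarrow> J"
proof -
  have sm: "strongly_measurable M (f n)" "strongly_measurable M g" for n
    using f g by (auto simp: has_strong_bochner_integral_def)
  have meas: "(\<lambda>x. norm (f n x - g x)) \<in> borel_measurable M" for n
    using sm by (auto intro!: strongly_measurable_norm[OF M] strongly_measurable_diff)
  have lim0: "AE x in M. (\<lambda>n. norm (f n x - g x)) \<longlonglongrightarrow> 0"
    using lim by eventually_elim (auto simp: tendsto_norm_zero_iff LIM_zero_iff)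
  have "(\<lambda>n. LINT x|M. norm (f n x - g x)) \<longlonglongrightarrow> (LINT x|M. 0)"
    by (rule integral_dominated_convergence[where w = m])
      (use meas m bound lim0 in auto)
  then have lim1: "(\<lambda>n. LINT x|M. norm (f n x - g x)) \<longlonglongrightarrow> 0" by simp
  have "norm (I n - J) \<le> (LINT x|M. norm (f n x - g x))" for n
  proof -
    have "integrable M (\<lambda>x. norm (f n x - g x))"
      by (rule Bochner_Integration.integrable_bound[OF m meas]) (use bound[of n] in auto)
    then have "(\<integral>\<^sup>+x. norm (f n x - g x) \<partial>M) = ennreal (LINT x|M. norm (f n x - g x))"
      by (intro nn_integral_eq_integral) auto
    with has_strong_bochner_integral_dist_le[OF M f g, of n] show ?thesis
      by (simp add: Bochner_Integration.integral_nonneg)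
  qed
  then have "(\<lambda>n. I n - J) \<longlonglongrightarrow> 0"
    by (intro Lim_null_comparison[OF _ lim1]) auto
  then show ?thesis by (simp add: LIM_zero_iff)
qed

lemma has_strong_bochner_integral_restrict_space:
  fixes f :: "'a \<Rightarrow> 'b::real_normed_vector"
  assumes M: "complete_measure M" and A: "A \<in> sets M" and f0: "\<And>x. x \<notin> A \<Longrightarrow> f x = 0"
    and f: "has_strong_bochner_integral M f I"
  shows "has_strong_bochner_integral (restrict_space M A) f I"
proof -
  have A': "A \<inter> space M \<in> sets M" using A by auto
  obtain r where r: "\<And>i::nat. simple_function M (r i)" "AE x in M. (\<lambda>i. r i x) \<longlonglongrightarrow> f x"
    using f by (auto simp: has_strong_bochner_integral_def strongly_measurable_def)
  have simple: "simple_function (restrict_space M A) s" if "simple_function M s" for s :: "'a \<Rightarrow> 'b"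
  proof -
    have "simple_function M (\<lambda>x. indicator A x *\<^sub>R s x)"
      using that A by (intro simple_function_compose2[where h = "(*\<^sub>R)"] simple_function_indicator) auto
    then show ?thesis
      using A' by (subst simple_function_restrict_space) auto
  qed
  have "strongly_measurable (restrict_space M A) f"
    unfolding strongly_measurable_def
    by (intro exI[of _ r]) (use r simple in \<open>auto simp: AE_restrict_space_iff[OF A']\<close>)
  moreover
  obtain s where s: "\<And>i::nat. simple_integrable M (s i)"
      "(\<lambda>i. \<integral>\<^sup>+x. norm (f x - s i x) \<partial>M) \<longlonglongrightarrow> 0"
      "(\<lambda>i. simple_integral M (s i)) \<longlonglongrightarrow> I"
    using f by (rule has_strong_bochner_integralE) blast
  define t where "t i x = indicator A x *\<^sub>R s i x" for i x
  have t1: "simple_integrable M (t i)" for i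
  proof (rule Bochner_Integration.simple_bochner_integrable.intros)
    show "simple_function M (t i)"
      unfolding t_def using simple_bochner_integrable_simple_function[OF s(1)] A
      by (intro simple_function_compose2[where h = "(*\<^sub>R)"] simple_function_indicator) auto
    have fin: "emeasure M {y \<in> space M. s i y \<noteq> 0} \<noteq> \<infinity>"
      using s(1)[of i] by (auto elim: Bochner_Integration.simple_bochner_integrable.cases)
    have "{y \<in> space M. s i y \<noteq> 0} \<in> sets M"
      using simple_functionD(2)[OF simple_bochner_integrable_simple_function[OF s(1)], of i "-{0}"]
      by (auto simp: vimage_def Collect_conj_eq Int_commute)
    then have "emeasure M {y \<in> space M. t i y \<noteq> 0} \<le> emeasure M {y \<in> space M. s i y \<noteq> 0}"
      by (intro emeasure_mono) (auto simp: t_def)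
    with fin show "emeasure M {y \<in> space M. t i y \<noteq> 0} \<noteq> \<infinity>"
      by (auto simp: top_unique)
  qed
  have le: "(\<integral>\<^sup>+x. norm (f x - t i x) \<partial>restrict_space M A) \<le> (\<integral>\<^sup>+x. norm (f x - s i x) \<partial>M)" for i
    by (subst nn_integral_restrict_space[OF A'])
      (auto intro!: nn_integral_mono simp: t_def indicator_def)
  have "(\<lambda>i. \<integral>\<^sup>+x. norm (f x - t i x) \<partial>restrict_space M A) \<longlonglongrightarrow> 0"
    by (rule ennreal_tendsto_0_le[OF s(2)]) (use le in simp)
  moreover have t2: "(\<lambda>i. \<integral>\<^sup>+x. norm (f x - t i x) \<partial>M) \<longlonglongrightarrow> 0"
    by (rule ennreal_tendsto_0_le[OF s(2)])
      (auto intro!: nn_integral_mono simp: t_def indicator_def f0)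
  have "(\<lambda>i. simple_integral M (t i)) \<longlonglongrightarrow> I"
  proof -
    have h: "has_strong_bochner_integral M (s i) (simple_integral M (s i))"
      "has_strong_bochner_integral M (t i) (simple_integral M (t i))" for i
      using s(1) t1 by (auto intro: has_strong_bochner_integral_simple)
    have "ennreal (norm (simple_integral M (t i) - I)) \<le> (\<integral>\<^sup>+x. norm (t i x - f x) \<partial>M)" for i
      by (rule has_strong_bochner_integral_dist_le[OF M h(2) f])
    then have "(\<lambda>i. ennreal (norm (simple_integral M (t i) - I))) \<longlonglongrightarrow> 0"
      by (intro ennreal_tendsto_0_le[OF t2]) (auto simp: norm_minus_commute)
    then have "(\<lambda>i. norm (simple_integral M (t i) - I)) \<longlonglongrightarrow> 0"
      by (metis ennreal_0 norm_ge_zero order_refl tendsto_ennreal_iff always_eventually)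
    then show ?thesis
      by (simp add: tendsto_norm_zero_iff LIM_zero_iff)
  qed
  moreover have tA: "(\<lambda>x. indicator A x *\<^sub>R t i x) = t i" for i
    by (auto simp: t_def indicator_def)
  have t3: "simple_integrable (restrict_space M A) (t i)" for i
    using t1[of i] by (subst simple_bochner_integrable_restrict_space[OF A']) (simp_all add: tA)
  moreover have "simple_integral (restrict_space M A) (t i)
      = simple_integral M (t i)" for i
    using t3 by (subst simple_bochner_integral_restrict_space[OF A']) (simp_all add: tA)
  ultimately show ?thesis
    unfolding has_strong_bochner_integral_def by (intro conjI exI[of _ t]) auto
qed

lemma has_strong_bochner_integral_approx:
  fixes f :: "'a \<Rightarrow> 'b::banach"
  assumes M: "complete_measure M" and f: "strongly_measurable M f"
    and s: "\<And>i::nat. simple_integrable M (s i)"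
    and lim: "(\<lambda>i. \<integral>\<^sup>+x. norm (f x - s i x) \<partial>M) \<longlonglongrightarrow> 0"
  obtains I where "has_strong_bochner_integral M f I"
    "(\<lambda>i. simple_integral M (s i)) \<longlonglongrightarrow> I"
proof -
  let ?S = "\<lambda>i. simple_integral M (s i)"
  let ?a = "\<lambda>i. \<integral>\<^sup>+x. norm (f x - s i x) \<partial>M"
  have sm: "strongly_measurable M (s i)" for i
    using s by (auto intro!: strongly_measurable_simple simple_bochner_integrable_simple_function)
  have le: "ennreal (norm (?S i - ?S j)) \<le> ?a i + ?a j" for i j
  proof -
    have "ennreal (norm (?S i - ?S j)) \<le> (\<integral>\<^sup>+x. norm (s i x - s j x) \<partial>M)"
      by (rule norm_simple_bochner_integral_diff_le[OF s s])
    also have "\<dots> \<le> (\<integral>\<^sup>+x. norm (s i x - f x) \<partial>M) + ?a j"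
      by (rule nn_integral_norm_triangle[OF M sm f sm])
    finally show ?thesis by (simp add: norm_minus_commute)
  qed
  have "Cauchy ?S"
  proof (rule CauchyI)
    fix e :: real assume e: "0 < e"
    then have "eventually (\<lambda>i. ?a i < ennreal (e / 2)) sequentially"
      by (intro order_tendstoD[OF lim]) simp
    then obtain N where N: "\<And>i. i \<ge> N \<Longrightarrow> ?a i < ennreal (e / 2)"
      by (auto simp: eventually_sequentially)
    have "norm (?S i - ?S j) < e" if "i \<ge> N" "j \<ge> N" for i j
    proof -
      have "ennreal (norm (?S i - ?S j)) < ennreal (e / 2) + ennreal (e / 2)"
        using le N[OF that(1)] N[OF that(2)] by (intro le_less_trans[OF le] add_strict_mono)
      also have "\<dots> = ennreal e"
        using e by (simp flip: ennreal_plus)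
      finally show ?thesis by (simp add: ennreal_less_iff)
    qed
    then show "\<exists>N. \<forall>i\<ge>N. \<forall>j\<ge>N. norm (?S i - ?S j) < e" by blast
  qed
  then obtain I where "?S \<longlonglongrightarrow> I"
    using Cauchy_convergent convergent_def by blast
  with that show ?thesis
    unfolding has_strong_bochner_integral_def using f s lim by blast
qed

text \<open>The source of all vector-valued integrals in this development. A continuous operator
kernel is uniformly close to a step kernel, and a step kernel applied to a simple function is simple. The
values of the approximating sums are finite combinations of vectors \<open>R \<tau> w\<close>, which is why the
integral inherits membership in a closed subspace.\<close>

lemma has_strong_bochner_integral_kernel:
  fixes R :: "real \<Rightarrow> 'm::euclidean_space \<Rightarrow>\<^sub>L 'c::banach" and v :: "real \<Rightarrow> 'm"
  assumes R: "continuous_on {a..b} R" and "a \<le> b"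
    and v: "integrable lebesgue v" and v0: "\<And>\<tau>. \<tau> \<notin> {a..b} \<Longrightarrow> v \<tau> = 0"
    and S: "subspace S" "closed S" and RS: "\<And>\<tau> w. \<tau> \<in> {a..b} \<Longrightarrow> R \<tau> w \<in> S"
  obtains I where "I \<in> S" "has_strong_bochner_integral lebesgue (\<lambda>\<tau>. R \<tau> (v \<tau>)) I"
proof -
  note M = complete_measure_lebesgue[where 'a = real]
  \<comment> \<open>Rounding down to multiples of \<open>1 / (n + 1)\<close>, clamped to the interval where \<open>R\<close> is continuous.\<close>
  define c :: "nat \<Rightarrow> real \<Rightarrow> real"
    where "c n \<tau> = max a (min b (real_of_int \<lfloor>real (Suc n) * \<tau>\<rfloor> / real (Suc n)))" for n \<tau>
  have cab: "c n \<tau> \<in> {a..b}" for n \<tau>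
    using \<open>a \<le> b\<close> by (auto simp: c_def)
  have cdist: "\<bar>c n \<tau> - \<tau>\<bar> \<le> 1 / real (Suc n)" if "\<tau> \<in> {a..b}" for n \<tau>
  proof -
    let ?q = "real_of_int \<lfloor>real (Suc n) * \<tau>\<rfloor> / real (Suc n)"
    have "?q \<le> \<tau>" by (simp add: divide_simps mult.commute) 
    moreover have "\<tau> - 1 / real (Suc n) \<le> ?q"
    proof (subst pos_le_divide_eq)
      have "(\<tau> - 1 / real (Suc n)) * real (Suc n) = real (Suc n) * \<tau> - 1"
        by (simp add: field_simps del: of_nat_Suc)
      then show "(\<tau> - 1 / real (Suc n)) * real (Suc n) \<le> real_of_int \<lfloor>real (Suc n) * \<tau>\<rfloor>"
        by linarith
    qed simp
    ultimately show ?thesis using that unfolding c_def by (auto simp: max_def min_def)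
  qed
  have csimple: "simple_function lebesgue (c n)" for n
  proof (rule simple_function_borel_measurable)
    have "c n \<in> borel_measurable lborel"
      unfolding c_def by measurable
    then show "c n \<in> borel_measurable lebesgue"
      by (rule measurable_completion)
    let ?J = "{\<lfloor>a * real (Suc n)\<rfloor>..\<lceil>b * real (Suc n)\<rceil>}"
    have "c n ` space lebesgue \<subseteq> {a, b} \<union> (\<lambda>j. real_of_int j / real (Suc n)) ` ?J"
    proof (rule image_subsetI, rule ccontr)
      fix \<tau>
      let ?j = "\<lfloor>real (Suc n) * \<tau>\<rfloor>"
      assume *: "c n \<tau> \<notin> {a, b} \<union> (\<lambda>j. real_of_int j / real (Suc n)) ` ?J"
      then have eq: "c n \<tau> = real_of_int ?j / real (Suc n)"
        and "a \<le> real_of_int ?j / real (Suc n)" "real_of_int ?j / real (Suc n) \<le> b"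
        unfolding c_def by (auto simp: max_def min_def split: if_splits)
      then have "a * real (Suc n) \<le> real_of_int ?j" "real_of_int ?j \<le> b * real (Suc n)"
        by (auto simp: field_simps)
      then have "?j \<in> ?J"
        by (auto simp: floor_le_iff le_ceiling_iff)
      with eq * show False by blast
    qed
    then show "finite (c n ` space lebesgue)"
      by (rule finite_subset) auto
  qed
  have RcR: "\<exists>e. e \<longlonglongrightarrow> 0 \<and> (\<forall>n. \<forall>\<tau>\<in>{a..b}. norm (R \<tau> - R (c n \<tau>)) \<le> e n)"
  proof -
    have uc: "uniformly_continuous_on {a..b} R"
      using R by (rule compact_uniformly_continuous) simp
    define e where "e n = (SUP \<tau>\<in>{a..b}. norm (R \<tau> - R (c n \<tau>)))" for n
    obtain K where K: "\<And>\<tau>. \<tau> \<in> {a..b} \<Longrightarrow> norm (R \<tau>) \<le> K"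
      using compact_imp_bounded[OF compact_continuous_image[OF R compact_Icc]]
      unfolding bounded_iff by blast
    have bdd: "bdd_above ((\<lambda>\<tau>. norm (R \<tau> - R (c n \<tau>))) ` {a..b})" for n
    proof (rule bdd_aboveI2)
      fix \<tau> assume "\<tau> \<in> {a..b}"
      then show "norm (R \<tau> - R (c n \<tau>)) \<le> K + K"
        by (intro order.trans[OF norm_triangle_ineq4 add_mono[OF K K]] cab)
    qed
    have "e \<longlonglongrightarrow> 0"
    proof (rule LIMSEQ_I)
      fix r :: real assume "0 < r"
      then obtain d where d: "d > 0"
        "\<And>x y. x \<in> {a..b} \<Longrightarrow> y \<in> {a..b} \<Longrightarrow> dist y x < d \<Longrightarrow> dist (R y) (R x) < r / 2"
        using uc unfolding uniformly_continuous_on_def by (metis half_gt_zero)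
      obtain N where N: "inverse (real (Suc N)) < d"
        using reals_Archimedean[OF d(1)] by blast
      have "norm (e n - 0) < r" if "n \<ge> N" for n
      proof -
        have "1 / real (Suc n) \<le> inverse (real (Suc N))"
          using that by (simp add: divide_simps)
        then have "norm (R \<tau> - R (c n \<tau>)) \<le> r / 2" if "\<tau> \<in> {a..b}" for \<tau>
          using d(2)[of "c n \<tau>" \<tau>] cab that cdist[OF that, of n] N
          by (auto simp: dist_norm norm_minus_commute abs_minus_commute intro!: less_imp_le)
        then have "e n \<le> r / 2"
          unfolding e_def using \<open>a \<le> b\<close> by (intro cSUP_least) auto
        moreover have "0 \<le> e n"
          unfolding e_def using \<open>a \<le> b\<close> by (intro cSUP_upper2[OF bdd, of a]) auto
        ultimately show ?thesis using \<open>0 < r\<close> by simp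
      qed
      then show "\<exists>N. \<forall>n\<ge>N. norm (e n - 0) < r" by blast
    qed
    moreover have "norm (R \<tau> - R (c n \<tau>)) \<le> e n" if "\<tau> \<in> {a..b}" for n \<tau>
      unfolding e_def using that by (intro cSUP_upper bdd)
    ultimately show ?thesis by blast
  qed
  then obtain e where e: "e \<longlonglongrightarrow> 0"
    and Re: "\<And>n \<tau>. \<tau> \<in> {a..b} \<Longrightarrow> norm (R \<tau> - R (c n \<tau>)) \<le> e n"
    by blast
  have e0: "0 \<le> e n" for n
    using order.trans[OF norm_ge_zero Re[of a n]] \<open>a \<le> b\<close> by auto
  have Rc: "(\<lambda>n. R (c n \<tau>)) \<longlonglongrightarrow> R \<tau>" if "\<tau> \<in> {a..b}" for \<tau>
  proof -
    have "(\<lambda>n. R (c n \<tau>) - R \<tau>) \<longlonglongrightarrow> 0"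
      by (rule Lim_null_comparison[OF _ e]) (use Re[OF that] in \<open>simp add: norm_minus_commute\<close>)
    then show ?thesis by (simp add: LIM_zero_iff)
  qed
  obtain K where K: "\<And>\<tau>. \<tau> \<in> {a..b} \<Longrightarrow> norm (R \<tau>) \<le> K" and "0 \<le> K"
  proof -
    obtain K where "\<And>\<tau>. \<tau> \<in> {a..b} \<Longrightarrow> norm (R \<tau>) \<le> K"
      using compact_imp_bounded[OF compact_continuous_image[OF R compact_Icc]]
      unfolding bounded_iff by blast
    then show thesis by (intro that[of "max K 0"]) (auto intro: max.coboundedI1)
  qed
  have vm [measurable]: "v \<in> borel_measurable lebesgue"
    using v by (rule borel_measurable_integrable)
  have simple: "simple_function lebesgue (\<lambda>\<tau>. R (c n \<tau>) (s \<tau>))" if "simple_function lebesgue s" for s n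
    using csimple that by (rule simple_function_compose2[where h = "\<lambda>x y. R x y"])
  have "strongly_measurable lebesgue (\<lambda>\<tau>. R \<tau> (v \<tau>))"
  proof -
    obtain s where s: "\<And>i. simple_function lebesgue (s i)"
      "\<And>x. (\<lambda>i. s i x) \<longlonglongrightarrow> v x" "\<And>i x. norm (s i x) \<le> 2 * norm (v x)"
      using borel_measurable_implies_sequence_metric[OF vm, of 0]
      by (auto simp: dist_norm)
    have "(\<lambda>i. R (c i \<tau>) (s i \<tau>)) \<longlonglongrightarrow> R \<tau> (v \<tau>)" for \<tau>
    proof (cases "\<tau> \<in> {a..b}")
      case True
      then show ?thesis by (intro blinfun.tendsto Rc s)
    next
      case False
      then have "s i \<tau> = 0" for i using s(3)[of i \<tau>] v0 by simp
      with False v0 show ?thesis by (simp add: blinfun.zero_right)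
    qed
    then show ?thesis
      unfolding strongly_measurable_def
      by (intro exI[of _ "\<lambda>i \<tau>. R (c i \<tau>) (s i \<tau>)"]) (auto intro!: simple s)
  qed
  moreover
  obtain I0 where "has_bochner_integral lebesgue v I0"
    using v by (auto simp: integrable.simps)
  then obtain s where s: "\<And>i. simple_integrable lebesgue (s i)"
    and sv: "(\<lambda>i. \<integral>\<^sup>+x. norm (v x - s i x) \<partial>lebesgue) \<longlonglongrightarrow> 0"
    by (rule has_bochner_integral.cases) blast
  have sm [measurable]: "s i \<in> borel_measurable lebesgue" for i
    using s by (intro borel_measurable_simple_function simple_bochner_integrable_simple_function)
  define \<sigma> where "\<sigma> i \<tau> = R (c i \<tau>) (s i \<tau>)" for i \<tau>
  have \<sigma>: "simple_integrable lebesgue (\<sigma> i)" for i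
  proof (rule Bochner_Integration.simple_bochner_integrable.intros)
    show "simple_function lebesgue (\<sigma> i)"
      unfolding \<sigma>_def by (intro simple simple_bochner_integrable_simple_function s)
    have fin: "emeasure lebesgue {y \<in> space lebesgue. s i y \<noteq> 0} \<noteq> \<infinity>"
      using s(1)[of i] by (auto elim: Bochner_Integration.simple_bochner_integrable.cases)
    have "{y \<in> space lebesgue. s i y \<noteq> 0} \<in> sets lebesgue" by measurable
    then have "emeasure lebesgue {y \<in> space lebesgue. \<sigma> i y \<noteq> 0} \<le> emeasure lebesgue {y \<in> space lebesgue. s i y \<noteq> 0}"
      by (intro emeasure_mono) (auto simp: \<sigma>_def blinfun.zero_right)
    with fin show "emeasure lebesgue {y \<in> space lebesgue. \<sigma> i y \<noteq> 0} \<noteq> \<infinity>"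
      by (auto simp: top_unique)
  qed
  have "(\<lambda>i. \<integral>\<^sup>+x. norm (R x (v x) - \<sigma> i x) \<partial>lebesgue) \<longlonglongrightarrow> 0"
  proof (rule ennreal_tendsto_0_le)
    let ?V = "\<integral>\<^sup>+x. norm (v x) \<partial>lebesgue"
    have V: "?V < \<infinity>" using v by (simp add: integrable_iff_bounded)
    have 1: "(\<lambda>i. ?V * ennreal (e i)) \<longlonglongrightarrow> ?V * ennreal 0"
      using V by (intro ennreal_tendsto_cmult tendsto_ennrealI e) (simp add: less_top)
    have 2: "(\<lambda>i. ennreal K * (\<integral>\<^sup>+x. norm (v x - s i x) \<partial>lebesgue)) \<longlonglongrightarrow> ennreal K * 0"
      by (intro ennreal_tendsto_cmult sv) simp
    show "(\<lambda>i. ennreal (e i) * ?V + ennreal K * (\<integral>\<^sup>+x. norm (v x - s i x) \<partial>lebesgue)) \<longlonglongrightarrow> 0"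
      using tendsto_add[OF 1 2] by (simp add: mult.commute[of ?V])
    fix i
    have pt: "norm (R x (v x) - \<sigma> i x) \<le> e i * norm (v x) + K * norm (v x - s i x)" for x
    proof -
      have "R x (v x) - \<sigma> i x = (R x - R (c i x)) (v x) + R (c i x) (v x - s i x)"
        by (simp add: \<sigma>_def blinfun.diff_left blinfun.diff_right)
      moreover have "norm ((R x - R (c i x)) (v x)) \<le> e i * norm (v x)"
      proof (cases "x \<in> {a..b}")
        case True
        then show ?thesis
          by (intro order.trans[OF norm_blinfun] mult_right_mono Re) auto
      next
        case False
        then show ?thesis by (simp add: v0 blinfun.zero_right)
      qed
      moreover have "norm (R (c i x) (v x - s i x)) \<le> K * norm (v x - s i x)"
        by (intro order.trans[OF norm_blinfun] mult_right_mono K cab) auto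
      ultimately show ?thesis
        using norm_triangle_ineq[of "(R x - R (c i x)) (v x)" "R (c i x) (v x - s i x)"] by simp
    qed
    have "(\<integral>\<^sup>+x. norm (R x (v x) - \<sigma> i x) \<partial>lebesgue)
        \<le> (\<integral>\<^sup>+x. ennreal (e i) * norm (v x) + ennreal K * norm (v x - s i x) \<partial>lebesgue)"
      using pt e0 \<open>0 \<le> K\<close> by (intro nn_integral_mono)
        (auto simp flip: ennreal_mult ennreal_plus intro!: ennreal_leI)
    also have "\<dots> = ennreal (e i) * ?V + ennreal K * (\<integral>\<^sup>+x. norm (v x - s i x) \<partial>lebesgue)"
      by (simp add: nn_integral_add nn_integral_cmult)
    finally show "(\<integral>\<^sup>+x. norm (R x (v x) - \<sigma> i x) \<partial>lebesgue)
        \<le> ennreal (e i) * ?V + ennreal K * (\<integral>\<^sup>+x. norm (v x - s i x) \<partial>lebesgue)" .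
  qed
  ultimately obtain I where I: "has_strong_bochner_integral lebesgue (\<lambda>\<tau>. R \<tau> (v \<tau>)) I"
    "(\<lambda>i. simple_integral lebesgue (\<sigma> i)) \<longlonglongrightarrow> I"
    by (rule has_strong_bochner_integral_approx[OF M _ \<sigma>])
  have "simple_integral lebesgue (\<sigma> i) \<in> S" for i
    unfolding Bochner_Integration.simple_bochner_integral_def
    by (intro subspace_sum subspace_scale S(1)) (auto simp: \<sigma>_def intro!: RS cab)
  then have "I \<in> S"
    by (intro Lim_in_closed_set[OF S(2) _ _ I(2)]) auto
  with I(1) that show ?thesis by blast
qed

section \<open>Strongly continuous semigroups\<close>

text \<open>The Banach-Steinhaus theorem, by Baire category: one of the closed sets on which the whole family is bounded
by \<open>n\<close> contains a ball, and a ball controls the operator norms.\<close>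

lemma uniform_boundedness:
  fixes T :: "'i \<Rightarrow> 'a::banach \<Rightarrow>\<^sub>L 'b::real_normed_vector"
  assumes pw: "\<And>x. \<exists>K. \<forall>i\<in>I. norm (T i x) \<le> K"
  shows "\<exists>K. \<forall>i\<in>I. norm (T i) \<le> K"
proof -
  define E where "E n = {x. \<forall>i\<in>I. norm (T i x) \<le> real n}" for n
  have "x \<in> (\<Union>n. E n)" for x
  proof -
    obtain K where "\<forall>i\<in>I. norm (T i x) \<le> K" using pw by blast
    moreover obtain n where "K \<le> real n" using real_arch_simple by blast
    ultimately show ?thesis unfolding E_def by (auto intro!: exI[of _ n] intro: order.trans)
  qed
  then have UN: "(\<Union>n. E n) = UNIV" by blast
  have cl: "closed (E n)" for n
  proof -
    have "E n = (\<Inter>i\<in>I. {x. norm (T i x) \<le> real n})" by (auto simp: E_def)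
    then show ?thesis
      by (auto intro!: closed_INT closed_Collect_le continuous_intros)
  qed
  obtain n where "interior (E n) \<noteq> {}"
  proof (rule ccontr)
    assume "\<not> thesis"
    then have "\<And>n. interior (E n) = {}" using that by blast
    then have "euclidean interior_of \<Union>(range E) = {}"
      using completely_metrizable_space_euclidean cl
      by (intro Baire_category_alt) (auto simp: euclidean_interior_of)
    then show False using UN by simp
  qed
  then obtain a where "a \<in> interior (E n)" by blast
  then obtain e where e: "e > 0" "cball a e \<subseteq> E n"
    by (meson interior_subset mem_interior_cball subset_trans)
  have "norm (T i) \<le> 2 * real n / e" if i: "i \<in> I" for i
  proof (rule norm_blinfun_bound)
    show "0 \<le> 2 * real n / e" using e by simp
    fix x
    show "norm (T i x) \<le> 2 * real n / e * norm x"
    proof (cases "x = 0")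
      case False
      define y where "y = (e / norm x) *\<^sub>R x"
      have "norm y = e" using False e by (simp add: y_def)
      then have "a + y \<in> E n" "a \<in> E n" using e by (auto simp: dist_norm intro!: subsetD[OF e(2)])
      then have "norm (T i (a + y)) \<le> real n" "norm (T i a) \<le> real n"
        using i by (auto simp: E_def)
      moreover have "T i y = T i (a + y) - T i a" by (simp add: blinfun.add_right)
      ultimately have "norm (T i y) \<le> 2 * real n"
        using norm_triangle_ineq4[of "T i (a + y)" "T i a"] by simp
      moreover have "norm (T i y) = e / norm x * norm (T i x)"
        using e by (simp add: y_def blinfun.scaleR_right)
      ultimately show ?thesis using False e by (simp add: field_simps)
    qed (simp add: blinfun.zero_right)
  qed
  then show ?thesis by blast
qed

lemma has_vector_derivative_iff_quotient:
  "(f has_vector_derivative f') (at x within S) \<longleftrightarrow>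
    ((\<lambda>y. (f y - f x) /\<^sub>R (y - x)) \<longlongrightarrow> f') (at x within S)"
proof -
  have eq: "norm (f y - f x - (y - x) *\<^sub>R f') / norm (y - x) = norm ((f y - f x) /\<^sub>R (y - x) - f')"
    if "y \<noteq> x" for y
  proof -
    have "(f y - f x) /\<^sub>R (y - x) - f' = (f y - f x - (y - x) *\<^sub>R f') /\<^sub>R (y - x)"
      using that by (simp add: scaleR_diff_right)
    then show ?thesis by (simp add: divide_inverse mult.commute)
  qed
  have "(f has_vector_derivative f') (at x within S) \<longleftrightarrow>
    ((\<lambda>y. norm (f y - f x - (y - x) *\<^sub>R f') / norm (y - x)) \<longlongrightarrow> 0) (at x within S)"
    by (simp add: has_vector_derivative_def has_derivative_iff_norm bounded_linear_scaleR_left)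
  also have "\<dots> \<longleftrightarrow> ((\<lambda>y. norm ((f y - f x) /\<^sub>R (y - x) - f')) \<longlongrightarrow> 0) (at x within S)"
    by (rule filterlim_cong) (auto simp: eventually_at_filter eq intro!: always_eventually simp del: real_norm_def)
  also have "\<dots> \<longleftrightarrow> ((\<lambda>y. (f y - f x) /\<^sub>R (y - x)) \<longlongrightarrow> f') (at x within S)"
    by (simp add: tendsto_norm_zero_iff LIM_zero_iff)
  finally show ?thesis .
qed

lemma tendsto_dist_at_right:
  assumes "(g \<longlongrightarrow> l) (at_right 0)"
  shows "((\<lambda>s'. g \<bar>s' - s\<bar>) \<longlongrightarrow> l) (at (s::real) within S)"
proof (rule filterlim_compose[OF assms])
  have "((\<lambda>s'. \<bar>s' - s\<bar>) \<longlongrightarrow> \<bar>s - s\<bar>) (at s within S)"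
    by (intro tendsto_intros)
  then show "filterlim (\<lambda>s'. \<bar>s' - s\<bar>) (at_right 0) (at s within S)"
    by (auto simp: filterlim_at eventually_at_filter)
qed

lemma eventually_le_bound:
  "0 \<le> (s::real) \<Longrightarrow> eventually (\<lambda>s'. 0 \<le> s' \<and> s' \<le> s + 1) (at s within {0..})"
  unfolding eventually_at by (rule exI[of _ 1]) (auto simp: dist_real_def)

locale semigroup_generator =
  fixes \<Psi> :: "real \<Rightarrow> 'b::banach \<Rightarrow>\<^sub>L 'b" and D :: "'b set" and A :: "'b \<Rightarrow> 'b"
  assumes C0: "C0_semigroup \<Psi>" and gen: "generates D A \<Psi>"
begin

lemma zero: "\<Psi> 0 x = x"
  using C0 by (simp add: C0_semigroup_def)

lemma add: "0 \<le> s \<Longrightarrow> 0 \<le> t \<Longrightarrow> \<Psi> (s + t) x = \<Psi> s (\<Psi> t x)"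
  using C0 by (simp add: C0_semigroup_def)

lemma tendsto_zero: "((\<lambda>s. \<Psi> s x) \<longlongrightarrow> x) (at_right 0)"
  using C0 by (simp add: C0_semigroup_def)

text \<open>Near \<open>0\<close> the norms are bounded by the uniform boundedness principle, since a sequence \<open>s\<^sub>n \<rightarrow> 0\<close> with unbounded
norms would still converge pointwise. The semigroup law propagates the bound to every
bounded interval.\<close>

lemma locally_bounded:
  obtains K where "\<And>s. s \<in> {0..T} \<Longrightarrow> norm (\<Psi> s) \<le> K" "0 \<le> K"
proof -
  have "\<exists>\<delta>>0. \<exists>K. \<forall>s\<in>{0..\<delta>}. norm (\<Psi> s) \<le> K"
  proof (rule ccontr)
    assume "\<not> ?thesis"
    then have "\<forall>n. \<exists>s\<in>{0..inverse (real (Suc n))}. \<not> norm (\<Psi> s) \<le> real (Suc n)"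
      by (metis inverse_positive_iff_positive of_nat_0_less_iff zero_less_Suc)
    then obtain s where s: "\<And>n. s n \<in> {0..inverse (real (Suc n))}" "\<And>n. norm (\<Psi> (s n)) > real (Suc n)"
      by (metis not_le)
    have "s n \<noteq> 0" for n
    proof
      assume "s n = 0"
      then have "norm (\<Psi> (s n)) \<le> 1"
        using C0 by (simp add: C0_semigroup_def norm_blinfun_id_le)
      with s(2)[of n] show False by simp
    qed
    moreover have "s \<longlonglongrightarrow> 0"
      by (rule real_tendsto_sandwich[OF _ _ tendsto_const LIMSEQ_inverse_real_of_nat]) (use s(1) in auto)
    ultimately have "filterlim s (at_right 0) sequentially"
      using s(1) by (auto simp: filterlim_at less_le eq_commute[of 0] intro!: always_eventually)
    then have "(\<lambda>n. \<Psi> (s n) x) \<longlonglongrightarrow> x" for x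
      by (rule filterlim_compose[OF tendsto_zero])
    then have "Bseq (\<lambda>n. \<Psi> (s n) x)" for x
      by (intro convergent_imp_Bseq convergentI)
    then have "\<exists>K. \<forall>n\<in>UNIV. norm (\<Psi> (s n) x) \<le> K" for x
      by (auto simp: Bseq_def)
    then obtain K where K: "\<forall>n. norm (\<Psi> (s n)) \<le> K"
      using uniform_boundedness[of UNIV "\<lambda>n. \<Psi> (s n)"] by auto
    obtain n where "K < real n" using reals_Archimedean2 by blast
    with K s(2)[of n] show False by (meson dual_order.strict_trans1 less_irrefl of_nat_Suc
      order_less_trans lessI of_nat_less_iff)
  qed
  then obtain \<delta> K where \<delta>: "\<delta> > 0" and K: "\<And>s. s \<in> {0..\<delta>} \<Longrightarrow> norm (\<Psi> s) \<le> K" by blast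
  have K0: "0 \<le> K" using K[of 0] \<delta> by (intro order.trans[OF norm_ge_zero]) auto
  have bnd: "\<exists>K. \<forall>s\<in>{0..real n * \<delta>}. norm (\<Psi> s) \<le> K" for n
  proof (induction n)
    case 0
    then show ?case by auto
  next
    case (Suc n)
    then obtain L where L: "\<And>s. s \<in> {0..real n * \<delta>} \<Longrightarrow> norm (\<Psi> s) \<le> L" by blast
    have "norm (\<Psi> s) \<le> max K (K * L)" if s: "s \<in> {0..real (Suc n) * \<delta>}" for s
    proof (cases "s \<le> \<delta>")
      case True
      then show ?thesis using K s by (auto intro!: max.coboundedI1)
    next
      case False
      have "\<Psi> s = \<Psi> \<delta> o\<^sub>L \<Psi> (s - \<delta>)"
        using C0 False \<delta> unfolding C0_semigroup_def
        by (metis add.commute diff_add_cancel diff_ge_0_iff_ge less_imp_le not_le)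
      then have "norm (\<Psi> s) \<le> norm (\<Psi> \<delta>) * norm (\<Psi> (s - \<delta>))"
        by (simp add: norm_blinfun_compose)
      also have "\<dots> \<le> K * L"
        using False s \<delta> K0 by (intro mult_mono K L) (auto simp: algebra_simps)
      finally show ?thesis by simp
    qed
    then show ?case by blast
  qed
  obtain n where "T \<le> real n * \<delta>"
    using ex_less_of_nat_mult[OF \<delta>, of T] by (auto intro: less_imp_le)
  with bnd[of n] obtain L where "\<And>s. s \<in> {0..T} \<Longrightarrow> norm (\<Psi> s) \<le> L" by force
  then show ?thesis
    using that[of "max L 0"] by (auto intro: max.coboundedI1)
qed

text \<open>One formula for increments in either direction of time: the earlier of the two operators acts on an increment
at \<open>0\<close>. Continuity and differentiability from the left and from the right thus follow together.\<close>

lemma diff_eq: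
  assumes "0 \<le> s" "0 \<le> s'"
  shows "\<Psi> s' x - \<Psi> s x = sgn (s' - s) *\<^sub>R \<Psi> (min s s') (\<Psi> \<bar>s' - s\<bar> x - x)"
proof (cases "s \<le> s'")
  case True
  then show ?thesis using assms add[of s "s' - s" x]
    by (auto simp: blinfun.diff_right sgn_if)
next
  case False
  then show ?thesis using assms add[of s' "s - s'" x]
    by (auto simp: blinfun.diff_right sgn_if)
qed

lemma continuous_on_orbit: "continuous_on {0..} (\<lambda>s. \<Psi> s x)"
  unfolding continuous_on_def
proof
  fix s :: real assume "s \<in> {0..}"
  then have s: "0 \<le> s" by simp
  obtain K where K: "\<And>r. r \<in> {0..s + 1} \<Longrightarrow> norm (\<Psi> r) \<le> K" "0 \<le> K"
    using locally_bounded by blast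
  have "((\<lambda>s'. norm (\<Psi> \<bar>s' - s\<bar> x - x)) \<longlongrightarrow> 0) (at s within {0..})"
    using tendsto_dist_at_right[OF tendsto_zero[of x], of s "{0..}"] by (simp add: LIM_zero tendsto_norm_zero)
  then have lim: "((\<lambda>s'. K * norm (\<Psi> \<bar>s' - s\<bar> x - x)) \<longlongrightarrow> 0) (at s within {0..})"
    by (rule tendsto_mult_right_zero)
  have "((\<lambda>s'. \<Psi> s' x - \<Psi> s x) \<longlongrightarrow> 0) (at s within {0..})"
  proof (rule Lim_null_comparison[OF _ lim])
    show "\<forall>\<^sub>F s' in at s within {0..}. norm (\<Psi> s' x - \<Psi> s x) \<le> K * norm (\<Psi> \<bar>s' - s\<bar> x - x)"
      using eventually_le_bound[OF s]
    proof eventually_elim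
      case (elim s')
      have "norm (\<Psi> s' x - \<Psi> s x) \<le> norm (\<Psi> (min s s') (\<Psi> \<bar>s' - s\<bar> x - x))"
        using s elim by (subst diff_eq) (auto simp: sgn_if)
      also have "\<dots> \<le> norm (\<Psi> (min s s')) * norm (\<Psi> \<bar>s' - s\<bar> x - x)"
        by (rule norm_blinfun)
      also have "\<dots> \<le> K * norm (\<Psi> \<bar>s' - s\<bar> x - x)"
        using s elim by (intro mult_right_mono K) auto
      finally show ?case .
    qed
  qed
  then show "((\<lambda>s. \<Psi> s x) \<longlongrightarrow> \<Psi> s x) (at s within {0..})"
    by (simp add: LIM_zero_iff)
qed

lemma generator_tendsto:
  "b \<in> D \<Longrightarrow> ((\<lambda>h. (\<Psi> h b - b) /\<^sub>R h) \<longlongrightarrow> A b) (at_right 0)"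
  using gen by (simp add: generates_def)

text \<open>The operator \<open>\<Psi> s\<close> commutes with the difference quotients that define the generator.\<close>

lemma orbit_in_domain:
  assumes "b \<in> D" "0 \<le> s"
  shows "\<Psi> s b \<in> D" "A (\<Psi> s b) = \<Psi> s (A b)"
proof -
  have "((\<lambda>h. \<Psi> s ((\<Psi> h b - b) /\<^sub>R h)) \<longlongrightarrow> \<Psi> s (A b)) (at_right 0)"
    by (intro blinfun.tendsto tendsto_const generator_tendsto assms)
  moreover have "\<forall>\<^sub>F h in at_right 0. \<Psi> s ((\<Psi> h b - b) /\<^sub>R h) = (\<Psi> h (\<Psi> s b) - \<Psi> s b) /\<^sub>R h"
    unfolding eventually_at_filter
    using assms(2) by (auto intro!: always_eventually
        simp: blinfun.scaleR_right blinfun.diff_right add[symmetric] add.commute[of s])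
  ultimately have lim: "((\<lambda>h. (\<Psi> h (\<Psi> s b) - \<Psi> s b) /\<^sub>R h) \<longlongrightarrow> \<Psi> s (A b)) (at_right 0)"
    by (rule Lim_transform_eventually)
  then show D: "\<Psi> s b \<in> D" using gen unfolding generates_def by blast
  show "A (\<Psi> s b) = \<Psi> s (A b)"
    by (rule tendsto_unique[OF _ generator_tendsto[OF D] lim]) simp
qed

lemma orbit_has_vector_derivative:
  assumes b: "b \<in> D" and s: "0 \<le> s"
  shows "((\<lambda>s. \<Psi> s b) has_vector_derivative \<Psi> s (A b)) (at s within {0..})"
  unfolding has_vector_derivative_iff_quotient
proof -
  obtain K where K: "\<And>r. r \<in> {0..s + 1} \<Longrightarrow> norm (\<Psi> r) \<le> K" "0 \<le> K"
    using locally_bounded by blast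
  define q where "q h = (\<Psi> h b - b) /\<^sub>R h" for h
  have "((\<lambda>s'. norm (q \<bar>s' - s\<bar> - A b)) \<longlongrightarrow> 0) (at s within {0..})"
    using tendsto_dist_at_right[OF generator_tendsto[OF b], of s "{0..}"]
    by (simp add: LIM_zero tendsto_norm_zero q_def)
  then have lim1: "((\<lambda>s'. K * norm (q \<bar>s' - s\<bar> - A b)) \<longlongrightarrow> 0) (at s within {0..})"
    by (rule tendsto_mult_right_zero)
  have "continuous_on {0..} (\<lambda>s'. \<Psi> (min s s') (A b))"
    by (rule continuous_on_compose2[OF continuous_on_orbit]) (use s in \<open>auto intro!: continuous_intros\<close>)
  then have "((\<lambda>s'. \<Psi> (min s s') (A b)) \<longlongrightarrow> \<Psi> (min s s) (A b)) (at s within {0..})"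
    using s unfolding continuous_on_def by blast
  then have lim2: "((\<lambda>s'. norm (\<Psi> (min s s') (A b) - \<Psi> s (A b))) \<longlongrightarrow> 0) (at s within {0..})"
    by (simp add: LIM_zero tendsto_norm_zero)
  have "((\<lambda>s'. (\<Psi> s' b - \<Psi> s b) /\<^sub>R (s' - s) - \<Psi> s (A b)) \<longlongrightarrow> 0) (at s within {0..})"
  proof (rule Lim_null_comparison)
    show "((\<lambda>s'. K * norm (q \<bar>s' - s\<bar> - A b) + norm (\<Psi> (min s s') (A b) - \<Psi> s (A b))) \<longlongrightarrow> 0)
        (at s within {0..})"
      using tendsto_add[OF lim1 lim2] by simp
    have "\<forall>\<^sub>F s' in at s within {0..}. s' \<noteq> s" by (simp add: eventually_at_filter)
    then show "\<forall>\<^sub>F s' in at s within {0..}. norm ((\<Psi> s' b - \<Psi> s b) /\<^sub>R (s' - s) - \<Psi> s (A b))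
        \<le> K * norm (q \<bar>s' - s\<bar> - A b) + norm (\<Psi> (min s s') (A b) - \<Psi> s (A b))"
      using eventually_le_bound[OF s]
    proof eventually_elim
      case (elim s')
      have "(\<Psi> s' b - \<Psi> s b) /\<^sub>R (s' - s) = \<Psi> (min s s') (q \<bar>s' - s\<bar>)"
        using s elim inverse_minus_eq[of "s' - s"]
        by (subst diff_eq) (auto simp: q_def blinfun.scaleR_right sgn_if abs_if)
      then have "(\<Psi> s' b - \<Psi> s b) /\<^sub>R (s' - s) - \<Psi> s (A b)
          = \<Psi> (min s s') (q \<bar>s' - s\<bar> - A b) + (\<Psi> (min s s') (A b) - \<Psi> s (A b))"
        by (simp add: blinfun.diff_right)
      also have "norm \<dots> \<le> norm (\<Psi> (min s s') (q \<bar>s' - s\<bar> - A b)) + norm (\<Psi> (min s s') (A b) - \<Psi> s (A b))"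
        by (rule norm_triangle_ineq)
      also have "norm (\<Psi> (min s s') (q \<bar>s' - s\<bar> - A b)) \<le> K * norm (q \<bar>s' - s\<bar> - A b)"
        using s elim by (intro order.trans[OF norm_blinfun] mult_right_mono K) auto
      finally show ?case by simp
    qed
  qed
  then show "((\<lambda>s'. (\<Psi> s' b - \<Psi> s b) /\<^sub>R (s' - s)) \<longlongrightarrow> \<Psi> s (A b)) (at s within {0..})"
    by (simp add: LIM_zero_iff)
qed

lemma orbit_lipschitz:
  assumes b: "b \<in> D" and K: "\<And>r. r \<in> {0..T} \<Longrightarrow> norm (\<Psi> r) \<le> K"
    and s: "s \<in> {0..T}" "s' \<in> {0..T}"
  shows "norm (\<Psi> s' b - \<Psi> s b) \<le> K * norm (A b) * \<bar>s' - s\<bar>"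
proof -
  have "norm (\<Psi> s' b - \<Psi> s b) \<le> K * norm (A b) * norm (s' - s)"
  proof (rule differentiable_bound[where S = "{0..T}"])
    show "((\<lambda>s. \<Psi> s b) has_derivative (\<lambda>h. h *\<^sub>R \<Psi> r (A b))) (at r within {0..T})"
      if "r \<in> {0..T}" for r
      using has_vector_derivative_within_subset[OF orbit_has_vector_derivative[OF b], of r "{0..T}"] that
      by (auto simp: has_vector_derivative_def)
    show "onorm (\<lambda>h. h *\<^sub>R \<Psi> r (A b)) \<le> K * norm (A b)" if "r \<in> {0..T}" for r
      using that by (simp add: onorm_scaleR_left onorm_id)
        (intro order.trans[OF norm_blinfun] mult_right_mono K, auto)
  qed (use s in auto)
  then show ?thesis by simp
qed

end

section \<open>Lebesgue differentiation on the line\<close>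

text \<open>A primitive of an integrable function has the right derivative wherever two rational slopes cannot be
separated. A point of excess slope is covered by arbitrarily short intervals on which
the function has too large a mean; a Vitali subfamily of these has small total length.\<close>

text \<open>Points where \<open>f\<close> is below \<open>p\<close> but which lie in arbitrarily short intervals on which the mean
of \<open>f\<close> exceeds \<open>q\<close>. The intervals need not be centred at the point, since difference quotients of the primitive
are means over intervals with the point at one end.\<close>

definition steep :: "(real \<Rightarrow> real) \<Rightarrow> real \<Rightarrow> real \<Rightarrow> real set" where
  "steep f p q = {x. f x < p \<and> (\<forall>d>0. \<exists>c r. 0 < r \<and> r < d \<and> x \<in> cball c r \<and>
     q * (2 * r) < (LINT s:cball c r|lborel. f s))}"

text \<open>Let \<open>W\<close> be the union of a disjoint Vitali family of intervals with mean above \<open>q\<close>, inside an open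
set \<open>G\<close> that barely exceeds \<open>A = {f < p}\<close>. Then \<open>f - q\<close> has nonnegative integral over \<open>W\<close>, is below \<open>p - q\<close> on
\<open>W \<inter> A\<close>, and has a small integral over \<open>G - A\<close>; so \<open>W\<close> has small measure. Outer regularity of the
measure with density \<open>|f| + |q| + 1\<close> provides \<open>G\<close>.\<close>

lemma negligible_steep_ball:
  assumes f [measurable]: "f \<in> borel_measurable borel" and int: "integrable lborel f" and pq: "p < q"
  shows "negligible (steep f p q \<inter> ball 0 R)"
  unfolding negligible_outer_le
proof (intro allI impI)
  fix e :: real assume "0 < e"
  \<comment> \<open>\<open>W \<inter> A\<close> will have measure at most \<open>\<epsilon> / (q - p)\<close>, and \<open>W - A\<close> at most \<open>\<epsilon>\<close>.\<close>
  define \<epsilon> where "\<epsilon> = e / (1 / (q - p) + 1)"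
  have "\<epsilon> > 0" using \<open>0 < e\<close> pq by (auto simp: \<epsilon>_def intro!: divide_pos_pos add_pos_pos)
  define g where "g x = (\<bar>f x\<bar> + \<bar>q\<bar> + 1) * indicator (ball 0 R) x" for x
  have gm [measurable]: "g \<in> borel_measurable borel"
    unfolding g_def by (intro borel_measurable_times borel_measurable_indicator borel_measurable_add
        borel_measurable_abs f borel_measurable_const) auto
  have g0: "0 \<le> g x" for x by (auto simp: g_def)
  have ball: "integrable lborel (indicat_real (ball 0 R))"
    by (intro integrable_real_indicator) (use emeasure_lborel_ball_finite[of 0 R] in auto)
  have gint: "integrable lborel g"
  proof -
    have "integrable lborel (\<lambda>x. \<bar>f x\<bar> * indicator (ball 0 R) x + (\<bar>q\<bar> + 1) * indicator (ball 0 R) x)"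
      by (intro Bochner_Integration.integrable_add integrable_mult_right ball
          integrable_real_mult_indicator integrable_abs int) auto
    then show ?thesis by (simp add: g_def[abs_def] algebra_simps)
  qed
  define M where "M = density lborel g"
  define A where "A = {x. f x < p} \<inter> ball 0 R"
  have A [measurable]: "A \<in> sets borel" unfolding A_def by measurable
  have M: "emeasure M S = ennreal (LINT x|lborel. g x * indicator S x)" if [measurable]: "S \<in> sets borel" for S
  proof -
    have "emeasure M S = (\<integral>\<^sup>+x. ennreal (g x) * indicator S x \<partial>lborel)"
      unfolding M_def by (rule emeasure_density) auto
    also have "\<dots> = (\<integral>\<^sup>+x. ennreal (g x * indicator S x) \<partial>lborel)"
      by (intro nn_integral_cong) (auto simp: indicator_def)
    also have "\<dots> = ennreal (LINT x|lborel. g x * indicator S x)"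
      using g0 by (intro nn_integral_eq_integral integrable_real_mult_indicator gint) auto
    finally show ?thesis .
  qed
  have "emeasure M A = (INF U \<in> {U. A \<subseteq> U \<and> open U}. emeasure M U)"
    by (rule outer_regular) (use M[of UNIV] in \<open>auto simp: M_def\<close>)
  moreover have "emeasure M A < emeasure M A + ennreal \<epsilon>"
    using \<open>\<epsilon> > 0\<close> M[OF A] by (auto simp: ennreal_add_left_cancel_less ennreal_less_top less_top)
  ultimately obtain U where U: "A \<subseteq> U" "open U" "emeasure M U < emeasure M A + ennreal \<epsilon>"
    by (auto simp: INF_less_iff)
  define G where "G = U \<inter> ball 0 R"
  have G: "open G" "A \<subseteq> G" "G \<subseteq> ball 0 R" using U by (auto simp: G_def A_def)
  have [measurable]: "G \<in> sets borel" "U \<in> sets borel" using G U by auto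
  have small: "(LINT x|lborel. g x * indicator (G - A) x) \<le> \<epsilon>"
  proof -
    have "(LINT x|lborel. g x * indicator G x) \<le> (LINT x|lborel. g x * indicator U x)"
      using g0 by (intro integral_mono integrable_real_mult_indicator gint)
        (auto simp: G_def indicator_def)
    moreover have "(LINT x|lborel. g x * indicator (G - A) x)
        = (LINT x|lborel. g x * indicator G x - g x * indicator A x)"
      using G by (intro Bochner_Integration.integral_cong) (auto simp: indicator_def)
    moreover have "\<dots> = (LINT x|lborel. g x * indicator G x) - (LINT x|lborel. g x * indicator A x)"
      by (intro Bochner_Integration.integral_diff integrable_real_mult_indicator gint) auto
    moreover have "(LINT x|lborel. g x * indicator U x) < (LINT x|lborel. g x * indicator A x) + \<epsilon>"
    proof -
      have "0 \<le> (LINT x|lborel. g x * indicator A x)"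
        using g0 by (intro Bochner_Integration.integral_nonneg) auto
      then have "ennreal (LINT x|lborel. g x * indicator U x) < ennreal ((LINT x|lborel. g x * indicator A x) + \<epsilon>)"
        using U(3) \<open>\<epsilon> > 0\<close> by (simp add: M ennreal_plus)
      moreover have "0 \<le> (LINT x|lborel. g x * indicator U x)"
        using g0 by (intro Bochner_Integration.integral_nonneg) auto
      ultimately show ?thesis by (simp only: ennreal_less_iff)
    qed
    ultimately show ?thesis by linarith
  qed
  define K where "K = {(c, r). 0 < r \<and> cball c r \<subseteq> G \<and> q * (2 * r) < (LINT s:cball c r|lborel. f s)}"
  let ?S = "steep f p q \<inter> ball 0 R"
  have SA: "?S \<subseteq> A" by (auto simp: steep_def A_def)
  obtain C where C: "countable C" "C \<subseteq> K"
     "pairwise (\<lambda>i j. disjnt (cball (fst i) (snd i)) (cball (fst j) (snd j))) C"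
     "negligible (?S - (\<Union>i \<in> C. cball (fst i) (snd i)))"
  proof (rule Vitali_covering_theorem_cballs[of K snd ?S fst])
    show "0 < snd i" if "i \<in> K" for i using that by (auto simp: K_def)
    fix x d :: real assume x: "x \<in> ?S" and d: "0 < d"
    then have "x \<in> G" using SA G by blast
    then obtain d' where d': "d' > 0" "ball x d' \<subseteq> G" using G(1) by (meson openE)
    then have "0 < min d (d' / 2)" using d by simp
    then obtain c r where cr: "0 < r" "r < min d (d' / 2)" "x \<in> cball c r"
      "q * (2 * r) < (LINT s:cball c r|lborel. f s)"
      using x unfolding steep_def by blast
    have "cball c r \<subseteq> ball x d'"
      using cr by (auto simp: dist_real_def)
    with cr d' have "(c, r) \<in> K" by (auto simp: K_def)
    with cr show "\<exists>i. i \<in> K \<and> x \<in> cball (fst i) (snd i) \<and> snd i < d"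
      by (intro exI[of _ "(c, r)"]) auto
  qed blast
  \<comment> \<open>The countable Vitali family, enumerated with empty sets in the gaps.\<close>
  define I where "I i = (if i \<in> to_nat_on C ` C then cball (fst (from_nat_into C i)) (snd (from_nat_into C i)) else {})" for i
  define W where "W = (\<Union>i \<in> C. cball (fst i) (snd i))"
  have WI: "W = (\<Union>i. I i)"
  proof (intro equalityI subsetI)
    fix x assume "x \<in> W"
    then obtain i where "i \<in> C" "x \<in> cball (fst i) (snd i)" by (auto simp: W_def)
    then have "x \<in> I (to_nat_on C i)" using C(1) by (simp add: I_def)
    then show "x \<in> (\<Union>i. I i)" by blast
  next
    fix x assume "x \<in> (\<Union>i. I i)"
    then obtain n where n: "x \<in> I n" by blast
    then obtain i where i: "i \<in> C" "n = to_nat_on C i" by (auto simp: I_def split: if_splits)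
    with n C(1) have "x \<in> cball (fst i) (snd i)" by (simp add: I_def)
    with i show "x \<in> W" unfolding W_def by blast
  qed
  have WG: "W \<subseteq> G"
    unfolding W_def
  proof (rule UN_least)
    fix i assume "i \<in> C"
    with C(2) have "i \<in> K" by blast
    then show "cball (fst i) (snd i) \<subseteq> G" unfolding K_def by (cases i) simp
  qed
  have [measurable]: "I i \<in> sets borel" for i by (auto simp: I_def)
  have [measurable]: "W \<in> sets borel" unfolding WI by auto
  have disj: "I i \<inter> I j = {}" if "i \<noteq> j" for i j
  proof (cases "i \<in> to_nat_on C ` C \<and> j \<in> to_nat_on C ` C")
    case True
    then obtain x y where xy: "x \<in> C" "i = to_nat_on C x" "y \<in> C" "j = to_nat_on C y" by blast
    with that have "x \<noteq> y" by blast
    with xy C(3) have "disjnt (cball (fst x) (snd x)) (cball (fst y) (snd y))"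
      by (auto simp: pairwise_def)
    then show ?thesis using xy C(1) by (simp add: I_def disjnt_def)
  qed (auto simp: I_def)
  have intW: "integrable lborel (\<lambda>x. indicator S x * (f x - q))" if [measurable]: "S \<in> sets borel" and "S \<subseteq> G" for S
  proof (rule Bochner_Integration.integrable_bound[OF gint])
    show "AE x in lborel. norm (indicator S x * (f x - q)) \<le> norm (g x)"
      using that(2) G(3) by (intro AE_I2) (auto simp: indicator_def g_def)
  qed simp
  have "0 \<le> (LINT x:W|lborel. (f x - q))"
  proof -
    have si: "set_integrable lborel (\<Union>i. I i) (\<lambda>x. f x - q)"
      using intW[of W] WG by (simp add: set_integrable_def WI[symmetric])
    have I0: "0 \<le> (LINT x:I i|lborel. (f x - q))" for i
    proof (cases "i \<in> to_nat_on C ` C")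
      case True
      then have "from_nat_into C i \<in> K" using C(1,2) by auto
      then obtain c r where cr: "from_nat_into C i = (c, r)" "0 < r" "q * (2 * r) < (LINT s:cball c r|lborel. f s)"
        by (auto simp: K_def)
      have Ii: "I i = cball c r" using True cr by (simp add: I_def)
      have "(LINT x:cball c r|lborel. (f x - q)) = (LINT s:cball c r|lborel. f s) - (LINT s:cball c r|lborel. q)"
      proof (rule set_integral_diff)
        show "set_integrable lborel (cball c r) f"
          unfolding set_integrable_def by (intro integrable_mult_indicator int) simp
        have "integrable lborel (indicat_real (cball c r))"
          by (intro integrable_real_indicator) (use emeasure_lborel_cball_finite[of c r] in auto)
        then show "set_integrable lborel (cball c r) (\<lambda>s. q)"
          unfolding set_integrable_def by simp
      qed
      then show ?thesis
        using cr unfolding Ii by (simp add: set_lebesgue_integral_def cball_eq_atLeastAtMost mult.commute)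
    qed (simp add: I_def set_lebesgue_integral_def)
    have sub: "set_integrable lborel S (\<lambda>x. f x - q)" if "S \<in> sets borel" "S \<subseteq> (\<Union>i. I i)" for S
      using that by (intro set_integrable_subset[OF si]) auto
    have "0 \<le> (LINT x:(\<Union>i<n. I i)|lborel. (f x - q))" for n
    proof (induction n)
      case (Suc n)
      have "(LINT x:(\<Union>i<n. I i) \<union> I n|lborel. (f x - q))
          = (LINT x:(\<Union>i<n. I i)|lborel. (f x - q)) + (LINT x:I n|lborel. (f x - q))"
      proof (intro set_integral_Un sub)
        have "I i \<inter> I n = {}" if "i < n" for i using that by (intro disj) simp
        then show "(\<Union>i<n. I i) \<inter> I n = {}" by blast
      qed auto
      then show ?case using Suc I0[of n] by (simp add: lessThan_Suc Un_commute)
    qed (simp add: set_lebesgue_integral_def)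
    moreover have "(\<lambda>n. LINT x:(\<Union>i<n. I i)|lborel. (f x - q)) \<longlonglongrightarrow> (LINT x:(\<Union>n. \<Union>i<n. I i)|lborel. (f x - q))"
    proof (rule set_integral_cont_up)
      show "incseq (\<lambda>n. \<Union>i<n. I i)" by (auto simp: incseq_def intro: order.strict_trans2)
      show "set_integrable lborel (\<Union>n. \<Union>i<n. I i) (\<lambda>x. f x - q)" by (intro sub) auto
    qed auto
    moreover have "(\<Union>n. \<Union>i<n. I i) = W" unfolding WI by auto
    ultimately show ?thesis
      by (intro LIMSEQ_le_const[of _ _ 0]) auto
  qed
  also have "\<dots> \<le> (LINT x|lborel. g x * indicator (G - A) x - (q - p) * indicator (W \<inter> A) x)"
    unfolding set_lebesgue_integral_def
  proof (intro integral_mono)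
    show "integrable lborel (\<lambda>x. indicat_real W x *\<^sub>R (f x - q))" using intW[of W] WG by simp
    have "emeasure lborel (W \<inter> A) < \<infinity>"
      by (rule le_less_trans[OF emeasure_mono emeasure_lborel_ball_finite[of 0 R]]) (auto simp: A_def)
    then show "integrable lborel (\<lambda>x. g x * indicator (G - A) x - (q - p) * indicator (W \<inter> A) x)"
      by (intro Bochner_Integration.integrable_diff integrable_real_mult_indicator gint
          integrable_mult_right integrable_real_indicator) auto
    show "indicator W x *\<^sub>R (f x - q) \<le> g x * indicator (G - A) x - (q - p) * indicator (W \<inter> A) x" for x
      using WG G g0[of x] by (auto simp: indicator_def A_def g_def)
  qed
  also have "\<dots> = (LINT x|lborel. g x * indicator (G - A) x) - (q - p) * measure lborel (W \<inter> A)"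
  proof -
    have "emeasure lborel (W \<inter> A) < \<infinity>"
      by (rule le_less_trans[OF emeasure_mono emeasure_lborel_ball_finite[of 0 R]]) (auto simp: A_def)
    then show ?thesis
      by (subst Bochner_Integration.integral_diff)
        (auto intro!: integrable_real_mult_indicator gint integrable_mult_right integrable_real_indicator)
  qed
  finally have "(q - p) * measure lborel (W \<inter> A) \<le> \<epsilon>" using small by simp
  then have 1: "measure lborel (W \<inter> A) \<le> \<epsilon> / (q - p)"
    using pq by (simp add: field_simps)
  have fin: "S \<in> fmeasurable lborel" if "S \<in> sets borel" "S \<subseteq> ball 0 R" for S :: "real set"
  proof (rule fmeasurableI)
    show "emeasure lborel S < \<infinity>"
      by (rule le_less_trans[OF emeasure_mono emeasure_lborel_ball_finite[of 0 R]]) (use that in auto)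
  qed (use that in simp)
  have 2: "measure lborel (W - A) \<le> \<epsilon>"
  proof -
    have "measure lborel (W - A) = (LINT x|lborel. indicator (W - A) x)" by simp
    also have "\<dots> \<le> (LINT x|lborel. g x * indicator (G - A) x)"
    proof (intro integral_mono integrable_real_indicator integrable_real_mult_indicator gint)
      have "W - A \<in> fmeasurable lborel" using WG G(3) by (intro fin) auto
      then show "emeasure lborel (W - A) < \<infinity>" by (simp add: fmeasurable_def)
      show "indicator (W - A) x \<le> g x * indicator (G - A) x" for x
        using WG G(3) by (auto simp: indicator_def g_def)
    qed auto
    finally show ?thesis using small by simp
  qed
  have "measure lborel W = measure lborel (W \<inter> A) + measure lborel (W - A)"
  proof -
    have "W \<inter> A \<in> fmeasurable lborel" "W - A \<in> fmeasurable lborel"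
      using WG G(3) by (auto intro!: fin)
    moreover have "W \<inter> A \<inter> (W - A) = {}" "W = (W \<inter> A) \<union> (W - A)" by blast+
    ultimately show ?thesis
      by (metis measure_Un3 measure_empty diff_zero)
  qed
  also have "\<dots> \<le> \<epsilon> * (1 / (q - p) + 1)" using 1 2 by (simp add: algebra_simps)
  also have "\<dots> = e"
    using pq add_pos_pos[of "1 / (q - p)" 1] by (simp add: \<epsilon>_def)
  finally have We: "measure lborel W \<le> e" .
  let ?N = "?S - W"
  have N: "?N \<in> null_sets lebesgue" using C(4) by (simp add: negligible_iff_null_sets W_def)
  have Wl: "W \<in> lmeasurable" using fin[of W] WG G by (auto simp: fmeasurable_def)
  show "\<exists>T. ?S \<subseteq> T \<and> T \<in> lmeasurable \<and> measure lebesgue T \<le> e"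
  proof (intro exI conjI)
    show "?S \<subseteq> W \<union> ?N" by auto
    show "W \<union> ?N \<in> lmeasurable" using Wl N by (intro fmeasurable.Un) (auto intro: fmeasurableI_null_sets)
    have "measure lebesgue (W \<union> ?N) = measure lebesgue W"
      using Wl N by (intro measure_Un_null_set) auto
    with We show "measure lebesgue (W \<union> ?N) \<le> e" by simp
  qed
qed

lemma negligible_steep:
  assumes "f \<in> borel_measurable borel" "integrable lborel f" "p < q"
  shows "negligible (steep f p q)"
proof -
  have "\<exists>n::nat. x \<in> ball 0 (real n)" for x :: real
    using reals_Archimedean2[of "norm x"] by (simp only: mem_ball_0)
  then have "steep f p q = (\<Union>n. steep f p q \<inter> ball 0 (real n))"
    by (intro equalityI subsetI) (simp_all only: UN_iff Int_iff UNIV_I bex_UNIV, blast+)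
  moreover have "negligible (\<Union>n. steep f p q \<inter> ball 0 (real n))"
    by (intro negligible_Union_nat negligible_steep_ball[OF assms])
  ultimately show ?thesis by simp
qed

lemma set_integral_atMost_diff:
  fixes f :: "real \<Rightarrow> real"
  assumes "integrable lborel f" "a \<le> b"
  shows "(LINT s:{..b}|lborel. f s) - (LINT s:{..a}|lborel. f s) = (LINT s:{a..b}|lborel. f s)"
proof -
  have i: "integrable lborel (\<lambda>s. indicator S s *\<^sub>R f s)" if "S \<in> sets borel" for S
    using that assms(1) by (intro integrable_mult_indicator) auto
  have "(LINT s:{..b}|lborel. f s) - (LINT s:{..a}|lborel. f s)
    = (LINT s|lborel. indicator {..b} s *\<^sub>R f s - indicator {..a} s *\<^sub>R f s)"
    unfolding set_lebesgue_integral_def by (rule Bochner_Integration.integral_diff[symmetric, OF i i]) auto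
  also have "\<dots> = (LINT s:{a..b}|lborel. f s)"
    unfolding set_lebesgue_integral_def
  proof (rule integral_cong_AE)
    show "AE s in lborel. indicator {..b} s *\<^sub>R f s - indicator {..a} s *\<^sub>R f s = indicator {a..b} s *\<^sub>R f s"
      using AE_lborel_singleton[of a] by eventually_elim (use assms(2) in \<open>auto simp: indicator_def\<close>)
    show "(\<lambda>s. indicator {..b} s *\<^sub>R f s - indicator {..a} s *\<^sub>R f s) \<in> borel_measurable lborel"
      by (rule borel_measurable_diff[OF borel_measurable_integrable[OF i] borel_measurable_integrable[OF i]]) auto
    show "(\<lambda>s. indicator {a..b} s *\<^sub>R f s) \<in> borel_measurable lborel"
      by (rule borel_measurable_integrable[OF i]) auto
  qed
  finally show ?thesis .
qed

text \<open>Outside the steep sets of \<open>f\<close> with rational parameters the upper derivative of the primitive is at most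
\<open>f\<close>; the same for \<open>- f\<close> bounds the lower derivative.\<close>

lemma has_real_derivative_integral_AE_borel:
  fixes f :: "real \<Rightarrow> real"
  assumes f: "f \<in> borel_measurable borel" and int: "integrable lborel f"
  shows "AE t in lebesgue. ((\<lambda>t. LINT s:{..t}|lborel. f s) has_vector_derivative f t) (at t)"
proof -
  define F where "F t = (LINT s:{..t}|lborel. f s)" for t
  define P where "P = {(p, q). p \<in> \<rat> \<and> q \<in> \<rat> \<and> p < (q::real)}"
  have "countable P"
    by (rule countable_subset[of _ "\<rat> \<times> \<rat>"]) (auto simp: P_def intro: countable_rat)
  have AE: "AE t in lebesgue. \<forall>pq\<in>P. t \<notin> steep g (fst pq) (snd pq)"
    if "g \<in> borel_measurable borel" "integrable lborel g" for g
    unfolding AE_ball_countable[OF \<open>countable P\<close>]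
  proof
    fix pq assume "pq \<in> P"
    then have "steep g (fst pq) (snd pq) \<in> null_sets lebesgue"
      using negligible_steep[OF that] by (auto simp: P_def negligible_iff_null_sets)
    then show "AE t in lebesgue. t \<notin> steep g (fst pq) (snd pq)" by (rule AE_not_in)
  qed
  have up: "\<forall>\<^sub>F s in at t. (G s - G t) /\<^sub>R (s - t) < g t + e"
    if g: "integrable lborel g" and G: "\<And>t. G t = (LINT s:{..t}|lborel. g s)"
      and t: "\<forall>pq\<in>P. t \<notin> steep g (fst pq) (snd pq)" and e: "0 < e" for g G t e
  proof -
    obtain q where q: "q \<in> \<rat>" "g t < q" "q < g t + e" using Rats_dense_in_real[of "g t" "g t + e"] e by auto
    obtain p where p: "p \<in> \<rat>" "g t < p" "p < q" using Rats_dense_in_real[OF q(2)] by auto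
    have "t \<notin> steep g p q" using t p q by (auto simp: P_def)
    then obtain d where d0: "d > 0" and "\<not> (\<exists>c r. 0 < r \<and> r < d \<and> t \<in> cball c r \<and>
        q * (2 * r) < (LINT s:cball c r|lborel. g s))"
      using p unfolding steep_def by blast
    then have d: "(LINT s:cball c r|lborel. g s) \<le> q * (2 * r)" if "0 < r" "r < d" "t \<in> cball c r" for c r
      using that by (meson not_less)
    have "(G s - G t) /\<^sub>R (s - t) \<le> q" if s: "s \<noteq> t" "dist s t < d" for s
    proof -
      define r where "r = \<bar>s - t\<bar> / 2"
      define c where "c = (s + t) / 2"
      have r: "0 < r" "r < d" "t \<in> cball c r"
        using s by (auto simp: r_def c_def dist_real_def field_simps abs_if)
      have cb: "cball c r = {min s t..max s t}"
        by (auto simp: cball_eq_atLeastAtMost r_def c_def field_simps abs_if min_def max_def)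
      have "G (max s t) - G (min s t) = (LINT s:cball c r|lborel. g s)"
        unfolding G cb using g by (intro set_integral_atMost_diff) auto
      also have "\<dots> \<le> q * (2 * r)" using r by (intro d)
      finally have le: "G (max s t) - G (min s t) \<le> q * \<bar>s - t\<bar>" by (simp add: r_def)
      have "(G s - G t) /\<^sub>R (s - t) = (G (max s t) - G (min s t)) / \<bar>s - t\<bar>"
      proof (cases "s < t")
        case True
        then have "(G s - G t) / (s - t) = (G t - G s) / (t - s)"
          by (metis minus_diff_eq minus_divide_divide)
        with True show ?thesis by (simp add: divide_inverse mult.commute)
      next
        case False
        then show ?thesis using s by (simp add: divide_inverse mult.commute)
      qed
      also have "\<dots> \<le> q" using le s by (simp add: pos_divide_le_eq)
      finally show ?thesis .
    qed
    then show ?thesis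
      unfolding eventually_at using d0 q by (intro exI[of _ d]) (auto intro: le_less_trans)
  qed
  have "AE t in lebesgue. (\<forall>pq\<in>P. t \<notin> steep f (fst pq) (snd pq))"
    by (rule AE[OF f int])
  moreover have "AE t in lebesgue. (\<forall>pq\<in>P. t \<notin> steep (\<lambda>x. - f x) (fst pq) (snd pq))"
    by (rule AE) (use f int in simp_all)
  ultimately show ?thesis
  proof eventually_elim
    case (elim t)
    have G: "- F t = (LINT s:{..t}|lborel. - f s)" for t
      by (simp add: F_def set_lebesgue_integral_def)
    have "((\<lambda>s. (F s - F t) /\<^sub>R (s - t)) \<longlongrightarrow> f t) (at t)"
    proof (rule tendstoI)
      fix e :: real assume e: "0 < e"
      have eq: "(- F s - - F t) /\<^sub>R (s - t) = - ((F s - F t) /\<^sub>R (s - t))" for s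
        by (simp add: right_diff_distrib)
      have "\<forall>\<^sub>F s in at t. (F s - F t) /\<^sub>R (s - t) < f t + e"
        by (rule up[where g = f and G = F, OF int _ elim(1) e]) (simp add: F_def)
      moreover have "\<forall>\<^sub>F s in at t. (- F s - - F t) /\<^sub>R (s - t) < - f t + e"
        by (rule up[where g = "\<lambda>x. - f x" and G = "\<lambda>t. - F t", OF _ G elim(2) e]) (use int in simp)
      ultimately show "\<forall>\<^sub>F s in at t. dist ((F s - F t) /\<^sub>R (s - t)) (f t) < e"
        unfolding eq by eventually_elim (simp only: dist_real_def abs_less_iff, linarith)
    qed
    then show ?case
      unfolding has_vector_derivative_iff_quotient F_def .
  qed
qed

theorem has_vector_derivative_integral_AE:
  fixes v :: "real \<Rightarrow> 'm::euclidean_space"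
  assumes v: "integrable lebesgue v"
  shows "AE t in lebesgue. ((\<lambda>t. LINT s:{..t}|lebesgue. v s) has_vector_derivative v t) (at t)"
proof -
  have "AE t in lebesgue. ((\<lambda>t. LINT s:{..t}|lebesgue. v s \<bullet> i) has_vector_derivative v t \<bullet> i) (at t)" for i
  proof -
    have vi: "integrable lebesgue (\<lambda>s. v s \<bullet> i)" using v by simp
    then obtain f where f [measurable]: "f \<in> borel_measurable borel" and eq: "AE s in lborel. v s \<bullet> i = f s"
      using completion_ex_borel_measurable_real[OF borel_measurable_integrable[OF vi]] by auto
    have eq': "AE s in lebesgue. v s \<bullet> i = f s" using eq by (rule AE_completion)
    have fm: "f \<in> borel_measurable lebesgue" using f by (simp add: measurable_completion)
    have "integrable lebesgue f"
      using vi integrable_cong_AE[OF borel_measurable_integrable[OF vi] fm eq'] by blast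
    then have "integrable lborel f" by (simp add: integrable_completion)
    from has_real_derivative_integral_AE_borel[OF f this]
    have "AE t in lebesgue. ((\<lambda>t. LINT s:{..t}|lborel. f s) has_vector_derivative f t) (at t)" .
    moreover have "(LINT s:{..t}|lborel. f s) = (LINT s:{..t}|lebesgue. v s \<bullet> i)" for t
    proof -
      have "(LINT s:{..t}|lborel. f s) = (LINT s:{..t}|lebesgue. f s)"
        unfolding set_lebesgue_integral_def by (subst integral_completion) auto
      also have "\<dots> = (LINT s:{..t}|lebesgue. v s \<bullet> i)"
        unfolding set_lebesgue_integral_def
        by (rule integral_cong_AE) (use eq' in \<open>auto intro!: borel_measurable_times borel_measurable_indicator fm borel_measurable_integrable[OF vi]\<close>)
      finally show ?thesis .
    qed
    ultimately have "AE t in lebesgue. ((\<lambda>t. LINT s:{..t}|lebesgue. v s \<bullet> i) has_vector_derivative f t) (at t)"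
      by simp
    with eq' show ?thesis by eventually_elim simp
  qed
  then have "AE t in lebesgue. \<forall>i\<in>Basis. ((\<lambda>t. LINT s:{..t}|lebesgue. v s \<bullet> i) has_vector_derivative v t \<bullet> i) (at t)"
    by (subst AE_ball_countable) (auto intro: countable_finite)
  then show ?thesis
  proof eventually_elim
    case (elim t)
    have "((\<lambda>t. \<Sum>i\<in>Basis. (LINT s:{..t}|lebesgue. v s \<bullet> i) *\<^sub>R i) has_vector_derivative (\<Sum>i\<in>Basis. (v t \<bullet> i) *\<^sub>R i)) (at t)"
    proof (rule has_vector_derivative_sum)
      fix i :: 'm assume "i \<in> Basis"
      with elim show "((\<lambda>t. (LINT s:{..t}|lebesgue. v s \<bullet> i) *\<^sub>R i) has_vector_derivative (v t \<bullet> i) *\<^sub>R i) (at t)"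
        using bounded_linear.has_vector_derivative[OF bounded_linear_scaleR_left] by blast
    qed
    moreover have "(\<Sum>i\<in>Basis. (LINT s:{..t}|lebesgue. v s \<bullet> i) *\<^sub>R i) = (LINT s:{..t}|lebesgue. v s)" for t
    proof -
      have "integrable lebesgue (\<lambda>s. indicator {..t} s *\<^sub>R v s)"
        using v by (intro integrable_mult_indicator) auto
      then have "(LINT s:{..t}|lebesgue. v s \<bullet> i) = (LINT s:{..t}|lebesgue. v s) \<bullet> i" for i
        unfolding set_lebesgue_integral_def by (subst integral_inner_left[symmetric]) auto
      then show ?thesis by (simp add: euclidean_representation)
    qed
    ultimately show ?case by (simp add: euclidean_representation)
  qed
qed

section \<open>Almost everywhere convergent convex combinations\<close>

text \<open>Dyadic convex combinations. Midpoints are all that the parallelogram argument uses, and every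
property that passes to midpoints passes to the whole set by induction.\<close>

inductive_set midpoint_closure :: "('a \<Rightarrow> 'b::real_vector) set \<Rightarrow> ('a \<Rightarrow> 'b) set"
  for F where
  base: "f \<in> F \<Longrightarrow> f \<in> midpoint_closure F"
| midpoint: "f \<in> midpoint_closure F \<Longrightarrow> g \<in> midpoint_closure F \<Longrightarrow>
    (\<lambda>x. (1/2) *\<^sub>R (f x + g x)) \<in> midpoint_closure F"

lemma midpoint_closure_mono:
  assumes "F \<subseteq> G" shows "midpoint_closure F \<subseteq> midpoint_closure G"
proof
  fix f assume "f \<in> midpoint_closure F"
  then show "f \<in> midpoint_closure G"
    by induction (use assms in \<open>auto intro: midpoint_closure.intros\<close>)
qed

lemma convex_midpoint:
  assumes "convex S" "x \<in> S" "y \<in> S" shows "(1/2) *\<^sub>R (x + y) \<in> S"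
  using convexD[OF assms, of "1/2" "1/2"] by (simp add: scaleR_add_right)

lemma midpoint_closure_in_convex:
  assumes "h \<in> midpoint_closure F" "convex S" "\<And>f. f \<in> F \<Longrightarrow> f x \<in> S"
  shows "h x \<in> S"
  using assms(1) by induction (use assms(2,3) in \<open>auto intro: convex_midpoint\<close>)

lemma midpoint_closure_measurable:
  fixes F :: "('a \<Rightarrow> 'b::{real_normed_vector, second_countable_topology}) set"
  assumes "h \<in> midpoint_closure F" "\<And>f. f \<in> F \<Longrightarrow> f \<in> borel_measurable M"
  shows "h \<in> borel_measurable M"
  using assms(1) by induction (use assms(2) in \<open>auto intro!: borel_measurable_scaleR borel_measurable_add\<close>)

lemma midpoint_closure_norm_le:
  fixes F :: "('a \<Rightarrow> 'b::real_normed_vector) set"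
  assumes "h \<in> midpoint_closure F" "\<And>f. f \<in> F \<Longrightarrow> norm (f x) \<le> m"
  shows "norm (h x) \<le> m"
  using midpoint_closure_in_convex[OF assms(1) convex_cball[of 0 m], of x] assms(2) by auto

text \<open>The closest-point argument of Hilbert space for the functional
\<open>J h = \<integral> |h|\<^sup>2 / m\<close>. Its infima over the closures of the tails increase to a finite limit, so by the
parallelogram law near-minimizers are Cauchy with respect to \<open>J\<close>. Young's inequality
\<open>|h| \<le> \<eta> m / 2 + |h|\<^sup>2 / (2 \<eta> m)\<close> turns this into the Cauchy property in \<open>L\<^sup>1\<close>. Dividing by the majorant \<open>m\<close>
makes \<open>J\<close> finite on every measure space, without square integrability of \<open>m\<close>; where \<open>m = 0\<close> all functions
vanish and the quotient is \<open>0\<close>.\<close>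

lemma dominated_midpoints_converge:
  fixes v :: "nat \<Rightarrow> 'a \<Rightarrow> 'b::euclidean_space" and m :: "'a \<Rightarrow> real"
  assumes v: "\<And>n. v n \<in> borel_measurable M" and m: "integrable M m"
    and vm: "\<And>n x. norm (v n x) \<le> m x"
  obtains g where "\<And>n. g n \<in> midpoint_closure (v ` {n..})" "AE x in M. convergent (\<lambda>n. g n x)"
proof -
  define H where "H n = midpoint_closure (v ` {n..})" for n
  define J where "J h = (LINT x|M. (norm (h x))\<^sup>2 / m x)" for h :: "'a \<Rightarrow> 'b"
  have m0: "0 \<le> m x" for x using order.trans[OF norm_ge_zero vm[of 0 x]] .
  have Hmeas: "h \<in> borel_measurable M" if "h \<in> H n" for h n
    by (rule midpoint_closure_measurable[OF that[unfolded H_def]]) (use v in auto)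
  have Hm: "norm (h x) \<le> m x" if "h \<in> H n" for h n x
    by (rule midpoint_closure_norm_le[OF that[unfolded H_def]]) (use vm in auto)
  have mid: "(\<lambda>x. (1/2) *\<^sub>R (f x + g x)) \<in> H n" if "f \<in> H n" "g \<in> H n" for f g n
    using that unfolding H_def by (rule midpoint_closure.midpoint)
  have Hmono: "H p \<subseteq> H n" if "n \<le> p" for n p
    unfolding H_def using that by (intro midpoint_closure_mono) auto
  have vH: "v n \<in> H n" for n unfolding H_def by (intro midpoint_closure.base) auto
  have sq_le: "(norm y)\<^sup>2 / m x \<le> m x" if "norm y \<le> m x" for x and y :: 'b
  proof (cases "m x = 0")
    case False
    then have "m x > 0" using m0[of x] by simp
    moreover have "(norm y)\<^sup>2 \<le> m x * m x" unfolding power2_eq_square using that m0 by (intro mult_mono) auto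
    ultimately show ?thesis by (simp add: pos_divide_le_eq)
  qed simp
  have Jint: "integrable M (\<lambda>x. (norm (h x))\<^sup>2 / m x)"
    if "h \<in> borel_measurable M" "\<And>x. norm (h x) \<le> m x" for h :: "'a \<Rightarrow> 'b"
  proof (rule Bochner_Integration.integrable_bound[OF m])
    show "(\<lambda>x. (norm (h x))\<^sup>2 / m x) \<in> borel_measurable M"
      using that(1) borel_measurable_integrable[OF m] by measurable
    show "AE x in M. norm ((norm (h x))\<^sup>2 / m x) \<le> norm (m x)"
      using sq_le[OF that(2)] m0 by (auto simp: abs_of_nonneg)
  qed
  have J0: "0 \<le> J h" for h unfolding J_def using m0 by (intro Bochner_Integration.integral_nonneg) auto
  have Jle: "J h \<le> integral\<^sup>L M m" if "h \<in> H n" for h n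
    unfolding J_def by (intro integral_mono Jint Hmeas[OF that] Hm[OF that] m sq_le)
  define a where "a n = (INF h\<in>H n. J h)" for n
  have bdd: "bdd_below (J ` H n)" for n using J0 by (intro bdd_belowI[of _ 0]) auto
  have a_le: "a n \<le> J h" if "h \<in> H n" for h n unfolding a_def using that by (intro cINF_lower bdd)
  have a_mono: "incseq a"
  proof (rule monoI)
    fix n p :: nat assume "n \<le> p"
    then show "a n \<le> a p"
      unfolding a_def using vH[of p] by (intro cINF_superset_mono[OF _ bdd Hmono]) auto
  qed
  have "a n \<le> integral\<^sup>L M m" for n using a_le[OF vH] Jle[OF vH] by (rule order.trans)
  then obtain L where L: "a \<longlonglongrightarrow> L" "\<And>n. a n \<le> L"
    using incseq_convergent[OF a_mono] by blast
  have "\<exists>g\<in>H n. J g < a n + 1 / real (Suc n)" for n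
    using cINF_less_iff[OF _ bdd, of n "a n + 1 / real (Suc n)"] vH[of n] by (auto simp: a_def)
  then obtain g where gH: "\<And>n. g n \<in> H n" and gJ: "\<And>n. J (g n) < a n + 1 / real (Suc n)" by metis
  define \<delta> where "\<delta> n = (L - a n) / 2 + 1 / real (Suc n)" for n
  have "\<delta> \<longlonglongrightarrow> (L - L) / 2 + 0"
    unfolding \<delta>_def by (intro tendsto_intros L LIMSEQ_Suc[OF lim_1_over_n]) simp
  then have \<delta>: "\<delta> \<longlonglongrightarrow> 0" by simp
  have half: "norm ((1/2) *\<^sub>R (f x - h x)) \<le> m x" if "f \<in> H n" "h \<in> H n" for f h n x
    using norm_triangle_ineq4[of "f x" "h x"] Hm[OF that(1), of x] Hm[OF that(2), of x] by simp
  have Jdiff: "J (\<lambda>x. (1/2) *\<^sub>R (g n x - g p x)) \<le> \<delta> n" if "n \<le> p" for n p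
  proof -
    have gp: "g p \<in> H n" using gH Hmono[OF that] by blast
    let ?s = "\<lambda>x. (1/2) *\<^sub>R (g n x + g p x)" and ?d = "\<lambda>x. (1/2) *\<^sub>R (g n x - g p x)"
    have s: "?s \<in> H n" by (rule mid[OF gH gp])
    have dm: "?d \<in> borel_measurable M"
      by (intro borel_measurable_scaleR borel_measurable_diff Hmeas[OF gH] borel_measurable_const)
    have id: "integrable M (\<lambda>x. (norm (?d x))\<^sup>2 / m x)" by (intro Jint dm half[OF gH gp])
    have ints: "integrable M (\<lambda>x. (norm (?s x))\<^sup>2 / m x)" by (intro Jint Hmeas[OF s] Hm[OF s])
    have in1: "integrable M (\<lambda>x. (norm (g n x))\<^sup>2 / m x)" by (intro Jint Hmeas[OF gH] Hm[OF gH])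
    have ip: "integrable M (\<lambda>x. (norm (g p x))\<^sup>2 / m x)" by (intro Jint Hmeas[OF gH] Hm[OF gH])
    have pt: "(norm (?s x))\<^sup>2 + (norm (?d x))\<^sup>2 = ((norm (g n x))\<^sup>2 + (norm (g p x))\<^sup>2) / 2" for x
      by (simp add: power2_norm_eq_inner inner_simps field_simps inner_commute)
    have "J ?s + J ?d = (LINT x|M. (norm (?s x))\<^sup>2 / m x + (norm (?d x))\<^sup>2 / m x)"
      unfolding J_def by (rule Bochner_Integration.integral_add[OF ints id, symmetric])
    also have "\<dots> = (LINT x|M. ((norm (g n x))\<^sup>2 / m x + (norm (g p x))\<^sup>2 / m x) / 2)"
      by (rule Bochner_Integration.integral_cong[OF refl])
        (simp only: pt add_divide_distrib[symmetric] divide_divide_eq_left mult.commute[of "2::real"])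
    also have "\<dots> = (J (g n) + J (g p)) / 2"
      unfolding J_def using Bochner_Integration.integral_add[OF in1 ip] by simp
    finally have "J ?d = (J (g n) + J (g p)) / 2 - J ?s" by linarith
    also have "\<dots> \<le> ((a n + 1 / real (Suc n)) + (L + 1 / real (Suc p))) / 2 - a n"
    proof -
      have "(x + y) / 2 - s \<le> (A + (l + c)) / 2 - b"
        if "x < A" "y < B + c" "B \<le> l" "b \<le> s" for x y s A B b c l :: real
        using that by (simp add: field_simps)
      from this[OF gJ gJ L(2) a_le[OF s]] show ?thesis .
    qed
    also have "\<dots> \<le> \<delta> n"
    proof -
      have "1 / real (Suc p) \<le> 1 / real (Suc n)" using that by (simp add: divide_simps)
      then show ?thesis unfolding \<delta>_def by (simp add: field_simps del: of_nat_Suc)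
    qed
    finally show ?thesis .
  qed
  have L1: "(LINT x|M. norm (g n x - g p x)) \<le> \<eta> / 2 * integral\<^sup>L M m + 2 / \<eta> * \<delta> n"
    if "n \<le> p" "\<eta> > 0" for n p \<eta>
  proof -
    have gp: "g p \<in> H n" using gH Hmono[OF that(1)] by blast
    let ?d = "\<lambda>x. (1/2) *\<^sub>R (g n x - g p x)"
    have dm: "?d \<in> borel_measurable M"
      by (intro borel_measurable_scaleR borel_measurable_diff Hmeas[OF gH] borel_measurable_const)
    have id: "integrable M (\<lambda>x. (norm (?d x))\<^sup>2 / m x)" by (intro Jint dm half[OF gH gp])
    have pt: "norm (g n x - g p x) \<le> \<eta> / 2 * m x + 2 / \<eta> * ((norm (?d x))\<^sup>2 / m x)" for x
    proof (cases "m x = 0")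
      case True
      then show ?thesis using Hm[OF gH, of n x] Hm[OF gH, of p x] by simp
    next
      case False
      then have mx: "m x > 0" using m0[of x] by simp
      let ?w = "norm (g n x - g p x)"
      have young: "w \<le> \<eta> / 2 * c + w\<^sup>2 / (2 * \<eta> * c)" if "c > 0" for w c :: real
      proof -
        have "2 * \<eta> * c * w \<le> (\<eta> * c)\<^sup>2 + w\<^sup>2"
          using zero_le_power2[of "\<eta> * c - w"] by (simp add: power2_diff algebra_simps)
        then have "w \<le> ((\<eta> * c)\<^sup>2 + w\<^sup>2) / (2 * \<eta> * c)"
          using that \<open>\<eta> > 0\<close> by (subst pos_le_divide_eq) (simp_all add: mult.commute)
        also have "\<dots> = \<eta> / 2 * c + w\<^sup>2 / (2 * \<eta> * c)"
          using that \<open>\<eta> > 0\<close> by (simp add: add_divide_distrib power2_eq_square)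
        finally show ?thesis .
      qed
      have "?w\<^sup>2 / (2 * \<eta> * m x) = 2 / \<eta> * ((norm (?d x))\<^sup>2 / m x)"
        by (simp add: power_mult_distrib power_divide)
      then show ?thesis using young[OF mx, of ?w] by simp
    qed
    have "(LINT x|M. norm (g n x - g p x))
        \<le> (LINT x|M. \<eta> / 2 * m x + 2 / \<eta> * ((norm (?d x))\<^sup>2 / m x))"
    proof (rule integral_mono)
      show ii: "integrable M (\<lambda>x. \<eta> / 2 * m x + 2 / \<eta> * ((norm (?d x))\<^sup>2 / m x))"
        by (rule Bochner_Integration.integrable_add[OF integrable_mult_right[OF m] integrable_mult_right[OF id]])
      show "integrable M (\<lambda>x. norm (g n x - g p x))"
      proof (rule Bochner_Integration.integrable_bound[OF ii])
        show "(\<lambda>x. norm (g n x - g p x)) \<in> borel_measurable M"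
          using Hmeas[OF gH] by measurable
        show "AE x in M. norm (norm (g n x - g p x)) \<le> norm (\<eta> / 2 * m x + 2 / \<eta> * ((norm (?d x))\<^sup>2 / m x))"
        proof (rule AE_I2)
          fix x show "norm (norm (g n x - g p x)) \<le> norm (\<eta> / 2 * m x + 2 / \<eta> * ((norm (?d x))\<^sup>2 / m x))"
            using order.trans[OF pt[of x] abs_ge_self] by (simp only: real_norm_def abs_norm_cancel)
        qed
      qed
    qed (rule pt)
    also have "\<dots> = \<eta> / 2 * integral\<^sup>L M m + 2 / \<eta> * J ?d"
      unfolding J_def
      by (subst Bochner_Integration.integral_add[OF integrable_mult_right[OF m] integrable_mult_right[OF id]])
        (simp only: integral_mult_right_zero)
    also have "\<dots> \<le> \<eta> / 2 * integral\<^sup>L M m + 2 / \<eta> * \<delta> n"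
      using Jdiff[OF that(1)] that(2) by (intro add_left_mono mult_left_mono) auto
    finally show ?thesis .
  qed
  have gint: "integrable M (g n)" for n
    by (rule Bochner_Integration.integrable_bound[OF m Hmeas[OF gH]])
      (use Hm[OF gH] m0 in auto)
  have "\<exists>N. \<forall>i\<ge>N. \<forall>j\<ge>N. (LINT x|M. norm (g i x - g j x)) < e" if e: "e > 0" for e
  proof -
    let ?I = "integral\<^sup>L M m"
    have I0: "0 \<le> ?I" using m0 by (intro Bochner_Integration.integral_nonneg) auto
    \<comment> \<open>The summand \<open>1\<close> keeps \<open>\<eta>\<close> defined when the majorant has integral \<open>0\<close>.\<close>
    define \<eta> where "\<eta> = e / (?I + 1)"
    have \<eta>: "\<eta> > 0" using e I0 by (simp add: \<eta>_def)
    have "\<eta> / 2 * ?I \<le> e / 2" using e I0 by (simp add: \<eta>_def field_simps)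
    moreover have "\<forall>\<^sub>F n in sequentially. \<delta> n < e * \<eta> / 4"
      using e \<eta> by (intro order_tendstoD[OF \<delta>]) auto
    then obtain N where N: "\<And>n. n \<ge> N \<Longrightarrow> \<delta> n < e * \<eta> / 4" by (auto simp: eventually_sequentially)
    have "2 / \<eta> * \<delta> n < e / 2" if "n \<ge> N" for n
      using N[OF that] \<eta> by (simp add: field_simps)
    ultimately have *: "(LINT x|M. norm (g i x - g j x)) < e" if "i \<ge> N" "i \<le> j" for i j
      using L1[OF that(2) \<eta>] that(1) by fastforce
    have "(LINT x|M. norm (g i x - g j x)) < e" if "i \<ge> N" "j \<ge> N" for i j
      using *[of i j] *[of j i] that by (cases "i \<le> j") (auto simp: norm_minus_commute)
    then show ?thesis by blast
  qed
  then obtain r where r: "strict_mono r" "AE x in M. Cauchy (\<lambda>i. g (r i) x)"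
    using cauchy_L1_AE_cauchy_subseq[where s = g, OF gint] by blast
  show thesis
  proof
    show "g (r n) \<in> midpoint_closure (v ` {n..})" for n
      using gH Hmono[OF seq_suble[OF r(1)], of n] unfolding H_def by blast
    show "AE x in M. convergent (\<lambda>n. g (r n) x)"
      using r(2) by eventually_elim (simp add: Cauchy_convergent_iff)
  qed
qed

section \<open>Volterra inclusions with a Filippov right-hand side\<close>

text \<open>Otherwise a hyperplane would separate the average from the set strictly, against monotonicity of the integral.\<close>

lemma average_in_closed_convex:
  fixes g :: "'k::euclidean_space \<Rightarrow> 'm::euclidean_space"
  assumes S: "closed S" "convex S" and r: "r > 0"
    and g: "integrable lborel (\<lambda>y. indicator (ball z r) y *\<^sub>R g y)"
    and gS: "AE y in lborel. y \<in> ball z r \<longrightarrow> g y \<in> S"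
  shows "(LINT y|lborel. indicator (ball z r) y *\<^sub>R g y) /\<^sub>R measure lborel (ball z r) \<in> S"
proof (rule ccontr)
  let ?m = "measure lborel (ball z r)"
  let ?A = "(LINT y|lborel. indicator (ball z r) y *\<^sub>R g y) /\<^sub>R ?m"
  have m: "?m > 0" using r by (rule content_ball_pos)
  assume "?A \<notin> S"
  then obtain a b where ab: "inner a ?A < b" "\<forall>x\<in>S. inner a x > b"
    using separating_hyperplane_closed_point[OF S(2,1)] by blast
  have i1: "integrable lborel (\<lambda>y. indicator (ball z r) y * b)"
    by (intro integrable_mult_left integrable_real_indicator)
      (use emeasure_lborel_ball_finite[of z r] in auto)
  have i2: "integrable lborel (\<lambda>y. a \<bullet> (indicator (ball z r) y *\<^sub>R g y))"
    by (rule integrable_inner_right, rule g)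
  have "b * ?m = (LINT y|lborel. indicator (ball z r) y * b)" by simp
  also have "\<dots> \<le> (LINT y|lborel. a \<bullet> (indicator (ball z r) y *\<^sub>R g y))"
  proof (rule integral_mono_AE[OF i1 i2])
    show "AE y in lborel. indicator (ball z r) y * b \<le> a \<bullet> (indicator (ball z r) y *\<^sub>R g y)"
      using gS
    proof eventually_elim
      case (elim y)
      then show ?case using ab(2) by (cases "y \<in> ball z r") (auto intro: less_imp_le)
    qed
  qed
  also have "\<dots> = a \<bullet> (LINT y|lborel. indicator (ball z r) y *\<^sub>R g y)"
    using g by (rule integral_inner_right)
  also have "\<dots> = (a \<bullet> ?A) * ?m" using m by (simp add: inner_scaleR_right)
  finally have "b \<le> a \<bullet> ?A" using m by simp
  with ab(1) show False by simp
qed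

definition ball_average :: "real \<Rightarrow> ('k::euclidean_space \<Rightarrow> 'm::euclidean_space) \<Rightarrow> 'k \<Rightarrow> 'm" where
  "ball_average r g z = (LINT y|lborel. indicator (ball z r) y *\<^sub>R g y) /\<^sub>R measure lborel (ball z r)"

lemma integrable_indicator_ball:
  fixes g :: "'k::euclidean_space \<Rightarrow> 'm::euclidean_space"
  assumes "g \<in> borel_measurable borel" "\<And>y. norm (g y) \<le> c"
  shows "integrable lborel (\<lambda>y. indicator (ball z r) y *\<^sub>R g y)"
proof (rule Bochner_Integration.integrable_bound)
  show "integrable lborel (\<lambda>y. c * indicator (ball z r) y)"
    by (intro integrable_mult_right integrable_real_indicator)
      (use emeasure_lborel_ball_finite[of z r] in auto)
  show "(\<lambda>y. indicator (ball z r) y *\<^sub>R g y) \<in> borel_measurable lborel"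
    using assms(1) by (intro borel_measurable_scaleR borel_measurable_indicator) auto
  show "AE y in lborel. norm (indicator (ball z r) y *\<^sub>R g y) \<le> norm (c * indicator (ball z r) y)"
    using assms(2) by (intro AE_I2) (auto simp: indicator_def intro: order.trans[OF _ abs_ge_self])
qed

lemma ball_average_in_closed_convex:
  fixes g :: "'k::euclidean_space \<Rightarrow> 'm::euclidean_space"
  assumes "closed S" "convex S" "r > 0" "g \<in> borel_measurable borel" "\<And>y. norm (g y) \<le> c"
    "AE y in lborel. y \<in> ball z r \<longrightarrow> g y \<in> S"
  shows "ball_average r g z \<in> S"
  unfolding ball_average_def
  by (rule average_in_closed_convex) (use assms in \<open>auto intro!: integrable_indicator_ball\<close>)

lemma ball_average_norm_le:
  fixes g :: "'k::euclidean_space \<Rightarrow> 'm::euclidean_space"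
  assumes "r > 0" "g \<in> borel_measurable borel" "\<And>y. norm (g y) \<le> c"
  shows "norm (ball_average r g z) \<le> c"
  using ball_average_in_closed_convex[where S = "cball 0 c", OF closed_cball convex_cball assms, of z] assms(3) by simp

lemma ball_average_measurable:
  fixes w :: "real \<Rightarrow> 'k::euclidean_space \<Rightarrow> 'm::euclidean_space"
  assumes w [measurable]: "(\<lambda>(t, y). w t y) \<in> borel_measurable (borel \<Otimes>\<^sub>M borel)"
    and z [measurable]: "z \<in> borel_measurable borel"
  shows "(\<lambda>t. ball_average r (w t) (z t)) \<in> borel_measurable borel"
proof -
  have m: "measure lborel (ball x r) = measure lborel (ball (0::'k) r)" for x :: 'k
  proof (cases "r \<ge> 0")
    case False
    then have e: "ball x r = {}" "ball (0::'k) r = {}" by simp_all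
    show ?thesis by (simp only: e)
  qed (simp add: content_ball)
  have ind: "(\<lambda>x. indicator (ball (z (fst x)) r) (snd x) :: real) \<in> borel_measurable (borel \<Otimes>\<^sub>M lborel)"
  proof -
    have "(\<lambda>x. dist (z (fst x)) (snd x)) \<in> borel_measurable (borel \<Otimes>\<^sub>M lborel)"
      by measurable
    then have "{x \<in> space (borel \<Otimes>\<^sub>M lborel). dist (z (fst x)) (snd x) < r} \<in> sets (borel \<Otimes>\<^sub>M lborel)"
      by measurable
    then have "(indicator {x \<in> space (borel \<Otimes>\<^sub>M lborel). dist (z (fst x)) (snd x) < r} :: _ \<Rightarrow> real)
        \<in> borel_measurable (borel \<Otimes>\<^sub>M lborel)"
      by (rule borel_measurable_indicator)
    then show ?thesis
      by (rule measurable_cong[THEN iffD1, rotated]) (auto simp: indicator_def)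
  qed
  have w': "(\<lambda>x. w (fst x) (snd x)) \<in> borel_measurable (borel \<Otimes>\<^sub>M lborel)"
    using w by (simp add: case_prod_beta' cong: measurable_cong_sets)
  have "(\<lambda>(t, y). indicator (ball (z t) r) y *\<^sub>R w t y) \<in> borel_measurable (borel \<Otimes>\<^sub>M lborel)"
    using borel_measurable_scaleR[OF ind w'] by (simp add: case_prod_beta')
  then have "(\<lambda>t. LINT y|lborel. indicator (ball (z t) r) y *\<^sub>R w t y) \<in> borel_measurable borel"
    by (rule sigma_finite_measure.borel_measurable_lebesgue_integral[OF sigma_finite_lborel])
  moreover have "ball_average r (w t) (z t)
      = (LINT y|lborel. indicator (ball (z t) r) y *\<^sub>R w t y) /\<^sub>R measure lborel (ball (0::'k) r)" for t
    unfolding ball_average_def m[of "z t"] ..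
  ultimately show ?thesis by simp
qed

text \<open>The weight \<open>exp (- t)\<close> admits majorants that are integrable as well as constant ones, so that local and global
solutions come from the same construction.\<close>

locale volterra =
  fixes G :: "real \<Rightarrow> 'm::euclidean_space \<Rightarrow>\<^sub>L 'k::euclidean_space" and a :: real
    and \<mu> :: "real \<Rightarrow> real"
  assumes G: "continuous_on {0..} G"
    and \<mu>_measurable [measurable]: "\<mu> \<in> borel_measurable borel"
    and \<mu>_nonneg: "\<And>t. 0 \<le> \<mu> t" and \<mu>_zero: "\<And>t. t < a \<Longrightarrow> \<mu> t = 0"
    and \<mu>_integrable: "integrable lborel (\<lambda>t. exp (- t) * \<mu> t)"
begin

text \<open>Extending the kernel by \<open>0\<close> to negative times lets every convolution be an integral over the whole line.\<close>

definition ker :: "real \<Rightarrow> 'm \<Rightarrow> 'k" where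
  "ker s w = (if 0 \<le> s then G s w else 0)"

definition conv :: "(real \<Rightarrow> 'm) \<Rightarrow> real \<Rightarrow> 'k" where
  "conv v t = (LINT \<tau>|lborel. ker (t - \<tau>) (v \<tau>))"

definition admissible :: "(real \<Rightarrow> 'm) \<Rightarrow> bool" where
  "admissible v \<longleftrightarrow> v \<in> borel_measurable borel \<and> (\<forall>\<tau>. norm (v \<tau>) \<le> \<mu> \<tau>)"

lemma ker_measurable:
  assumes [measurable]: "f \<in> borel_measurable M" "g \<in> borel_measurable M"
  shows "(\<lambda>x. ker (f x) (g x)) \<in> borel_measurable M"
proof -
  have "continuous_on UNIV (\<lambda>x::real \<times> 'm. G (max 0 (fst x)) (snd x))"
    by (intro blinfun.continuous_on continuous_on_compose2[OF G] continuous_intros) auto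
  then have [measurable]: "(\<lambda>x. G (max 0 (f x)) (g x)) \<in> borel_measurable M"
    using borel_measurable_continuous_Pair[OF assms, of "\<lambda>s w. G (max 0 s) w"] by simp
  have "(\<lambda>x. if 0 \<le> f x then G (max 0 (f x)) (g x) else 0) \<in> borel_measurable M"
    by measurable
  then show ?thesis by (simp add: ker_def max_def cong: if_cong)
qed

lemma conv_measurable:
  assumes [measurable]: "v \<in> borel_measurable borel"
  shows "conv v \<in> borel_measurable borel"
proof -
  have "(\<lambda>x. ker (fst x - snd x) (v (snd x))) \<in> borel_measurable (borel \<Otimes>\<^sub>M lborel)"
    by (intro ker_measurable) measurable
  then have "(\<lambda>(t, \<tau>). ker (t - \<tau>) (v \<tau>)) \<in> borel_measurable (borel \<Otimes>\<^sub>M lborel)"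
    by (simp add: case_prod_beta')
  then show ?thesis unfolding conv_def
    by (rule sigma_finite_measure.borel_measurable_lebesgue_integral[OF sigma_finite_lborel])
qed

lemma ker_bound:
  obtains K where "\<And>s w. s \<le> T \<Longrightarrow> norm (ker s w) \<le> K * norm w" "0 \<le> K"
proof -
  have "continuous_on {0..T} G" using G by (rule continuous_on_subset) auto
  then have "bounded (G ` {0..T})"
    by (intro compact_imp_bounded compact_continuous_image compact_Icc)
  then obtain K where K: "\<And>s. s \<in> {0..T} \<Longrightarrow> norm (G s) \<le> K"
    unfolding bounded_iff by blast
  have "norm (ker s w) \<le> max K 0 * norm w" if "s \<le> T" for s w
  proof (cases "0 \<le> s")
    case True
    then have "norm (G s w) \<le> norm (G s) * norm w" by (intro norm_blinfun)
    also have "\<dots> \<le> max K 0 * norm w"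
      using True that by (intro mult_right_mono max.coboundedI1 K) auto
    finally show ?thesis using True by (simp add: ker_def)
  qed (simp add: ker_def)
  then show thesis using that[of "max K 0"] by auto
qed

lemma \<mu>_locally_integrable: "integrable lborel (\<lambda>\<tau>. indicator {..t} \<tau> * \<mu> \<tau>)"
proof (rule Bochner_Integration.integrable_bound)
  show "integrable lborel (\<lambda>\<tau>. exp t * (exp (- \<tau>) * \<mu> \<tau>))"
    using \<mu>_integrable by (rule integrable_mult_right)
  show "AE \<tau> in lborel. norm (indicator {..t} \<tau> * \<mu> \<tau>) \<le> norm (exp t * (exp (- \<tau>) * \<mu> \<tau>))"
  proof (rule AE_I2)
    fix \<tau>
    have "\<mu> \<tau> \<le> exp t * (exp (- \<tau>) * \<mu> \<tau>)" if "\<tau> \<le> t"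
    proof -
      have "1 * \<mu> \<tau> \<le> exp (t - \<tau>) * \<mu> \<tau>"
        using that by (intro mult_right_mono \<mu>_nonneg) simp
      then show ?thesis by (simp add: exp_diff exp_minus divide_inverse)
    qed
    then show "norm (indicator {..t} \<tau> * \<mu> \<tau>) \<le> norm (exp t * (exp (- \<tau>) * \<mu> \<tau>))"
      using \<mu>_nonneg[of \<tau>] by (auto simp: indicator_def abs_mult)
  qed
qed simp

text \<open>A bound of the kernel on \<open>{..T - a}\<close> suffices, since an admissible input vanishes before \<open>a\<close> and the kernel
vanishes after \<open>t\<close>.\<close>

lemma ker_le:
  assumes K: "\<And>s w. s \<le> T - a \<Longrightarrow> norm (ker s w) \<le> K * norm w" "0 \<le> K"
    and t: "t \<le> T" and v: "admissible v"
  shows "norm (ker (t - \<tau>) (v \<tau>)) \<le> K * (indicator {..T} \<tau> * \<mu> \<tau>)"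
proof -
  have vm: "norm (v \<tau>) \<le> \<mu> \<tau>" using v by (simp add: admissible_def)
  consider "\<tau> < a" | "a \<le> \<tau>" "\<tau> \<le> t" | "t < \<tau>" by linarith
  then show ?thesis
  proof cases
    case 1
    then have "v \<tau> = 0" using vm \<mu>_zero by simp
    then show ?thesis using K(2) \<mu>_nonneg by (simp add: ker_def blinfun.zero_right indicator_def)
  next
    case 2
    then have "norm (ker (t - \<tau>) (v \<tau>)) \<le> K * norm (v \<tau>)" using t by (intro K) auto
    also have "\<dots> \<le> K * \<mu> \<tau>" using vm K(2) by (rule mult_left_mono)
    finally show ?thesis using 2 t by simp
  next
    case 3
    then show ?thesis using K(2) \<mu>_nonneg by (simp add: ker_def indicator_def)
  qed
qed

lemma ker_conv_measurable:
  "admissible v \<Longrightarrow> (\<lambda>\<tau>. ker (t - \<tau>) (v \<tau>)) \<in> borel_measurable lborel"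
  unfolding admissible_def by (intro ker_measurable) auto

lemma ker_integrable:
  assumes v: "admissible v"
  shows "integrable lborel (\<lambda>\<tau>. ker (t - \<tau>) (v \<tau>))"
proof -
  obtain K where K: "\<And>s w. s \<le> t - a \<Longrightarrow> norm (ker s w) \<le> K * norm w" "0 \<le> K"
    using ker_bound by blast
  show ?thesis
  proof (rule Bochner_Integration.integrable_bound)
    show "integrable lborel (\<lambda>\<tau>. K * (indicator {..t} \<tau> * \<mu> \<tau>))"
      by (intro integrable_mult_right \<mu>_locally_integrable)
    show "AE \<tau> in lborel. norm (ker (t - \<tau>) (v \<tau>)) \<le> norm (K * (indicator {..t} \<tau> * \<mu> \<tau>))"
      using ker_le[OF K order_refl v] by (intro AE_I2) (auto intro: order.trans[OF _ abs_ge_self])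
  qed (rule ker_conv_measurable[OF v])
qed

lemma conv_bounded: "\<exists>B. \<forall>v. admissible v \<longrightarrow> norm (conv v t) \<le> B"
proof -
  obtain K where K: "\<And>s w. s \<le> t - a \<Longrightarrow> norm (ker s w) \<le> K * norm w" "0 \<le> K"
    using ker_bound by blast
  have "norm (conv v t) \<le> (LINT \<tau>|lborel. K * (indicator {..t} \<tau> * \<mu> \<tau>))" if v: "admissible v" for v
    unfolding conv_def
    by (rule Bochner_Integration.integral_norm_bound_integral)
      (auto intro!: ker_integrable[OF v] integrable_mult_right \<mu>_locally_integrable ker_le[OF K order_refl v])
  then show ?thesis by blast
qed

text \<open>The inputs may vary with \<open>n\<close>, since they enter only through their common majorant. The kernel jumps at \<open>0\<close>, so the
integrands converge at every \<open>\<tau> \<noteq> t\<close>.\<close>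

lemma conv_equicontinuous_sequence:
  assumes s: "s \<longlonglongrightarrow> t" and v: "\<And>n::nat. admissible (v n)"
  shows "(\<lambda>n. conv (v n) (s n) - conv (v n) t) \<longlonglongrightarrow> 0"
proof -
  obtain T where T: "\<And>n. \<bar>s n\<bar> \<le> T" using convergent_imp_Bseq[OF convergentI[OF s]]
    by (auto simp: Bseq_def)
  define T' where "T' = max T t"
  have sT: "s n \<le> T'" "t \<le> T'" for n using T[of n] by (auto simp: T'_def)
  obtain K where K: "\<And>s w. s \<le> T' - a \<Longrightarrow> norm (ker s w) \<le> K * norm w" "0 \<le> K"
    using ker_bound by blast
  have "(\<lambda>n. LINT \<tau>|lborel. ker (s n - \<tau>) (v n \<tau>) - ker (t - \<tau>) (v n \<tau>)) \<longlonglongrightarrow> (LINT \<tau>::real|lborel. 0)"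
  proof (rule Bochner_Integration.integral_dominated_convergence)
    let ?m = "\<lambda>\<tau>. K * (indicator {..T'} \<tau> * \<mu> \<tau>)"
    show "integrable lborel (\<lambda>\<tau>. ?m \<tau> + ?m \<tau>)"
      by (intro Bochner_Integration.integrable_add integrable_mult_right \<mu>_locally_integrable)
    show "AE \<tau> in lborel. norm (ker (s n - \<tau>) (v n \<tau>) - ker (t - \<tau>) (v n \<tau>)) \<le> ?m \<tau> + ?m \<tau>" for n
      by (rule AE_I2, rule order.trans[OF norm_triangle_ineq4],
          rule add_mono[OF ker_le[OF K sT(1) v] ker_le[OF K sT(2) v]])
    show "(\<lambda>\<tau>. ker (s n - \<tau>) (v n \<tau>) - ker (t - \<tau>) (v n \<tau>)) \<in> borel_measurable lborel" for n
      by (intro borel_measurable_diff ker_conv_measurable v)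
    show "AE \<tau> in lborel. (\<lambda>n. ker (s n - \<tau>) (v n \<tau>) - ker (t - \<tau>) (v n \<tau>)) \<longlonglongrightarrow> 0"
      using AE_lborel_singleton[of t]
    proof eventually_elim
      case (elim \<tau>)
      show ?case
      proof (cases "\<tau> < t")
        case True
        have "continuous_on UNIV (\<lambda>s. G (max 0 s))"
          by (intro continuous_on_compose2[OF G] continuous_intros) auto
        then have "isCont (\<lambda>s. G (max 0 s)) (t - \<tau>)" by (simp add: continuous_on_eq_continuous_at)
        moreover have "(\<lambda>n. s n - \<tau>) \<longlonglongrightarrow> t - \<tau>" by (intro tendsto_diff s tendsto_const)
        ultimately have "(\<lambda>n. G (max 0 (s n - \<tau>))) \<longlonglongrightarrow> G (max 0 (t - \<tau>))"
          by (rule isCont_tendsto_compose)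
        then have "(\<lambda>n. norm (G (max 0 (s n - \<tau>)) - G (max 0 (t - \<tau>))) * \<mu> \<tau>) \<longlonglongrightarrow> 0"
          by (intro tendsto_mult_left_zero tendsto_norm_zero LIM_zero)
        moreover have "\<forall>\<^sub>F n in sequentially. s n > \<tau>" using order_tendstoD(1)[OF s True] .
        then have "\<forall>\<^sub>F n in sequentially. norm (ker (s n - \<tau>) (v n \<tau>) - ker (t - \<tau>) (v n \<tau>))
            \<le> norm (G (max 0 (s n - \<tau>)) - G (max 0 (t - \<tau>))) * \<mu> \<tau>"
        proof eventually_elim
          case (elim n)
          then have "ker (s n - \<tau>) (v n \<tau>) - ker (t - \<tau>) (v n \<tau>)
              = (G (max 0 (s n - \<tau>)) - G (max 0 (t - \<tau>))) (v n \<tau>)"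
            using True by (simp add: ker_def blinfun.diff_left)
          also have "norm \<dots> \<le> norm (G (max 0 (s n - \<tau>)) - G (max 0 (t - \<tau>))) * norm (v n \<tau>)"
            by (rule norm_blinfun)
          also have "\<dots> \<le> norm (G (max 0 (s n - \<tau>)) - G (max 0 (t - \<tau>))) * \<mu> \<tau>"
            using v by (intro mult_left_mono) (auto simp: admissible_def)
          finally show ?case .
        qed
        ultimately show ?thesis by (rule Lim_null_comparison[rotated])
      next
        case False
        then have "t < \<tau>" using elim by simp
        then have "\<forall>\<^sub>F n in sequentially. s n < \<tau>" by (rule order_tendstoD(2)[OF s])
        then have "\<forall>\<^sub>F n in sequentially. ker (s n - \<tau>) (v n \<tau>) - ker (t - \<tau>) (v n \<tau>) = 0"
          by eventually_elim (use \<open>t < \<tau>\<close> in \<open>simp add: ker_def\<close>)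
        then show ?thesis by (rule tendsto_eventually)
      qed
    qed
  qed simp
  moreover have "conv (v n) (s n) - conv (v n) t
      = (LINT \<tau>|lborel. ker (s n - \<tau>) (v n \<tau>) - ker (t - \<tau>) (v n \<tau>))" for n
    unfolding conv_def by (intro Bochner_Integration.integral_diff[symmetric] ker_integrable v)
  ultimately show ?thesis by simp
qed

text \<open>The sequential statement, used for inputs that would violate uniformity.\<close>

lemma conv_equicontinuous:
  assumes "e > 0"
  shows "\<exists>d>0. \<forall>s v. dist s t < d \<longrightarrow> admissible v \<longrightarrow> norm (conv v s - conv v t) < e"
proof (rule ccontr)
  assume "\<not> ?thesis"
  note neg = this
  have "\<exists>s v. dist s t < inverse (real (Suc n)) \<and> admissible v \<and> \<not> norm (conv v s - conv v t) < e" for n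
  proof -
    have "0 < inverse (real (Suc n))" by simp
    with neg show ?thesis by blast
  qed
  then obtain s v where s: "\<And>n. dist (s n) t < inverse (real (Suc n))"
    and v: "\<And>n. admissible (v n)" and e: "\<And>n. \<not> norm (conv (v n) (s n) - conv (v n) t) < e"
    by metis
  have "s \<longlonglongrightarrow> t"
  proof (rule metric_tendsto_imp_tendsto[OF LIMSEQ_inverse_real_of_nat])
    show "\<forall>\<^sub>F n in sequentially. dist (s n) t \<le> dist (inverse (real (Suc n))) 0"
      using s by (intro always_eventually allI) (simp add: less_imp_le)
  qed
  from conv_equicontinuous_sequence[OF this v]
  have "\<forall>\<^sub>F n in sequentially. norm (conv (v n) (s n) - conv (v n) t) < e"
    using assms by (auto simp: tendsto_iff dist_norm)
  then obtain n where "norm (conv (v n) (s n) - conv (v n) t) < e"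
    using eventually_happens'[OF sequentially_bot] by blast
  with e show False by blast
qed

lemma conv_continuous:
  assumes "admissible v"
  shows "continuous_on UNIV (conv v)"
  unfolding continuous_on_iff
proof (intro ballI allI impI)
  fix t e :: real assume "0 < e"
  then show "\<exists>d>0. \<forall>s\<in>UNIV. dist s t < d \<longrightarrow> dist (conv v s) (conv v t) < e"
    using conv_equicontinuous[of e t] assms by (auto simp: dist_norm)
qed

text \<open>On \<open>t < a + j \<eta>\<close> the right-hand side only involves values of \<open>y\<close> at times before \<open>a + (j - 1) \<eta>\<close>, so the \<open>j\<close>-th Picard
iterate is already exact there. The limit of the iterates is eventually constant at each time, hence
a measurable solution.\<close>

lemma delay_equation:
  fixes F :: "real \<Rightarrow> 'k \<Rightarrow> 'm"
  assumes F: "\<And>z. z \<in> borel_measurable borel \<Longrightarrow> (\<lambda>t. F t (z t)) \<in> borel_measurable borel"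
    and F0: "\<And>t z. t < a \<Longrightarrow> F t z = 0"
    and f [measurable]: "f \<in> borel_measurable borel" and \<eta>: "\<eta> > 0"
  obtains y where "y \<in> borel_measurable borel"
    "\<And>t. y t = f t + conv (\<lambda>\<tau>. F \<tau> (y (\<tau> - \<eta>))) t"
proof -
  define \<Theta> where "\<Theta> y t = f t + conv (\<lambda>\<tau>. F \<tau> (y (\<tau> - \<eta>))) t" for y t
  have \<Theta>_meas: "\<Theta> y \<in> borel_measurable borel" if [measurable]: "y \<in> borel_measurable borel" for y
  proof -
    have "(\<lambda>\<tau>. y (\<tau> - \<eta>)) \<in> borel_measurable borel" by measurable
    from borel_measurable_add[OF f conv_measurable[OF F[OF this]]]
    show ?thesis by (simp add: \<Theta>_def[abs_def])
  qed
  have cong: "\<Theta> y t = \<Theta> z t"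
    if "\<And>\<tau>. a \<le> \<tau> \<Longrightarrow> \<tau> \<le> t \<Longrightarrow> y (\<tau> - \<eta>) = z (\<tau> - \<eta>)" for y z t
  proof -
    have "ker (t - \<tau>) (F \<tau> (y (\<tau> - \<eta>))) = ker (t - \<tau>) (F \<tau> (z (\<tau> - \<eta>)))" for \<tau>
    proof -
      consider "\<tau> < a" | "t < \<tau>" | "a \<le> \<tau>" "\<tau> \<le> t" by linarith
      then show ?thesis
      proof cases
        case 1
        then show ?thesis by (simp only: F0)
      next
        case 2
        then show ?thesis by (simp add: ker_def)
      next
        case 3
        then show ?thesis by (simp only: that)
      qed
    qed
    then show ?thesis by (simp only: \<Theta>_def conv_def)
  qed
  define it where "it j = (\<Theta> ^^ j) f" for j
  have it_Suc: "it (Suc j) = \<Theta> (it j)" for j by (simp add: it_def)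
  have it_meas: "it j \<in> borel_measurable borel" for j
  proof (induction j)
    case 0
    show ?case using f by (simp add: it_def)
  next
    case (Suc j)
    then show ?case unfolding it_Suc by (rule \<Theta>_meas)
  qed
  have step_eq: "it (Suc j) t = it j t" if "t < a + real j * \<eta>" for j t
    using that
  proof (induction j arbitrary: t)
    case 0
    then have "ker (t - \<tau>) (F \<tau> z) = 0" for \<tau> z
      using F0[of \<tau> z] by (cases "\<tau> < a") (auto simp: ker_def)
    then have "\<Theta> f t = f t" by (simp add: \<Theta>_def conv_def)
    then show ?case by (simp add: it_def)
  next
    case (Suc j)
    have "it (Suc j) (\<tau> - \<eta>) = it j (\<tau> - \<eta>)" if "\<tau> \<le> t" for \<tau>
      using Suc.prems that by (intro Suc.IH) (simp add: algebra_simps)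
    then have "\<Theta> (it (Suc j)) t = \<Theta> (it j) t" by (intro cong) simp
    then show ?case by (simp only: it_Suc[symmetric])
  qed
  have later: "it k t = it j t" if "j \<le> k" "t < a + real j * \<eta>" for j k t
    using that(1)
  proof (induction k rule: dec_induct)
    case (step k)
    have "real j * \<eta> \<le> real k * \<eta>" using step.hyps \<eta> by (intro mult_right_mono) auto
    then have "it (Suc k) t = it k t" using that(2) by (intro step_eq) linarith
    with step.IH show ?case by simp
  qed simp
  have ex: "\<exists>j. t < a + real j * \<eta>" for t
  proof -
    obtain n where "t - a < real n * \<eta>" using reals_Archimedean3[OF \<eta>] by blast
    then have "t < a + real n * \<eta>" by linarith
    then show ?thesis by blast
  qed
  define y where "y t = lim (\<lambda>j. it j t)" for t
  have y_eq: "y t = it j t" if "t < a + real j * \<eta>" for j t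
  proof -
    have "(\<lambda>k. it k t) \<longlonglongrightarrow> it j t"
      by (rule tendsto_eventually, rule eventually_sequentiallyI[of j], rule later[OF _ that])
    then show ?thesis unfolding y_def by (rule limI)
  qed
  show thesis
  proof
    show "y \<in> borel_measurable borel"
      unfolding y_def by (intro borel_measurable_lim_metric it_meas)
    fix t
    obtain j where j: "t < a + real j * \<eta>" using ex by blast
    then have j': "t < a + real (Suc j) * \<eta>" using \<eta> by (simp add: algebra_simps)
    have "y t = \<Theta> (it j) t" using y_eq[OF j'] by (simp add: it_Suc)
    also have "\<dots> = \<Theta> y t"
      by (intro cong y_eq[symmetric]) (use j \<eta> in linarith)
    finally show "y t = f t + conv (\<lambda>\<tau>. F \<tau> (y (\<tau> - \<eta>))) t" by (simp add: \<Theta>_def)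
  qed
qed

lemma admissible_zero: "admissible (\<lambda>_. 0)"
  using \<mu>_nonneg by (simp add: admissible_def)

lemma conv_midpoint:
  assumes "admissible v" "admissible w"
  shows "conv (\<lambda>\<tau>. (1/2) *\<^sub>R (v \<tau> + w \<tau>)) t = (1/2) *\<^sub>R (conv v t + conv w t)"
proof -
  have "ker (t - \<tau>) ((1/2) *\<^sub>R (v \<tau> + w \<tau>)) = (1/2) *\<^sub>R (ker (t - \<tau>) (v \<tau>) + ker (t - \<tau>) (w \<tau>))" for \<tau>
    by (simp add: ker_def blinfun.add_right blinfun.scaleR_right)
  then show ?thesis
    using ker_integrable[OF assms(1), of t] ker_integrable[OF assms(2), of t] by (simp add: conv_def)
qed

lemma conv_in_convex:
  assumes h: "h \<in> midpoint_closure F" and F: "\<And>v. v \<in> F \<Longrightarrow> admissible v"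
    and S: "convex S" "\<And>v. v \<in> F \<Longrightarrow> conv v t \<in> S"
  shows "admissible h \<and> conv h t \<in> S"
  using h
proof induction
  case (base v)
  then show ?case using F S by blast
next
  case (midpoint v w)
  have "admissible (\<lambda>\<tau>. (1/2) *\<^sub>R (v \<tau> + w \<tau>))"
    unfolding admissible_def
  proof (intro conjI allI)
    show "(\<lambda>\<tau>. (1/2) *\<^sub>R (v \<tau> + w \<tau>)) \<in> borel_measurable borel"
      using midpoint.IH by (auto simp: admissible_def intro!: borel_measurable_scaleR borel_measurable_add)
    fix \<tau>
    have "v \<tau> \<in> cball 0 (\<mu> \<tau>)" "w \<tau> \<in> cball 0 (\<mu> \<tau>)"
      using midpoint.IH by (auto simp: admissible_def)
    from convex_midpoint[OF convex_cball this]
    show "norm ((1/2) *\<^sub>R (v \<tau> + w \<tau>)) \<le> \<mu> \<tau>" by simp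
  qed
  then show ?case
    using midpoint.IH convex_midpoint[OF S(1)] by (simp add: conv_midpoint)
qed

lemma conv_dominated_convergence:
  assumes h: "\<And>n::nat. admissible (h n)" and v: "admissible v"
    and lim: "AE \<tau> in lborel. (\<lambda>n. h n \<tau>) \<longlonglongrightarrow> v \<tau>"
  shows "(\<lambda>n. conv (h n) t) \<longlonglongrightarrow> conv v t"
proof -
  obtain K where K: "\<And>s w. s \<le> t - a \<Longrightarrow> norm (ker s w) \<le> K * norm w" "0 \<le> K"
    using ker_bound by blast
  show ?thesis
    unfolding conv_def
  proof (rule Bochner_Integration.integral_dominated_convergence)
    show "integrable lborel (\<lambda>\<tau>. K * (indicator {..t} \<tau> * \<mu> \<tau>))"
      by (intro integrable_mult_right \<mu>_locally_integrable)
    show "AE \<tau> in lborel. norm (ker (t - \<tau>) (h n \<tau>)) \<le> K * (indicator {..t} \<tau> * \<mu> \<tau>)" for n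
      by (rule AE_I2, rule ker_le[OF K order_refl h])
    show "AE \<tau> in lborel. (\<lambda>n. ker (t - \<tau>) (h n \<tau>)) \<longlonglongrightarrow> ker (t - \<tau>) (v \<tau>)"
      using lim
    proof eventually_elim
      case (elim \<tau>)
      then show ?case by (cases "0 \<le> t - \<tau>") (auto simp: ker_def intro: blinfun.tendsto tendsto_const)
    qed
  qed (rule ker_conv_measurable, fact)+
qed

text \<open>For every \<open>\<delta>\<close> the averaging balls eventually lie in the ball of radius \<open>\<delta>\<close> around the limit output, and averages do not see
null sets. So all late combinations, and their limit, lie in each of the closed convex sets
whose intersection is the regularization.\<close>

lemma filippov_limit:
  fixes w :: "real \<Rightarrow> 'k \<Rightarrow> 'm"
  assumes w: "w \<tau> \<in> borel_measurable borel" "\<And>y. norm (w \<tau> y) \<le> c"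
    and r: "\<And>n. r n > 0" "r \<longlonglongrightarrow> 0" and z: "z \<longlonglongrightarrow> y"
    and h: "\<And>n::nat. h n \<in> midpoint_closure ((\<lambda>n \<tau>. ball_average (r n) (w \<tau>) (Z n \<tau>)) ` {n..})"
    and Z: "\<And>n. Z n \<tau> = z n"
    and lim: "(\<lambda>n. h n \<tau>) \<longlonglongrightarrow> l"
  shows "l \<in> filippov_regularization w \<tau> y"
  unfolding filippov_regularization_def
proof (intro INT_I)
  fix \<delta> :: real and M :: "'k set" assume "\<delta> \<in> {0<..}" and M: "M \<in> null_sets lebesgue"
  then have \<delta>: "\<delta> > 0" by simp
  define S where "S = closure (convex hull (w \<tau> ` ((+) y ` ball 0 \<delta> - M)))"
  have S: "closed S" "convex S" by (auto simp: S_def convex_closure convex_convex_hull)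
  have "(\<lambda>n. dist (z n) y + r n) \<longlonglongrightarrow> dist y y + 0"
    by (intro tendsto_intros z r)
  then have "\<forall>\<^sub>F n in sequentially. dist (z n) y + r n < \<delta>"
    using order_tendstoD(2)[of "\<lambda>n. dist (z n) y + r n" 0 sequentially \<delta>] \<delta> by simp
  then obtain N where N: "\<And>n. n \<ge> N \<Longrightarrow> dist (z n) y + r n < \<delta>"
    by (auto simp: eventually_sequentially)
  have "AE x in lebesgue. x \<notin> M" using M by (rule AE_not_in)
  then have nM: "AE x in lborel. x \<notin> M" by (simp add: AE_completion_iff)
  have av: "ball_average (r n) (w \<tau>) (z n) \<in> S" if "n \<ge> N" for n
  proof (rule ball_average_in_closed_convex[OF S r(1) w])
    show "AE x in lborel. x \<in> ball (z n) (r n) \<longrightarrow> w \<tau> x \<in> S"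
      using nM
    proof eventually_elim
      case (elim x)
      show ?case
      proof
        assume "x \<in> ball (z n) (r n)"
        then have "dist y x < \<delta>"
          using N[OF that] dist_triangle[of y x "z n"] by (simp add: dist_commute)
        then have "x - y \<in> ball 0 \<delta>" by (simp add: dist_norm norm_minus_commute)
        then have "x \<in> (+) y ` ball 0 \<delta>" by (rule rev_image_eqI) simp
        with elim have "w \<tau> x \<in> w \<tau> ` ((+) y ` ball 0 \<delta> - M)" by blast
        then show "w \<tau> x \<in> S"
          unfolding S_def by (intro subsetD[OF closure_subset] hull_inc)
      qed
    qed
  qed
  have "h n \<tau> \<in> S" if "n \<ge> N" for n
    by (rule midpoint_closure_in_convex[OF h S(2)]) (use av that in \<open>auto simp: Z\<close>)
  then have "\<forall>\<^sub>F n in sequentially. h n \<tau> \<in> S" by (auto simp: eventually_sequentially)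
  from Lim_in_closed_set[OF S(1) this _ lim] show "l \<in> S" by simp
qed

text \<open>Pointwise convergence at rational times, which is a diagonal argument, extends to all times by equicontinuity. Equicontinuity also makes the delay
disappear in the limit, while the input is the almost everywhere limit of midpoint combinations.\<close>

theorem inclusion_solution_exists:
  fixes w :: "real \<Rightarrow> 'k \<Rightarrow> 'm"
  assumes w: "(\<lambda>(t, y). w t y) \<in> borel_measurable (borel \<Otimes>\<^sub>M borel)"
    and w\<mu>: "\<And>t y. norm (w t y) \<le> \<mu> t" and f: "continuous_on UNIV f"
  obtains y v where "admissible v" "\<And>t. y t = f t + conv v t"
    "AE t in lborel. v t \<in> filippov_regularization w t (y t)"
proof -
  have wt: "w t \<in> borel_measurable borel" for t
    using measurable_Pair2[OF w, of t] by simp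
  have fm: "f \<in> borel_measurable borel" using f by (rule borel_measurable_continuous_onI)
  define r where "r n = 1 / real (Suc n)" for n
  have r0: "r n > 0" for n by (simp add: r_def)
  have r: "r \<longlonglongrightarrow> 0" unfolding r_def by (rule LIMSEQ_Suc[OF lim_1_over_n])
  have av_zero: "ball_average (r n) (w t) z = 0" if "t < a" for n t z
    using ball_average_norm_le[OF r0 wt w\<mu>, of n t z] \<mu>_zero[OF that] by simp
  \<comment> \<open>Thanks to the delay, the averaged feedback only has to be measurable in the output.\<close>
  have "\<forall>n. \<exists>y. y \<in> borel_measurable borel \<and>
      (\<forall>t. y t = f t + conv (\<lambda>\<tau>. ball_average (r n) (w \<tau>) (y (\<tau> - r n))) t)"
  proof
    fix n
    show "\<exists>y. y \<in> borel_measurable borel \<and>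
      (\<forall>t. y t = f t + conv (\<lambda>\<tau>. ball_average (r n) (w \<tau>) (y (\<tau> - r n))) t)"
      by (rule delay_equation[of "\<lambda>t. ball_average (r n) (w t)" f "r n"])
        (use ball_average_measurable[OF w] av_zero fm r0 in blast)+
  qed
  from choice[OF this] obtain Y where Ym: "\<And>n. Y n \<in> borel_measurable borel"
    and Y: "\<And>n t. Y n t = f t + conv (\<lambda>\<tau>. ball_average (r n) (w \<tau>) (Y n (\<tau> - r n))) t"
    by blast
  define V where "V n \<tau> = ball_average (r n) (w \<tau>) (Y n (\<tau> - r n))" for n \<tau>
  have V: "admissible (V n)" for n
    unfolding admissible_def
  proof (intro conjI allI)
    have "(\<lambda>\<tau>. Y n (\<tau> - r n)) \<in> borel_measurable borel" using Ym by measurable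
    then show "V n \<in> borel_measurable borel"
      unfolding V_def by (rule ball_average_measurable[OF w])
    show "norm (V n \<tau>) \<le> \<mu> \<tau>" for \<tau>
      unfolding V_def by (rule ball_average_norm_le[OF r0 wt w\<mu>])
  qed
  have YV: "Y n t = f t + conv (V n) t" for n t
    using Y[of n t] by (simp add: V_def[abs_def])
  obtain b where b: "\<And>t v. admissible v \<Longrightarrow> norm (conv v t) \<le> b t"
  proof -
    have "\<forall>t. \<exists>B. \<forall>v. admissible v \<longrightarrow> norm (conv v t) \<le> B" by (intro allI conv_bounded)
    from choice[OF this] obtain b where "\<And>t. \<forall>v. admissible v \<longrightarrow> norm (conv v t) \<le> b t" by blast
    then show thesis using that by blast
  qed
  have b0: "0 \<le> b t" for t
    using order.trans[OF norm_ge_zero b[OF admissible_zero]] .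
  \<comment> \<open>Dividing by \<open>1 + b t\<close> gives one bound for all times, as the subsequence lemma requires.\<close>
  obtain k where k: "strict_mono (k::nat\<Rightarrow>nat)"
    "\<And>t. t \<in> \<rat> \<Longrightarrow> \<exists>l. (\<lambda>n. conv (V (k n)) t /\<^sub>R (1 + b t)) \<longlonglongrightarrow> l"
  proof (rule function_convergent_subsequence[where S = "\<rat> :: real set" and M = 1
        and f = "\<lambda>n t. conv (V n) t /\<^sub>R (1 + b t)"])
    show "countable (\<rat> :: real set)" by (rule countable_rat)
    show "norm (conv (V n) t /\<^sub>R (1 + b t)) \<le> 1" for n t
      using b[OF V, of n t] b0[of t] by (simp add: divide_simps flip: divide_inverse)
  qed blast
  have conv_rat: "convergent (\<lambda>n. conv (V (k n)) t)" if t: "t \<in> \<rat>" for t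
  proof -
    obtain l where "(\<lambda>n. conv (V (k n)) t /\<^sub>R (1 + b t)) \<longlonglongrightarrow> l" using k(2)[OF t] by blast
    then have "(\<lambda>n. (1 + b t) *\<^sub>R (conv (V (k n)) t /\<^sub>R (1 + b t))) \<longlonglongrightarrow> (1 + b t) *\<^sub>R l"
      by (intro tendsto_scaleR tendsto_const)
    then show ?thesis using b0[of t] by (auto simp: convergent_def)
  qed
  have conv_all: "convergent (\<lambda>n. conv (V (k n)) t)" for t
  proof -
    have "Cauchy (\<lambda>n. conv (V (k n)) t)"
    proof (rule CauchyI)
      fix e :: real assume e: "0 < e"
      then have "e / 3 > 0" by simp
      from conv_equicontinuous[OF this, of t] obtain d where d: "d > 0"
        "\<And>s v. dist s t < d \<Longrightarrow> admissible v \<Longrightarrow> norm (conv v s - conv v t) < e / 3" by blast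
      \<comment> \<open>The outputs at \<open>s\<close> are close to those at \<open>t\<close> simultaneously for all inputs.\<close>
      obtain s where s: "s \<in> \<rat>" "t < s" "s < t + d" using Rats_dense_in_real[of t "t + d"] d by auto
      then have st: "dist s t < d" by (simp add: dist_real_def)
      have "Cauchy (\<lambda>n. conv (V (k n)) s)" using conv_rat[OF s(1)] by (rule convergent_Cauchy)
      from CauchyD[OF this \<open>e / 3 > 0\<close>] obtain N where N:
        "\<And>m n. m \<ge> N \<Longrightarrow> n \<ge> N \<Longrightarrow> norm (conv (V (k m)) s - conv (V (k n)) s) < e / 3" by blast
      have "norm (conv (V (k m)) t - conv (V (k n)) t) < e" if "m \<ge> N" "n \<ge> N" for m n
      proof -
        let ?A = "conv (V (k m)) s" and ?B = "conv (V (k n)) s"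
        let ?C = "conv (V (k m)) t" and ?D = "conv (V (k n)) t"
        have "norm (?A - ?C) < e / 3" "norm (?B - ?D) < e / 3" "norm (?A - ?B) < e / 3"
          using d(2)[OF st V] N[OF that] by auto
        moreover have "norm (?C - ?D) = norm ((?A - ?B) - (?A - ?C) + (?B - ?D))" by simp
        moreover note norm_triangle_ineq[of "(?A - ?B) - (?A - ?C)" "?B - ?D"]
          norm_triangle_ineq4[of "?A - ?B" "?A - ?C"]
        ultimately show ?thesis by linarith
      qed
      then show "\<exists>N. \<forall>m\<ge>N. \<forall>n\<ge>N. norm (conv (V (k m)) t - conv (V (k n)) t) < e" by blast
    qed
    then show ?thesis by (simp add: Cauchy_convergent_iff)
  qed
  define Q where "Q t = lim (\<lambda>n. conv (V (k n)) t)" for t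
  have Q: "(\<lambda>n. conv (V (k n)) t) \<longlonglongrightarrow> Q t" for t
    unfolding Q_def using conv_all by (simp add: convergent_LIMSEQ_iff)
  define y where "y t = f t + Q t" for t
  have rk: "(\<lambda>n. r (k n)) \<longlonglongrightarrow> 0" using LIMSEQ_subseq_LIMSEQ[OF r k(1)] by (simp add: o_def)
  have Ylim: "(\<lambda>n. Y (k n) (t - r (k n))) \<longlonglongrightarrow> y t" for t
  proof -
    have s: "(\<lambda>n. t - r (k n)) \<longlonglongrightarrow> t" using tendsto_diff[OF tendsto_const rk, of t] by simp
    have "isCont f t" using f by (simp add: continuous_on_eq_continuous_at)
    then have "(\<lambda>n. f (t - r (k n))) \<longlonglongrightarrow> f t" using s by (rule isCont_tendsto_compose)
    from tendsto_add[OF this tendsto_add[OF conv_equicontinuous_sequence[OF s, of "\<lambda>n. V (k n)", OF V] Q[of t]]]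
    show ?thesis by (simp add: YV y_def)
  qed
  obtain g where g: "\<And>n. g n \<in> midpoint_closure ((\<lambda>n \<tau>. exp (- \<tau>) *\<^sub>R V (k n) \<tau>) ` {n..})"
    "AE \<tau> in lborel. convergent (\<lambda>n. g n \<tau>)"
  proof (rule dominated_midpoints_converge[where v = "\<lambda>n \<tau>. exp (- \<tau>) *\<^sub>R V (k n) \<tau>" and M = lborel])
    show "(\<lambda>\<tau>. exp (- \<tau>) *\<^sub>R V (k n) \<tau>) \<in> borel_measurable lborel" for n
      using V[of "k n"] by (auto simp: admissible_def)
    show "integrable lborel (\<lambda>\<tau>. exp (- \<tau>) * \<mu> \<tau>)" by (rule \<mu>_integrable)
    show "norm (exp (- \<tau>) *\<^sub>R V (k n) \<tau>) \<le> exp (- \<tau>) * \<mu> \<tau>" for n \<tau>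
      using V[of "k n"] by (simp add: admissible_def)
  qed blast
  \<comment> \<open>The factor \<open>exp (- \<tau>)\<close> made the majorant integrable; removing it commutes with taking midpoints.\<close>
  define h where "h n \<tau> = exp \<tau> *\<^sub>R g n \<tau>" for n \<tau>
  have h_mem: "h n \<in> midpoint_closure ((\<lambda>n. V (k n)) ` {n..})" for n
  proof -
    have "(\<lambda>\<tau>. exp \<tau> *\<^sub>R q \<tau>) \<in> midpoint_closure ((\<lambda>n. V (k n)) ` {n..})"
      if "q \<in> midpoint_closure ((\<lambda>n \<tau>. exp (- \<tau>) *\<^sub>R V (k n) \<tau>) ` {n..})" for q
      using that
    proof induction
      case (base q)
      then obtain j where "j \<ge> n" "q = (\<lambda>\<tau>. exp (- \<tau>) *\<^sub>R V (k j) \<tau>)" by auto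
      then have "(\<lambda>\<tau>. exp \<tau> *\<^sub>R q \<tau>) = V (k j)" by (simp add: exp_minus)
      with \<open>j \<ge> n\<close> show ?case by (auto intro: midpoint_closure.base)
    next
      case (midpoint q p)
      have "(\<lambda>\<tau>. exp \<tau> *\<^sub>R ((1/2) *\<^sub>R (q \<tau> + p \<tau>))) = (\<lambda>\<tau>. (1/2) *\<^sub>R (exp \<tau> *\<^sub>R q \<tau> + exp \<tau> *\<^sub>R p \<tau>))"
        by (simp add: scaleR_add_right mult.commute)
      then show ?case using midpoint_closure.midpoint[OF midpoint.IH] by (simp only:)
    qed
    from this[OF g(1)] show ?thesis by (simp add: h_def[abs_def])
  qed
  have h_conv: "AE \<tau> in lborel. (\<lambda>n. h n \<tau>) \<longlonglongrightarrow> lim (\<lambda>n. h n \<tau>)"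
    using g(2)
  proof eventually_elim
    case (elim \<tau>)
    then obtain l where "(\<lambda>n. g n \<tau>) \<longlonglongrightarrow> l" by (auto simp: convergent_def)
    then have "(\<lambda>n. h n \<tau>) \<longlonglongrightarrow> exp \<tau> *\<^sub>R l" unfolding h_def by (intro tendsto_scaleR tendsto_const)
    then show ?case by (simp add: limI)
  qed
  have h_adm: "admissible (h n)" for n
    using conv_in_convex[OF h_mem, of n UNIV] V by auto
  \<comment> \<open>Where the combinations diverge, \<open>lim\<close> is an arbitrary value; the test restores the majorant everywhere.\<close>
  define v where "v \<tau> = (if norm (lim (\<lambda>n. h n \<tau>)) \<le> \<mu> \<tau> then lim (\<lambda>n. h n \<tau>) else 0)" for \<tau>
  have v: "admissible v"
    unfolding admissible_def
  proof (intro conjI allI)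
    have [measurable]: "(\<lambda>\<tau>. lim (\<lambda>n. h n \<tau>)) \<in> borel_measurable borel"
      using h_adm by (intro borel_measurable_lim_metric) (simp add: admissible_def)
    show "v \<in> borel_measurable borel" unfolding v_def by measurable
    show "norm (v \<tau>) \<le> \<mu> \<tau>" for \<tau> using \<mu>_nonneg by (simp add: v_def)
  qed
  have hv: "AE \<tau> in lborel. (\<lambda>n. h n \<tau>) \<longlonglongrightarrow> v \<tau>"
    using h_conv
  proof eventually_elim
    case (elim \<tau>)
    have "norm (lim (\<lambda>n. h n \<tau>)) \<le> \<mu> \<tau>"
      by (rule LIMSEQ_le_const2[OF tendsto_norm[OF elim]]) (use h_adm in \<open>auto simp: admissible_def\<close>)
    with elim show ?case by (simp add: v_def)
  qed
  have "conv v t = Q t" for t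
  proof (rule LIMSEQ_unique[OF conv_dominated_convergence[OF h_adm v hv]])
    show "(\<lambda>n. conv (h n) t) \<longlonglongrightarrow> Q t"
    proof (rule metric_LIMSEQ_I)
      fix e :: real assume e: "0 < e"
      have "\<forall>\<^sub>F n in sequentially. dist (conv (V (k n)) t) (Q t) < e"
        using Q e by (rule tendstoD)
      then obtain N where N: "\<And>n. n \<ge> N \<Longrightarrow> dist (conv (V (k n)) t) (Q t) < e"
        by (auto simp: eventually_sequentially)
      have "conv (h n) t \<in> ball (Q t) e" if "n \<ge> N" for n
      proof (rule conjunct2[OF conv_in_convex[OF h_mem _ convex_ball]])
        fix v assume "v \<in> (\<lambda>n. V (k n)) ` {n..}"
        then obtain j where j: "v = V (k j)" "n \<le> j" by auto
        show "admissible v" unfolding j by (rule V)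
        show "conv v t \<in> ball (Q t) e" using N[of j] j that by (simp add: dist_commute)
      qed
      then show "\<exists>N. \<forall>n\<ge>N. dist (conv (h n) t) (Q t) < e"
        by (auto simp: dist_commute)
    qed
  qed
  then have "y t = f t + conv v t" for t by (simp add: y_def)
  moreover have "AE t in lborel. v t \<in> filippov_regularization w t (y t)"
    using hv
  proof eventually_elim
    case (elim t)
    show ?case
    proof (rule filippov_limit[where w = w and \<tau> = t and r = "\<lambda>n. r (k n)" and h = h
          and Z = "\<lambda>n \<tau>. Y (k n) (\<tau> - r (k n))", OF wt w\<mu> r0 rk Ylim _ refl elim])
      show "h n \<in> midpoint_closure ((\<lambda>n \<tau>. ball_average (r (k n)) (w \<tau>) (Y (k n) (\<tau> - r (k n)))) ` {n..})" for n
        using h_mem[of n] by (simp add: V_def[abs_def])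
    qed
  qed
  ultimately show thesis using that v by blast
qed

end

section \<open>Regularity of mild solutions\<close>

locale controlled_semigroup = semigroup_generator \<Psi> D A
  for \<Psi> :: "real \<Rightarrow> 'b::banach \<Rightarrow>\<^sub>L 'b" and D A +
  fixes B :: "'m::euclidean_space \<Rightarrow>\<^sub>L 'b"
  assumes operator: "closed_densely_defined_operator D A" and range_B: "range B \<subseteq> D"
begin

lemma B_in_domain: "B w \<in> D"
  using range_B by blast

lemma A_add: "x \<in> D \<Longrightarrow> y \<in> D \<Longrightarrow> A (x + y) = A x + A y"
  using operator by (simp add: closed_densely_defined_operator_def)

lemma A_scaleR: "x \<in> D \<Longrightarrow> A (c *\<^sub>R x) = c *\<^sub>R A x"
  using operator by (simp add: closed_densely_defined_operator_def)

lemma subspace_D: "subspace D"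
  using operator by (simp add: closed_densely_defined_operator_def)

definition graph :: "('b \<times> 'b) set" where "graph = {(x, A x) | x. x \<in> D}"

lemma closed_graph: "closed graph"
  using operator by (simp add: closed_densely_defined_operator_def graph_def)

lemma subspace_graph: "subspace graph"
proof -
  have "A 0 = 0" using A_scaleR[of 0 0] subspace_D by (simp add: subspace_0)
  then show ?thesis
    unfolding subspace_def graph_def using subspace_D
    by (auto simp: zero_prod_def A_add A_scaleR subspace_0 subspace_add subspace_scale)
qed

text \<open>The composition is linear on a Euclidean space and therefore bounded, although \<open>A\<close> is not.\<close>

definition AB :: "'m \<Rightarrow>\<^sub>L 'b" where "AB = Blinfun (\<lambda>w. A (B w))"

lemma AB_apply: "AB w = A (B w)"
proof -
  have "linear (\<lambda>w. A (B w))"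
    by (rule linearI) (simp_all add: blinfun.add_right blinfun.scaleR_right A_add A_scaleR B_in_domain)
  then show ?thesis
    unfolding AB_def by (simp add: bounded_linear_Blinfun_apply linear_conv_bounded_linear)
qed

text \<open>The kernel with values \<open>(\<Psi>(t - \<tau>) B w, \<Psi>(t - \<tau>) A B w)\<close> takes values in the graph of \<open>A\<close>, a closed subspace of
the product space; so does the integral.\<close>

lemma mild_integral:
  fixes v :: "real \<Rightarrow> 'm"
  assumes t: "t\<^sub>0 \<le> t" and v: "set_integrable lebesgue {t\<^sub>0..t} v"
  obtains p where "p \<in> D"
    "has_strong_bochner_integral lebesgue (\<lambda>\<tau>. indicator {t\<^sub>0..t} \<tau> *\<^sub>R \<Psi> (t - \<tau>) (B (v \<tau>))) p"
    "has_strong_bochner_integral lebesgue (\<lambda>\<tau>. indicator {t\<^sub>0..t} \<tau> *\<^sub>R \<Psi> (t - \<tau>) (AB (v \<tau>))) (A p)"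
proof -
  note M = complete_measure_lebesgue[where 'a = real]
  define R where "R \<tau> = Blinfun (\<lambda>w. (\<Psi> (t - \<tau>) (B w), \<Psi> (t - \<tau>) (AB w)))" for \<tau>
  have R: "R \<tau> w = (\<Psi> (t - \<tau>) (B w), \<Psi> (t - \<tau>) (AB w))" for \<tau> w
    unfolding R_def
    by (subst bounded_linear_Blinfun_apply)
      (auto intro!: bounded_linear_Pair bounded_linear_compose[OF blinfun.bounded_linear_right] blinfun.bounded_linear_right)
  have cont: "continuous_on {t\<^sub>0..t} R"
  proof (rule continuous_on_blinfun_componentwise)
    fix i :: 'm assume "i \<in> Basis"
    show "continuous_on {t\<^sub>0..t} (\<lambda>\<tau>. R \<tau> i)"
      unfolding R
      by (intro continuous_on_Pair continuous_on_compose2[OF continuous_on_orbit] continuous_intros) auto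
  qed
  let ?v = "\<lambda>\<tau>. indicator {t\<^sub>0..t} \<tau> *\<^sub>R v \<tau>"
  obtain I where I: "I \<in> graph" "has_strong_bochner_integral lebesgue (\<lambda>\<tau>. R \<tau> (?v \<tau>)) I"
  proof (rule has_strong_bochner_integral_kernel[OF cont t _ _ subspace_graph closed_graph, of ?v])
    show "integrable lebesgue ?v" using v unfolding set_integrable_def .
    show "R \<tau> w \<in> graph" if "\<tau> \<in> {t\<^sub>0..t}" for \<tau> w
      using that unfolding R graph_def AB_apply by (auto simp: orbit_in_domain B_in_domain)
  qed auto
  then obtain p where p: "p \<in> D" "I = (p, A p)" by (auto simp: graph_def)
  have "has_strong_bochner_integral lebesgue (\<lambda>\<tau>. fst (R \<tau> (?v \<tau>))) (fst I)"
    "has_strong_bochner_integral lebesgue (\<lambda>\<tau>. snd (R \<tau> (?v \<tau>))) (snd I)"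
    by (intro has_strong_bochner_integral_bounded_linear[OF M _ I(2)] bounded_linear_fst bounded_linear_snd)+
  with p that show thesis by (simp add: R blinfun.scaleR_right)
qed

context
  fixes v :: "real \<Rightarrow> 'm" and t\<^sub>0 t\<^sub>1 :: real and J :: "real \<Rightarrow> 'b"
  assumes v: "set_integrable lebesgue {t\<^sub>0..t\<^sub>1} v"
    and J: "\<And>t. t \<in> {t\<^sub>0..t\<^sub>1} \<Longrightarrow> has_strong_bochner_integral lebesgue
      (\<lambda>\<tau>. indicator {t\<^sub>0..t} \<tau> *\<^sub>R \<Psi> (t - \<tau>) (B (v \<tau>))) (J t)"
begin

lemma v_subset: "t \<in> {t\<^sub>0..t\<^sub>1} \<Longrightarrow> set_integrable lebesgue {t\<^sub>0..t} v"
  by (rule set_integrable_subset[OF v]) auto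

lemma mild_in_domain:
  assumes t: "t \<in> {t\<^sub>0..t\<^sub>1}"
  shows "J t \<in> D"
    "has_strong_bochner_integral lebesgue (\<lambda>\<tau>. indicator {t\<^sub>0..t} \<tau> *\<^sub>R \<Psi> (t - \<tau>) (AB (v \<tau>))) (A (J t))"
proof -
  obtain p where p: "p \<in> D"
    "has_strong_bochner_integral lebesgue (\<lambda>\<tau>. indicator {t\<^sub>0..t} \<tau> *\<^sub>R \<Psi> (t - \<tau>) (B (v \<tau>))) p"
    "has_strong_bochner_integral lebesgue (\<lambda>\<tau>. indicator {t\<^sub>0..t} \<tau> *\<^sub>R \<Psi> (t - \<tau>) (AB (v \<tau>))) (A p)"
    using mild_integral[OF _ v_subset[OF t]] t by auto
  have "p = J t" by (rule has_strong_bochner_integral_unique[OF _ p(2) J[OF t]]) (rule complete_measure_lebesgue)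
  with p show "J t \<in> D"
    "has_strong_bochner_integral lebesgue (\<lambda>\<tau>. indicator {t\<^sub>0..t} \<tau> *\<^sub>R \<Psi> (t - \<tau>) (AB (v \<tau>))) (A (J t))"
    by auto
qed

definition V :: "real \<Rightarrow> 'm" where "V t = (LINT \<tau>:{..t}|lebesgue. indicator {t\<^sub>0..t\<^sub>1} \<tau> *\<^sub>R v \<tau>)"

lemma V_eq: "t \<in> {t\<^sub>0..t\<^sub>1} \<Longrightarrow> V t = (LINT \<tau>:{t\<^sub>0..t}|lebesgue. v \<tau>)"
  unfolding V_def set_lebesgue_integral_def
  by (intro Bochner_Integration.integral_cong refl) (auto simp: indicator_def)

text \<open>Subtracting \<open>B\<close> applied to the primitive of \<open>v\<close> removes the jump of the kernel at
\<open>\<tau> = t\<close>: the new integrand is Lipschitz in \<open>t\<close> and is written over the fixed interval \<open>{t\<^sub>0..t\<^sub>1}\<close>.\<close>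

lemma mild_minus_jump:
  assumes t: "t \<in> {t\<^sub>0..t\<^sub>1}"
  shows "has_strong_bochner_integral lebesgue
    (\<lambda>\<tau>. indicator {t\<^sub>0..t\<^sub>1} \<tau> *\<^sub>R (\<Psi> (max 0 (t - \<tau>)) (B (v \<tau>)) - B (v \<tau>))) (J t - B (V t))"
proof -
  note M = complete_measure_lebesgue[where 'a = real]
  have "has_bochner_integral lebesgue (\<lambda>\<tau>. indicator {t\<^sub>0..t} \<tau> *\<^sub>R v \<tau>) (V t)"
    unfolding V_eq[OF t] set_lebesgue_integral_def
    using v_subset[OF t] unfolding set_integrable_def by (rule has_bochner_integral_integrable)
  then have "has_strong_bochner_integral lebesgue (\<lambda>\<tau>. B (indicator {t\<^sub>0..t} \<tau> *\<^sub>R v \<tau>)) (B (V t))"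
    by (intro has_strong_bochner_integral_bounded_linear[OF M blinfun.bounded_linear_right])
      (simp add: has_strong_bochner_integral_iff_has_bochner_integral[OF M])
  from has_strong_bochner_integral_diff[OF M J[OF t] this]
  have "has_strong_bochner_integral lebesgue (\<lambda>\<tau>. indicator {t\<^sub>0..t} \<tau> *\<^sub>R \<Psi> (t - \<tau>) (B (v \<tau>))
      - B (indicator {t\<^sub>0..t} \<tau> *\<^sub>R v \<tau>)) (J t - B (V t))" .
  moreover have "indicator {t\<^sub>0..t} \<tau> *\<^sub>R \<Psi> (t - \<tau>) (B (v \<tau>)) - B (indicator {t\<^sub>0..t} \<tau> *\<^sub>R v \<tau>)
      = indicator {t\<^sub>0..t\<^sub>1} \<tau> *\<^sub>R (\<Psi> (max 0 (t - \<tau>)) (B (v \<tau>)) - B (v \<tau>))" for \<tau>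
    using t by (auto simp: indicator_def zero blinfun.zero_right max_def)
  ultimately show ?thesis by simp
qed

text \<open>Difference quotients of the integrand are bounded by a multiple of \<open>|v|\<close> and converge for \<open>\<tau> \<noteq> t\<close>, to
\<open>\<Psi>(t - \<tau>) A B v(\<tau>)\<close> before time \<open>t\<close> and to \<open>0\<close> after it. Dominated convergence
identifies the derivative with the integral that represents \<open>A (J t)\<close>.\<close>

lemma mild_minus_jump_derivative:
  assumes t: "t \<in> {t\<^sub>0..t\<^sub>1}"
  shows "((\<lambda>t. J t - B (V t)) has_vector_derivative A (J t)) (at t within {t\<^sub>0..t\<^sub>1})"
  unfolding has_vector_derivative_iff_quotient tendsto_at_iff_sequentially o_def
proof (intro allI impI)
  fix s :: "nat \<Rightarrow> real" assume s: "\<forall>n. s n \<in> {t\<^sub>0..t\<^sub>1} - {t}" and lim: "s \<longlonglongrightarrow> t"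
  note M = complete_measure_lebesgue[where 'a = real]
  obtain K where K: "\<And>r. r \<in> {0..t\<^sub>1 - t\<^sub>0} \<Longrightarrow> norm (\<Psi> r) \<le> K" "0 \<le> K"
    using locally_bounded by blast
  define h where "h t \<tau> = indicator {t\<^sub>0..t\<^sub>1} \<tau> *\<^sub>R (\<Psi> (max 0 (t - \<tau>)) (B (v \<tau>)) - B (v \<tau>))" for t \<tau>
  define g where "g \<tau> = indicator {t\<^sub>0..t} \<tau> *\<^sub>R \<Psi> (t - \<tau>) (AB (v \<tau>))" for \<tau>
  have hs: "h (s n) \<tau> - h t \<tau>
      = indicator {t\<^sub>0..t\<^sub>1} \<tau> *\<^sub>R (\<Psi> (max 0 (s n - \<tau>)) (B (v \<tau>)) - \<Psi> (max 0 (t - \<tau>)) (B (v \<tau>)))" for n \<tau>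
    by (simp add: h_def scaleR_diff_right)
  show "(\<lambda>n. (J (s n) - B (V (s n)) - (J t - B (V t))) /\<^sub>R (s n - t)) \<longlonglongrightarrow> A (J t)"
  proof (rule has_strong_bochner_integral_tendsto[OF M])
    show "has_strong_bochner_integral lebesgue (\<lambda>\<tau>. (h (s n) \<tau> - h t \<tau>) /\<^sub>R (s n - t))
        ((J (s n) - B (V (s n)) - (J t - B (V t))) /\<^sub>R (s n - t))" for n
      unfolding h_def using s t
      by (intro has_strong_bochner_integral_bounded_linear[OF M bounded_linear_scaleR_right]
          has_strong_bochner_integral_diff[OF M] mild_minus_jump) auto
    show "has_strong_bochner_integral lebesgue g (A (J t))"
      unfolding g_def by (rule mild_in_domain(2)[OF t])
    let ?m = "\<lambda>\<tau>. K * norm AB * norm (indicator {t\<^sub>0..t\<^sub>1} \<tau> *\<^sub>R v \<tau>)"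
    show "integrable lebesgue (\<lambda>\<tau>. ?m \<tau> + ?m \<tau>)"
      using v unfolding set_integrable_def
      by (intro Bochner_Integration.integrable_add integrable_mult_right integrable_norm)
    have h_le: "norm ((h (s n) \<tau> - h t \<tau>) /\<^sub>R (s n - t)) \<le> ?m \<tau>" for n \<tau>
    proof (cases "\<tau> \<in> {t\<^sub>0..t\<^sub>1}")
      case True
      have sn: "s n \<in> {t\<^sub>0..t\<^sub>1}" "s n \<noteq> t" using s by auto
      have "norm (\<Psi> (max 0 (s n - \<tau>)) (B (v \<tau>)) - \<Psi> (max 0 (t - \<tau>)) (B (v \<tau>)))
          \<le> K * norm (A (B (v \<tau>))) * \<bar>max 0 (s n - \<tau>) - max 0 (t - \<tau>)\<bar>"
        by (rule orbit_lipschitz[OF B_in_domain K(1)]) (use True sn t in auto)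
      also have "\<dots> \<le> (K * (norm AB * norm (v \<tau>))) * \<bar>s n - t\<bar>"
        using K(2) norm_blinfun[of AB "v \<tau>"]
        by (intro mult_mono mult_left_mono) (auto simp: AB_apply intro!: mult_nonneg_nonneg)
      finally show ?thesis
        using True sn by (simp add: hs divide_simps mult.commute mult.left_commute)
    qed (use K(2) in \<open>simp add: hs\<close>)
    have g_le: "norm (g \<tau>) \<le> ?m \<tau>" for \<tau>
    proof (cases "\<tau> \<in> {t\<^sub>0..t}")
      case True
      then have "norm (\<Psi> (t - \<tau>) (AB (v \<tau>))) \<le> norm (\<Psi> (t - \<tau>)) * norm (AB (v \<tau>))"
        by (intro norm_blinfun)
      also have "\<dots> \<le> K * (norm AB * norm (v \<tau>))"
        using True t K(2) by (intro mult_mono K norm_blinfun) auto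
      finally show ?thesis using True t by (simp add: g_def mult.assoc)
    qed (use K(2) in \<open>simp add: g_def\<close>)
    show "AE \<tau> in lebesgue. norm ((h (s n) \<tau> - h t \<tau>) /\<^sub>R (s n - t) - g \<tau>) \<le> ?m \<tau> + ?m \<tau>" for n
      by (rule AE_I2, rule order.trans[OF norm_triangle_ineq4], rule add_mono[OF h_le g_le])
    have "{t} \<in> null_sets lebesgue" by simp
    then have "AE \<tau> in lebesgue. \<tau> \<notin> {t}" by (rule AE_not_in)
    then show "AE \<tau> in lebesgue. (\<lambda>n. (h (s n) \<tau> - h t \<tau>) /\<^sub>R (s n - t)) \<longlonglongrightarrow> g \<tau>"
    proof eventually_elim
      case (elim \<tau>)
      consider "\<tau> \<notin> {t\<^sub>0..t\<^sub>1}" | "\<tau> \<in> {t\<^sub>0..t\<^sub>1}" "\<tau> < t" | "t < \<tau>" using elim by force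
      then show ?case
      proof cases
        case 1
        moreover have "\<tau> \<notin> {t\<^sub>0..t}" using 1 t by auto
        ultimately show ?thesis by (simp add: hs g_def)
      next
        case 2
        have "((\<lambda>r. (\<Psi> r (B (v \<tau>)) - \<Psi> (t - \<tau>) (B (v \<tau>))) /\<^sub>R (r - (t - \<tau>))) \<longlongrightarrow> \<Psi> (t - \<tau>) (A (B (v \<tau>))))
            (at (t - \<tau>) within {0..})"
          using orbit_has_vector_derivative[OF B_in_domain, of "t - \<tau>" "v \<tau>"] 2
          by (simp add: has_vector_derivative_iff_quotient)
        moreover have ev: "\<forall>\<^sub>F n in sequentially. \<tau> < s n" using order_tendstoD(1)[OF lim 2(2)] .
        have "filterlim (\<lambda>n. s n - \<tau>) (at (t - \<tau>) within {0..}) sequentially"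
          unfolding filterlim_at
        proof
          show "\<forall>\<^sub>F n in sequentially. s n - \<tau> \<in> {0..} \<and> s n - \<tau> \<noteq> t - \<tau>"
            using ev by eventually_elim (use s in auto)
          show "(\<lambda>n. s n - \<tau>) \<longlonglongrightarrow> t - \<tau>" by (intro tendsto_diff lim tendsto_const)
        qed
        ultimately have "(\<lambda>n. (\<Psi> (s n - \<tau>) (B (v \<tau>)) - \<Psi> (t - \<tau>) (B (v \<tau>))) /\<^sub>R (s n - \<tau> - (t - \<tau>)))
            \<longlonglongrightarrow> \<Psi> (t - \<tau>) (A (B (v \<tau>)))"
          by (rule filterlim_compose)
        moreover have "\<forall>\<^sub>F n in sequentially. (\<Psi> (s n - \<tau>) (B (v \<tau>)) - \<Psi> (t - \<tau>) (B (v \<tau>))) /\<^sub>R (s n - \<tau> - (t - \<tau>))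
            = (h (s n) \<tau> - h t \<tau>) /\<^sub>R (s n - t)"
          using ev by eventually_elim (use 2 in \<open>simp add: hs\<close>)
        ultimately have "(\<lambda>n. (h (s n) \<tau> - h t \<tau>) /\<^sub>R (s n - t)) \<longlonglongrightarrow> \<Psi> (t - \<tau>) (A (B (v \<tau>)))"
          by (rule Lim_transform_eventually)
        then show ?thesis using 2 by (simp add: g_def AB_apply)
      next
        case 3
        have "\<forall>\<^sub>F n in sequentially. s n < \<tau>" using order_tendstoD(2)[OF lim 3] .
        then have "\<forall>\<^sub>F n in sequentially. (h (s n) \<tau> - h t \<tau>) /\<^sub>R (s n - t) = g \<tau>"
          by eventually_elim (use 3 in \<open>simp add: hs g_def\<close>)
        then show ?thesis by (rule tendsto_eventually)
      qed
    qed
  qed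
qed

lemma mild_continuous: "continuous_on {t\<^sub>0..t\<^sub>1} J"
proof -
  have "continuous_on {t\<^sub>0..t\<^sub>1} (\<lambda>t. J t - B (V t))"
    unfolding continuous_on_eq_continuous_within
    using mild_minus_jump_derivative by (blast intro: has_vector_derivative_continuous)
  moreover have "continuous_on {t\<^sub>0..t\<^sub>1} V"
  proof -
    have "v integrable_on {t\<^sub>0..t\<^sub>1}" by (rule set_lebesgue_integral_eq_integral(1)[OF v])
    then have "continuous_on {t\<^sub>0..t\<^sub>1} (\<lambda>t. integral {t\<^sub>0..t} v)" by (rule indefinite_integral_continuous_1)
    then show ?thesis
      by (rule continuous_on_eq)
        (simp add: V_eq set_lebesgue_integral_eq_integral(2)[OF v_subset])
  qed
  ultimately have "continuous_on {t\<^sub>0..t\<^sub>1} (\<lambda>t. (J t - B (V t)) + B (V t))"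
    by (intro continuous_on_add blinfun.continuous_on continuous_on_const)
  then show ?thesis by simp
qed

lemma mild_derivative:
  "AE t in lebesgue. t\<^sub>0 < t \<and> t < t\<^sub>1 \<longrightarrow> (J has_vector_derivative A (J t) + B (v t)) (at t)"
proof -
  have "AE t in lebesgue. (V has_vector_derivative indicator {t\<^sub>0..t\<^sub>1} t *\<^sub>R v t) (at t)"
    using has_vector_derivative_integral_AE[OF v[unfolded set_integrable_def]] by (simp add: V_def[abs_def])
  then show ?thesis
  proof eventually_elim
    case (elim t)
    show ?case
    proof
      assume t: "t\<^sub>0 < t \<and> t < t\<^sub>1"
      have "((\<lambda>t. J t - B (V t)) has_vector_derivative A (J t)) (at t)"
        using mild_minus_jump_derivative[of t] t at_within_Icc_at[of t\<^sub>0 t t\<^sub>1] by simp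
      moreover have "((\<lambda>t. B (V t)) has_vector_derivative B (v t)) (at t)"
        using bounded_linear.has_vector_derivative[OF blinfun.bounded_linear_right elim, of B] t by simp
      ultimately have "((\<lambda>t. (J t - B (V t)) + B (V t)) has_vector_derivative A (J t) + B (v t)) (at t)"
        by (rule has_vector_derivative_add)
      then show "(J has_vector_derivative A (J t) + B (v t)) (at t)" by simp
    qed
  qed
qed

end

end

section \<open>From the measurable feedback to a Volterra inclusion\<close>

lemma completion_ex_borel_measurable_euclidean:
  fixes g :: "'a \<Rightarrow> 'm::euclidean_space"
  assumes g: "g \<in> borel_measurable (completion M)"
  shows "\<exists>g'\<in>borel_measurable M. AE x in M. g x = g' x"
proof -
  have "\<forall>i. \<exists>h. h \<in> borel_measurable M \<and> (AE x in M. g x \<bullet> i = h x)"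
  proof
    fix i :: 'm
    have "(\<lambda>x. g x \<bullet> i) \<in> borel_measurable (completion M)" using g by simp
    from completion_ex_borel_measurable_real[OF this]
    show "\<exists>h. h \<in> borel_measurable M \<and> (AE x in M. g x \<bullet> i = h x)" unfolding Bex_def .
  qed
  from choice[OF this] obtain h where h: "\<And>i. h i \<in> borel_measurable M"
    "\<And>i. AE x in M. g x \<bullet> i = h i x" by blast
  have "AE x in M. \<forall>i\<in>Basis. g x \<bullet> i = h i x"
    using h(2) by (subst AE_ball_countable) (simp_all add: countable_finite)
  then have "AE x in M. g x = (\<Sum>i\<in>Basis. h i x *\<^sub>R i)"
  proof eventually_elim
    case (elim x)
    then have "(\<Sum>i\<in>Basis. (g x \<bullet> i) *\<^sub>R i) = (\<Sum>i\<in>Basis. h i x *\<^sub>R i)"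
      by (intro sum.cong) auto
    then show ?case by (simp only: euclidean_representation)
  qed
  moreover have "(\<lambda>x. \<Sum>i\<in>Basis. h i x *\<^sub>R i) \<in> borel_measurable M"
    using h(1) by (intro borel_measurable_sum borel_measurable_scaleR borel_measurable_const)
  ultimately show ?thesis by (rule bexI)
qed

lemma AE_lebesgue_pair:
  fixes P :: "real \<Rightarrow> 'k::euclidean_space \<Rightarrow> bool"
  assumes "AE p in lebesgue. P (fst p) (snd p)"
  shows "AE t in lebesgue. AE y in lebesgue. P t y"
proof -
  have "AE p in lborel \<Otimes>\<^sub>M lborel. P (fst p) (snd p)"
    using assms unfolding lborel_prod AE_completion_iff .
  from lborel_pair.AE_pair[OF this] show ?thesis by (simp add: AE_completion_iff)
qed

text \<open>A Lebesgue measurable function of two variables need not have measurable sections; its Borel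
version has, and by Fubini's theorem almost all sections of the two agree almost everywhere. Regularizations ignore
the difference.\<close>

lemma borel_version:
  fixes u :: "real \<Rightarrow> 'k::euclidean_space \<Rightarrow> 'm::euclidean_space"
  assumes "(\<lambda>(t, y). u t y) \<in> borel_measurable (lebesgue_on ({t\<^sub>0..} \<times> UNIV))"
  obtains u' where "(\<lambda>(t, y). u' t y) \<in> borel_measurable (borel \<Otimes>\<^sub>M borel)"
    "AE t in lebesgue. t\<^sub>0 \<le> t \<longrightarrow> (AE y in lebesgue. u t y = u' t y)"
proof -
  let ?S = "{t\<^sub>0..} \<times> (UNIV :: 'k set)"
  have "closed ?S" by (intro closed_Times) auto
  then have "?S \<in> sets lebesgue" by (intro sets_completionI_sets) auto
  then have "(\<lambda>p. indicator ?S p *\<^sub>R (case p of (t, y) \<Rightarrow> u t y)) \<in> borel_measurable lebesgue"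
    using assms by (subst borel_measurable_restrict_space_iff[symmetric]) auto
  then obtain h where h: "h \<in> borel_measurable (lborel :: (real \<times> 'k) measure)"
    and eq: "AE p in lborel. indicator ?S p *\<^sub>R (case p of (t, y) \<Rightarrow> u t y) = h p"
    using completion_ex_borel_measurable_euclidean by blast
  have "AE t in lebesgue. AE y in lebesgue. indicator {t\<^sub>0..} t *\<^sub>R u t y = h (t, y)"
  proof (rule AE_lebesgue_pair)
    show "AE p in lebesgue. indicator {t\<^sub>0..} (fst p) *\<^sub>R u (fst p) (snd p) = h (fst p, snd p)"
      unfolding AE_completion_iff using eq
    proof eventually_elim
      case (elim p)
      then show ?case by (cases p) (simp add: indicator_def)
    qed
  qed
  then have "AE t in lebesgue. t\<^sub>0 \<le> t \<longrightarrow> (AE y in lebesgue. u t y = h (t, y))"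
    by eventually_elim auto
  moreover have "(\<lambda>(t, y). h (t, y)) \<in> borel_measurable (borel \<Otimes>\<^sub>M borel)"
    using h by (simp add: borel_prod)
  ultimately show thesis by (intro that[of "\<lambda>t y. h (t, y)"])
qed

text \<open>Regularization is local and insensitive to null sets: the exceptional set can be added to \<open>M\<close>.\<close>

lemma filippov_regularization_mono:
  fixes u w :: "real \<Rightarrow> 'k::euclidean_space \<Rightarrow> 'm::euclidean_space"
  assumes O: "open O'" "y \<in> O'" and eq: "AE z in lebesgue. z \<in> O' \<longrightarrow> w t z = u t z"
  shows "filippov_regularization w t y \<subseteq> filippov_regularization u t y"
proof
  fix l assume l: "l \<in> filippov_regularization w t y"
  show "l \<in> filippov_regularization u t y"
    unfolding filippov_regularization_def
  proof (intro INT_I)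
    fix \<delta> :: real and M :: "'k set" assume "\<delta> \<in> {0<..}" and M: "M \<in> null_sets lebesgue"
    obtain \<epsilon> where \<epsilon>: "\<epsilon> > 0" "ball y \<epsilon> \<subseteq> O'" using O by (meson openE)
    obtain N where N: "N \<in> null_sets lebesgue" "\<And>z. z \<notin> N \<Longrightarrow> z \<in> O' \<Longrightarrow> w t z = u t z"
    proof (rule AE_E3[OF eq])
      fix N :: "'k set" assume "\<And>z. z \<in> space lebesgue - N \<Longrightarrow> z \<in> O' \<longrightarrow> w t z = u t z"
        and "N \<in> null_sets lebesgue"
      then show thesis using that[of N] by simp
    qed
    let ?\<eta> = "min \<delta> \<epsilon>"
    have "?\<eta> \<in> {0<..}" "M \<union> N \<in> null_sets lebesgue" using \<epsilon> M N \<open>\<delta> \<in> _\<close> by auto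
    then have "l \<in> closure (convex hull (w t ` ((+) y ` ball 0 ?\<eta> - (M \<union> N))))"
      using l unfolding filippov_regularization_def by blast
    moreover have "w t ` ((+) y ` ball 0 ?\<eta> - (M \<union> N)) \<subseteq> u t ` ((+) y ` ball 0 \<delta> - M)"
    proof
      fix x assume "x \<in> w t ` ((+) y ` ball 0 ?\<eta> - (M \<union> N))"
      then have "x \<in> w t ` (ball y ?\<eta> - (M \<union> N))" by simp
      then obtain z where z: "x = w t z" "z \<in> ball y ?\<eta>" "z \<notin> M" "z \<notin> N" by blast
      then have "z \<in> O'" using \<epsilon>(2) by auto
      then have "x = u t z" using N(2) z by simp
      then show "x \<in> u t ` ((+) y ` ball 0 \<delta> - M)" using z by auto
    qed
    ultimately show "l \<in> closure (convex hull (u t ` ((+) y ` ball 0 \<delta> - M)))"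
      using closure_mono[OF hull_mono] by blast
  qed
qed

text \<open>A coordinate projection is linear and continuous, so it maps the closed convex hull of a set into that of the
projected set.\<close>

lemma utkin_first_kind_subset_second_kind:
  fixes u :: "real \<Rightarrow> real^'k \<Rightarrow> real^'m"
  shows "utkin_first_kind u t y \<subseteq> utkin_second_kind u t y"
proof (intro subsetI, unfold utkin_second_kind_def, intro CollectI allI)
  fix v i assume v: "v \<in> utkin_first_kind u t y"
  show "v $ i \<in> filippov_regularization (\<lambda>t y. u t y $ i) t y"
    unfolding filippov_regularization_def
  proof (intro INT_I)
    fix \<delta> :: real and M :: "(real^'k) set" assume d: "\<delta> \<in> {0<..}" and M: "M \<in> null_sets lebesgue"
    let ?S = "(+) y ` ball 0 \<delta> - M"
    let ?H = "closure (convex hull ((\<lambda>y. u t y $ i) ` ?S))"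
    have "v \<in> closure (convex hull (u t ` ?S))"
      using v d M unfolding utkin_first_kind_def filippov_regularization_def by blast
    moreover have "closure (convex hull (u t ` ?S)) \<subseteq> (\<lambda>v. v $ i) -` ?H"
    proof (intro closure_minimal hull_minimal)
      show "u t ` ?S \<subseteq> (\<lambda>v. v $ i) -` ?H"
        by (auto intro!: subsetD[OF closure_subset] hull_inc)
      show "convex ((\<lambda>v. v $ i) -` ?H)"
        by (intro convex_linear_vimage convex_closure convex_convex_hull)
          (simp add: bounded_linear.linear bounded_linear_vec_nth)
      show "closed ((\<lambda>v. v $ i) -` ?H)"
        by (intro closed_vimage closed_closure continuous_intros)
    qed
    ultimately show "v $ i \<in> ?H" by blast
  qed
qed

lemma integrable_exp_atLeast: "integrable lborel (\<lambda>t. exp (- t) * (c * indicator {a..} t) :: real)"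
proof -
  have "(\<integral>\<^sup>+t. ennreal (exp (- t)) * indicator {a..} t \<partial>lborel) = ennreal (0 - (- exp (- a)))"
  proof (rule nn_integral_FTC_atLeast[where F = "\<lambda>t. - exp (- t)"])
    show "((\<lambda>t::real. - exp (- t)) \<longlongrightarrow> 0) at_top"
      using tendsto_minus[OF filterlim_compose[OF exp_at_bot filterlim_uminus_at_bot_at_top]] by simp
  qed (auto intro!: derivative_eq_intros)
  moreover have "(\<integral>\<^sup>+t. ennreal (norm (exp (- t) * indicator {a..} t)) \<partial>lborel)
      = (\<integral>\<^sup>+t. ennreal (exp (- t)) * indicator {a..} t \<partial>lborel)"
    by (rule nn_integral_cong) (simp add: indicator_def)
  ultimately have "integrable lborel (\<lambda>t. exp (- t) * indicator {a..} t :: real)"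
    by (intro integrableI_bounded) auto
  from integrable_mult_right[OF this, of c] show ?thesis by (simp add: mult.left_commute)
qed

context controlled_semigroup
begin

text \<open>A mild solution for the input \<open>v\<close> on the half line, with the regularity that an initial value in the domain entails. The
integral is taken over the whole line with an indicator, so that integrals for different times are
comparable.\<close>

definition mild_trajectory :: "real \<Rightarrow> 'b \<Rightarrow> (real \<Rightarrow> 'm) \<Rightarrow> (real \<Rightarrow> 'b) \<Rightarrow> bool" where
  "mild_trajectory t\<^sub>0 x\<^sub>0 v x \<longleftrightarrow>
    x t\<^sub>0 = x\<^sub>0 \<and> continuous_on {t\<^sub>0..} x \<and> (\<forall>t\<ge>t\<^sub>0. x t \<in> D) \<and>
    (AE t in lebesgue. t\<^sub>0 < t \<longrightarrow> (x has_vector_derivative A (x t) + B (v t)) (at t)) \<and>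
    (\<forall>t\<ge>t\<^sub>0. has_strong_bochner_integral lebesgue
      (\<lambda>\<tau>. indicator {t\<^sub>0..t} \<tau> *\<^sub>R \<Psi> (t - \<tau>) (B (v \<tau>))) (x t - \<Psi> (t - t\<^sub>0) x\<^sub>0))"

lemma mild_trajectory_exists:
  fixes v :: "real \<Rightarrow> 'm"
  assumes x\<^sub>0: "x\<^sub>0 \<in> D" and v: "\<And>t. set_integrable lebesgue {t\<^sub>0..t} v"
  obtains x where "mild_trajectory t\<^sub>0 x\<^sub>0 v x"
proof -
  note M = complete_measure_lebesgue[where 'a = real]
  have "\<forall>t. \<exists>p. t\<^sub>0 \<le> t \<longrightarrow> has_strong_bochner_integral lebesgue
      (\<lambda>\<tau>. indicator {t\<^sub>0..t} \<tau> *\<^sub>R \<Psi> (t - \<tau>) (B (v \<tau>))) p"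
  proof
    fix t
    show "\<exists>p. t\<^sub>0 \<le> t \<longrightarrow> has_strong_bochner_integral lebesgue
      (\<lambda>\<tau>. indicator {t\<^sub>0..t} \<tau> *\<^sub>R \<Psi> (t - \<tau>) (B (v \<tau>))) p"
    proof (cases "t\<^sub>0 \<le> t")
      case True
      from mild_integral[OF this v] show ?thesis by blast
    qed blast
  qed
  from choice[OF this] obtain J where J: "\<And>t. t\<^sub>0 \<le> t \<Longrightarrow> has_strong_bochner_integral lebesgue
      (\<lambda>\<tau>. indicator {t\<^sub>0..t} \<tau> *\<^sub>R \<Psi> (t - \<tau>) (B (v \<tau>))) (J t)" by blast
  define x where "x t = \<Psi> (t - t\<^sub>0) x\<^sub>0 + J t" for t
  have J': "has_strong_bochner_integral lebesgue (\<lambda>\<tau>. indicator {t\<^sub>0..s} \<tau> *\<^sub>R \<Psi> (s - \<tau>) (B (v \<tau>))) (J s)"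
    if "s \<in> {t\<^sub>0..t}" for s t using J[of s] that by simp
  have JD: "J t \<in> D" if "t\<^sub>0 \<le> t" for t
    by (rule mild_in_domain(1)[OF v J', where t\<^sub>1 = t]) (use that in auto)
  have cont: "continuous_on {t\<^sub>0..t} J" for t by (rule mild_continuous[OF v J'])
  have "continuous_on {t\<^sub>0..} J"
    unfolding continuous_on_eq_continuous_within
  proof
    fix t assume t: "t \<in> {t\<^sub>0..}"
    have "continuous (at t within {t\<^sub>0..t + 1}) J"
      using cont[of "t + 1"] t by (auto simp: continuous_on_eq_continuous_within)
    moreover have "at t within {t\<^sub>0..} = at t within {t\<^sub>0..t + 1}"
      by (rule at_within_nhd[of t "{..<t + 1}"]) auto
    ultimately show "continuous (at t within {t\<^sub>0..}) J" by simp
  qed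
  moreover have "continuous_on {t\<^sub>0..} (\<lambda>t. \<Psi> (t - t\<^sub>0) x\<^sub>0)"
    by (intro continuous_on_compose2[OF continuous_on_orbit] continuous_intros) auto
  ultimately have x_cont: "continuous_on {t\<^sub>0..} x"
    unfolding x_def[abs_def] by (intro continuous_on_add)
  have xD: "x t \<in> D" "A (x t) = \<Psi> (t - t\<^sub>0) (A x\<^sub>0) + A (J t)" if "t\<^sub>0 \<le> t" for t
    using orbit_in_domain[OF x\<^sub>0, of "t - t\<^sub>0"] JD[OF that] that subspace_D
    by (auto simp: x_def A_add subspace_add)
  have "AE t in lebesgue. \<forall>n::nat. t\<^sub>0 < t \<and> t < t\<^sub>0 + real n \<longrightarrow> (J has_vector_derivative A (J t) + B (v t)) (at t)"
    unfolding AE_all_countable by (intro allI mild_derivative[OF v J'])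
  then have deriv: "AE t in lebesgue. t\<^sub>0 < t \<longrightarrow> (x has_vector_derivative A (x t) + B (v t)) (at t)"
  proof eventually_elim
    case (elim t)
    show ?case
    proof
      assume t: "t\<^sub>0 < t"
      obtain n where "t - t\<^sub>0 < real n" using reals_Archimedean2 by blast
      then have "t < t\<^sub>0 + real n" by linarith
      with elim t have J'': "(J has_vector_derivative A (J t) + B (v t)) (at t)" by blast
      have "t - t\<^sub>0 \<in> interior {0..}" "0 \<le> t - t\<^sub>0" using t by auto
      then have d: "((\<lambda>s. \<Psi> s x\<^sub>0) has_vector_derivative \<Psi> (t - t\<^sub>0) (A x\<^sub>0)) (at (t - t\<^sub>0))"
        using orbit_has_vector_derivative[OF x\<^sub>0, of "t - t\<^sub>0"] by (simp only: at_within_interior)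
      have "((\<lambda>t. t - t\<^sub>0) has_vector_derivative 1) (at t)"
        using has_vector_derivative_diff[OF has_vector_derivative_id has_vector_derivative_const, of t\<^sub>0 "at t"]
        by simp
      from vector_diff_chain_at[OF this d]
      have "((\<lambda>t. \<Psi> (t - t\<^sub>0) x\<^sub>0) has_vector_derivative \<Psi> (t - t\<^sub>0) (A x\<^sub>0)) (at t)"
        by (simp only: o_def scaleR_one)
      from has_vector_derivative_add[OF this J'']
      have "((\<lambda>t. \<Psi> (t - t\<^sub>0) x\<^sub>0 + J t) has_vector_derivative \<Psi> (t - t\<^sub>0) (A x\<^sub>0) + (A (J t) + B (v t))) (at t)" .
      moreover have "\<Psi> (t - t\<^sub>0) (A x\<^sub>0) + (A (J t) + B (v t)) = A (x t) + B (v t)"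
        using xD(2)[of t] t by simp
      moreover have "(\<lambda>t. \<Psi> (t - t\<^sub>0) x\<^sub>0 + J t) = x" by (rule ext) (simp add: x_def)
      ultimately show "(x has_vector_derivative A (x t) + B (v t)) (at t)" by (simp only:)
    qed
  qed
  have "J t\<^sub>0 = 0"
  proof -
    have J0: "has_strong_bochner_integral lebesgue (\<lambda>\<tau>. indicator {t\<^sub>0..t\<^sub>0} \<tau> *\<^sub>R \<Psi> (t\<^sub>0 - \<tau>) (B (v \<tau>))) (J t\<^sub>0)"
      by (rule J) simp
    have "has_strong_bochner_integral (lebesgue :: real measure) (\<lambda>\<tau>. 0) (0 :: 'b)"
      using has_strong_bochner_integral_diff[OF M J0 J0] by simp
    from has_strong_bochner_integral_dist_le[OF M J0 this]
    have "ennreal (norm (J t\<^sub>0)) \<le> (\<integral>\<^sup>+\<tau>. norm (indicator {t\<^sub>0} \<tau> *\<^sub>R \<Psi> (t\<^sub>0 - \<tau>) (B (v \<tau>))) \<partial>lebesgue)" by simp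
    also have "\<dots> = (\<integral>\<^sup>+\<tau>. 0 \<partial>(lebesgue :: real measure))"
    proof (rule nn_integral_cong_AE)
      have "{t\<^sub>0} \<in> null_sets lebesgue" by simp
      then have "AE \<tau> in lebesgue. \<tau> \<notin> {t\<^sub>0}" by (rule AE_not_in)
      then show "AE \<tau> in lebesgue. ennreal (norm (indicator {t\<^sub>0} \<tau> *\<^sub>R \<Psi> (t\<^sub>0 - \<tau>) (B (v \<tau>)))) = 0"
        by eventually_elim simp
    qed
    finally show ?thesis by simp
  qed
  then have "x t\<^sub>0 = x\<^sub>0" by (simp add: x_def zero)
  moreover have "x t - \<Psi> (t - t\<^sub>0) x\<^sub>0 = J t" for t by (simp add: x_def)
  ultimately have "mild_trajectory t\<^sub>0 x\<^sub>0 v x"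
    unfolding mild_trajectory_def using x_cont xD(1) deriv J by simp
  then show thesis by (rule that)
qed

lemma output_integral:
  fixes C :: "'b \<Rightarrow>\<^sub>L 'k::euclidean_space"
  assumes "has_strong_bochner_integral lebesgue (\<lambda>\<tau>. indicator {t\<^sub>0..t} \<tau> *\<^sub>R \<Psi> (t - \<tau>) (B (v \<tau>))) J"
  shows "has_bochner_integral lebesgue (\<lambda>\<tau>. indicator {t\<^sub>0..t} \<tau> *\<^sub>R C (\<Psi> (t - \<tau>) (B (v \<tau>)))) (C J)"
proof -
  note M = complete_measure_lebesgue[where 'a = real]
  have "has_bochner_integral lebesgue (\<lambda>\<tau>. C (indicator {t\<^sub>0..t} \<tau> *\<^sub>R \<Psi> (t - \<tau>) (B (v \<tau>)))) (C J)"
    by (rule iffD1[OF has_strong_bochner_integral_iff_has_bochner_integral[OF M]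
          has_strong_bochner_integral_bounded_linear[OF M blinfun.bounded_linear_right assms]])
  then show ?thesis by (simp add: blinfun.scaleR_right)
qed

end

lemma Linfty_borel_version:
  fixes \<gamma> :: "real \<Rightarrow> 'm::euclidean_space"
  assumes "Linfty lebesgue \<gamma>"
  obtains \<gamma>' c where "\<gamma>' \<in> borel_measurable borel" "\<And>t. norm (\<gamma>' t) \<le> c" "AE t in lebesgue. \<gamma> t = \<gamma>' t"
proof -
  have \<gamma>: "\<gamma> \<in> borel_measurable lebesgue" "esssup lebesgue (\<lambda>t. ereal (norm (\<gamma> t))) < \<infinity>"
    using assms by (auto simp: Linfty_def)
  obtain g where g: "g \<in> borel_measurable lborel" "AE t in lborel. \<gamma> t = g t"
    using completion_ex_borel_measurable_euclidean[OF \<gamma>(1)] by blast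
  obtain c where c: "esssup lebesgue (\<lambda>t. ereal (norm (\<gamma> t))) \<le> ereal c" "0 \<le> c"
  proof (cases "esssup lebesgue (\<lambda>t. ereal (norm (\<gamma> t)))")
    case (real r)
    then show thesis by (intro that[of "max r 0"]) auto
  next
    case MInf
    then show thesis by (intro that[of 0]) auto
  qed (use \<gamma>(2) in simp)
  have bound: "AE t in lebesgue. norm (\<gamma> t) \<le> c"
    using esssup_AE[of "\<lambda>t. ereal (norm (\<gamma> t))" lebesgue]
  proof eventually_elim
    case (elim t)
    then have "ereal (norm (\<gamma> t)) \<le> ereal c" using c(1) by (rule order.trans)
    then show ?case by simp
  qed
  define \<gamma>' where "\<gamma>' t = (if norm (g t) \<le> c then g t else 0)" for t
  have gb: "g \<in> borel_measurable borel" using g(1) by simp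
  have "\<gamma>' \<in> borel_measurable borel" unfolding \<gamma>'_def using gb by measurable
  moreover have "norm (\<gamma>' t) \<le> c" for t using c(2) by (simp add: \<gamma>'_def)
  moreover have "AE t in lebesgue. \<gamma> t = g t" using g(2) by (rule AE_completion)
  with bound have "AE t in lebesgue. \<gamma> t = \<gamma>' t" by eventually_elim (simp add: \<gamma>'_def)
  ultimately show thesis by (rule that)
qed

lemma set_integrable_lebesgueI:
  fixes v :: "real \<Rightarrow> 'm::euclidean_space"
  assumes "v \<in> borel_measurable borel" "\<And>t. norm (v t) \<le> \<mu> t"
    and \<mu>: "integrable lborel (\<lambda>t. indicator {..b} t * \<mu> t)"
  shows "set_integrable lebesgue {a..b} v"
proof -
  have "integrable lborel (\<lambda>t. indicator {a..b} t *\<^sub>R v t)"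
  proof (rule Bochner_Integration.integrable_bound[OF \<mu>])
    show "(\<lambda>t. indicator {a..b} t *\<^sub>R v t) \<in> borel_measurable lborel"
      using assms(1) by (intro borel_measurable_scaleR borel_measurable_indicator) auto
    show "AE t in lborel. norm (indicator {a..b} t *\<^sub>R v t) \<le> norm (indicator {..b} t * \<mu> t)"
      using assms(2) by (intro AE_I2) (auto simp: indicator_def intro: order.trans[OF _ abs_ge_self])
  qed
  then show ?thesis
    unfolding set_integrable_def
    by (subst integrable_completion) (auto dest: borel_measurable_integrable)
qed

context controlled_semigroup
begin

text \<open>The Volterra inclusion with kernel \<open>C \<Psi>(s) B\<close> determines the input; the disturbance \<open>\<gamma>\<close> is a given input and
contributes a continuous term to the data of the inclusion. Applying \<open>C\<close> to the trajectory reproduces the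
right-hand side of the equation, so the output of the trajectory is the solution of the inclusion.\<close>

lemma relaxed_solution:
  fixes C :: "'b \<Rightarrow>\<^sub>L 'k::euclidean_space" and w :: "real \<Rightarrow> 'k \<Rightarrow> 'm" and \<mu> :: "real \<Rightarrow> real"
  assumes x\<^sub>0: "x\<^sub>0 \<in> D" and \<gamma>: "Linfty lebesgue \<gamma>"
    and \<mu>: "\<mu> \<in> borel_measurable borel" "\<And>t. 0 \<le> \<mu> t" "\<And>t. t < t\<^sub>0 \<Longrightarrow> \<mu> t = 0"
      "integrable lborel (\<lambda>t. exp (- t) * \<mu> t)"
    and w: "(\<lambda>(t, y). w t y) \<in> borel_measurable (borel \<Otimes>\<^sub>M borel)" "\<And>t y. norm (w t y) \<le> \<mu> t"
  obtains x v where "mild_trajectory t\<^sub>0 x\<^sub>0 (\<lambda>t. v t + \<gamma> t) x"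
    "\<And>b. set_integrable lebesgue {t\<^sub>0..b} v"
    "AE t in lebesgue. t\<^sub>0 \<le> t \<longrightarrow> v t \<in> filippov_regularization w t (C (x t))"
proof -
  define G where "G s = C o\<^sub>L (\<Psi> s o\<^sub>L B)" for s
  have G_apply: "G s b = C (\<Psi> s (B b))" for s b by (simp add: G_def)
  have G: "continuous_on {0..} G"
  proof (rule continuous_on_blinfun_componentwise)
    show "continuous_on {0..} (\<lambda>s. G s i)" for i
      unfolding G_apply by (intro blinfun.continuous_on continuous_on_const continuous_on_orbit)
  qed
  interpret V: volterra G t\<^sub>0 \<mu>
    by unfold_locales (use G \<mu> in auto)
  obtain \<gamma>' c where \<gamma>': "\<gamma>' \<in> borel_measurable borel" "\<And>t. norm (\<gamma>' t) \<le> c" "AE t in lebesgue. \<gamma> t = \<gamma>' t"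
    using Linfty_borel_version[OF \<gamma>] by blast
  have c0: "0 \<le> c" using order.trans[OF norm_ge_zero \<gamma>'(2)] .
  interpret W: volterra G t\<^sub>0 "\<lambda>t. c * indicator {t\<^sub>0..} t"
    by unfold_locales (use G c0 integrable_exp_atLeast in auto)
  define \<gamma>\<^sub>0 where "\<gamma>\<^sub>0 t = indicator {t\<^sub>0..} t *\<^sub>R \<gamma>' t" for t
  have \<gamma>\<^sub>0: "W.admissible \<gamma>\<^sub>0"
    unfolding W.admissible_def
  proof (intro conjI allI)
    show "\<gamma>\<^sub>0 \<in> borel_measurable borel"
      unfolding \<gamma>\<^sub>0_def using \<gamma>'(1) by (intro borel_measurable_scaleR borel_measurable_indicator) auto
    show "norm (\<gamma>\<^sub>0 t) \<le> c * indicator {t\<^sub>0..} t" for t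
      using \<gamma>'(2)[of t] by (simp add: \<gamma>\<^sub>0_def indicator_def)
  qed
  have "continuous_on UNIV (\<lambda>t. C (\<Psi> (max 0 (t - t\<^sub>0)) x\<^sub>0) + W.conv \<gamma>\<^sub>0 t)"
    by (intro continuous_on_add W.conv_continuous[OF \<gamma>\<^sub>0] blinfun.continuous_on continuous_on_const
        continuous_on_compose2[OF continuous_on_orbit] continuous_intros) auto
  then obtain y v where v: "V.admissible v"
    and y: "\<And>t. y t = C (\<Psi> (max 0 (t - t\<^sub>0)) x\<^sub>0) + W.conv \<gamma>\<^sub>0 t + V.conv v t"
    and incl: "AE t in lborel. v t \<in> filippov_regularization w t (y t)"
    using V.inclusion_solution_exists[OF w] by blast
  have v_int: "set_integrable lebesgue {t\<^sub>0..b} v" for b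
    using v unfolding V.admissible_def
    by (intro set_integrable_lebesgueI[OF _ _ V.\<mu>_locally_integrable]) auto
  have \<gamma>_int: "set_integrable lebesgue {t\<^sub>0..b} \<gamma>" for b
  proof -
    have i: "set_integrable lebesgue {t\<^sub>0..b} \<gamma>\<^sub>0"
      using \<gamma>\<^sub>0 unfolding W.admissible_def
      by (intro set_integrable_lebesgueI[OF _ _ W.\<mu>_locally_integrable]) auto
    show ?thesis
      unfolding set_integrable_def
    proof (rule integrable_cong_AE_imp[OF i[unfolded set_integrable_def]])
      show "(\<lambda>t. indicator {t\<^sub>0..b} t *\<^sub>R \<gamma> t) \<in> borel_measurable lebesgue"
        using \<gamma> unfolding Linfty_def by (intro borel_measurable_scaleR borel_measurable_indicator) auto
      show "AE t in lebesgue. indicator {t\<^sub>0..b} t *\<^sub>R \<gamma>\<^sub>0 t = indicator {t\<^sub>0..b} t *\<^sub>R \<gamma> t"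
        using \<gamma>'(3) by eventually_elim (simp add: \<gamma>\<^sub>0_def indicator_def)
    qed
  qed
  have "set_integrable lebesgue {t\<^sub>0..b} (\<lambda>t. v t + \<gamma> t)" for b
    by (rule set_integral_add(1)[OF v_int \<gamma>_int])
  then obtain x where x: "mild_trajectory t\<^sub>0 x\<^sub>0 (\<lambda>t. v t + \<gamma> t) x"
    using mild_trajectory_exists[OF x\<^sub>0] by blast
  have "C (x t) = y t" if t: "t\<^sub>0 \<le> t" for t
  proof -
    let ?k = "\<lambda>\<tau>. V.ker (t - \<tau>) (v \<tau>) + W.ker (t - \<tau>) (\<gamma>\<^sub>0 \<tau>)"
    have 1: "has_bochner_integral lebesgue (\<lambda>\<tau>. indicator {t\<^sub>0..t} \<tau> *\<^sub>R C (\<Psi> (t - \<tau>) (B (v \<tau> + \<gamma> \<tau>))))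
        (C (x t - \<Psi> (t - t\<^sub>0) x\<^sub>0))"
      by (rule output_integral) (use x t in \<open>simp add: mild_trajectory_def\<close>)
    have k: "integrable lborel ?k"
      by (intro Bochner_Integration.integrable_add V.ker_integrable[OF v] W.ker_integrable[OF \<gamma>\<^sub>0])
    then have km: "?k \<in> borel_measurable lborel" by (rule borel_measurable_integrable)
    have "integral\<^sup>L lebesgue ?k = integral\<^sup>L lborel ?k" using km by (rule integral_completion)
    also have "\<dots> = V.conv v t + W.conv \<gamma>\<^sub>0 t"
      unfolding V.conv_def
      by (intro Bochner_Integration.integral_add V.ker_integrable[OF v] W.ker_integrable[OF \<gamma>\<^sub>0])
    finally have 2: "has_bochner_integral lebesgue ?k (V.conv v t + W.conv \<gamma>\<^sub>0 t)"
      using k km by (simp add: has_bochner_integral_iff integrable_completion)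
    have v0: "v \<tau> = 0" if "\<tau> < t\<^sub>0" for \<tau>
      using v \<mu>(3)[OF that] unfolding V.admissible_def by (metis norm_le_zero_iff)
    have "AE \<tau> in lebesgue. indicator {t\<^sub>0..t} \<tau> *\<^sub>R C (\<Psi> (t - \<tau>) (B (v \<tau> + \<gamma> \<tau>))) = ?k \<tau>"
      using \<gamma>'(3)
    proof eventually_elim
      case (elim \<tau>)
      consider "\<tau> < t\<^sub>0" | "t < \<tau>" | "t\<^sub>0 \<le> \<tau>" "\<tau> \<le> t" by linarith
      then show ?case
      proof cases
        case 1
        then show ?thesis by (simp add: v0 \<gamma>\<^sub>0_def V.ker_def blinfun.zero_right)
      next
        case 2
        then show ?thesis by (simp add: V.ker_def)
      next
        case 3
        then show ?thesis
          by (simp add: V.ker_def G_apply \<gamma>\<^sub>0_def elim blinfun.add_right)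
      qed
    qed
    with 1 2 have "C (x t - \<Psi> (t - t\<^sub>0) x\<^sub>0) = V.conv v t + W.conv \<gamma>\<^sub>0 t"
      using has_bochner_integral_cong_AE[OF borel_measurable_has_bochner_integral[OF 1]
          borel_measurable_has_bochner_integral[OF 2]] has_bochner_integral_eq by blast
    then show ?thesis using t by (simp add: y blinfun.diff_right algebra_simps max_def)
  qed
  moreover have "AE t in lebesgue. v t \<in> filippov_regularization w t (y t)" using incl by (rule AE_completion)
  ultimately have "AE t in lebesgue. t\<^sub>0 \<le> t \<longrightarrow> v t \<in> filippov_regularization w t (C (x t))"
    by (auto elim!: eventually_mono)
  with x v_int show thesis by (rule that)
qed

end

section \<open>Existence of Utkin solutions\<close>

lemma utkin_solutionI:
  fixes \<Psi> :: "real \<Rightarrow> 'b::banach \<Rightarrow>\<^sub>L 'b" and B :: "(real^'m) \<Rightarrow>\<^sub>L 'b" and C :: "'b \<Rightarrow>\<^sub>L (real^'k)"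
  assumes "controlled_semigroup \<Psi> D A B"
    and x: "controlled_semigroup.mild_trajectory \<Psi> D A B t\<^sub>0 x\<^sub>0 (\<lambda>t. v t + \<gamma> t) x"
    and v: "\<And>b. set_integrable lebesgue {t\<^sub>0..b} v"
    and T: "0 < T" and incl: "AE t in lebesgue. t\<^sub>0 < t \<and> ereal t < ereal t\<^sub>0 + T \<longrightarrow> v t \<in> U t (C (x t))"
  shows "utkin_solution U \<Psi> B C \<gamma> t\<^sub>0 x\<^sub>0 T x v"
proof -
  interpret controlled_semigroup \<Psi> D A B by fact
  have x: "x t\<^sub>0 = x\<^sub>0" "continuous_on {t\<^sub>0..} x"
    "\<And>t. t\<^sub>0 \<le> t \<Longrightarrow> has_strong_bochner_integral lebesgue
      (\<lambda>\<tau>. indicator {t\<^sub>0..t} \<tau> *\<^sub>R \<Psi> (t - \<tau>) (B (v \<tau> + \<gamma> \<tau>))) (x t - \<Psi> (t - t\<^sub>0) x\<^sub>0)"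
    using x by (auto simp: mild_trajectory_def)
  show ?thesis
    unfolding utkin_solution_def
  proof (intro conjI allI impI)
    note M = complete_measure_lebesgue[where 'a = real]
    show "continuous_on {t. t\<^sub>0 \<le> t \<and> ereal t < ereal t\<^sub>0 + T} x"
      by (rule continuous_on_subset[OF x(2)]) auto
    show "set_integrable lebesgue {t. t\<^sub>0 < t \<and> t < b \<and> ereal t < ereal t\<^sub>0 + T} v" for b
    proof (rule set_integrable_subset[OF v[of b]])
      have "{t. t\<^sub>0 < t \<and> t < b \<and> ereal t < ereal t\<^sub>0 + T} = {t\<^sub>0<..<b} \<inter> {t. ereal t < ereal t\<^sub>0 + T}" by auto
      moreover have "open {t. ereal t < ereal t\<^sub>0 + T}"
        by (intro open_Collect_less continuous_intros)
      ultimately show "{t. t\<^sub>0 < t \<and> t < b \<and> ereal t < ereal t\<^sub>0 + T} \<in> sets lebesgue" by auto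
    qed auto
    fix t assume t: "t\<^sub>0 \<le> t \<and> ereal t < ereal t\<^sub>0 + T"
    have "has_strong_bochner_integral (lebesgue_on {t\<^sub>0..t})
        (\<lambda>\<tau>. indicator {t\<^sub>0..t} \<tau> *\<^sub>R \<Psi> (t - \<tau>) (B (v \<tau> + \<gamma> \<tau>))) (x t - \<Psi> (t - t\<^sub>0) x\<^sub>0)"
      by (rule has_strong_bochner_integral_restrict_space[OF M]) (use x(3) t in auto)
    then have "has_strong_bochner_integral (lebesgue_on {t\<^sub>0..t})
        (\<lambda>\<tau>. \<Psi> (t - \<tau>) (B (v \<tau> + \<gamma> \<tau>))) (x t - \<Psi> (t - t\<^sub>0) x\<^sub>0)"
      by (rule has_strong_bochner_integral_cong) simp
    then show "\<exists>I. has_strong_bochner_integral (lebesgue_on {t\<^sub>0..t}) (\<lambda>\<tau>. \<Psi> (t - \<tau>) (B (v \<tau> + \<gamma> \<tau>))) I \<and>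
        x t = \<Psi> (t - t\<^sub>0) x\<^sub>0 + I"
      by (intro exI[of _ "x t - \<Psi> (t - t\<^sub>0) x\<^sub>0"]) simp
  qed (use x(1) T incl in simp_all)
qed

context controlled_semigroup
begin

text \<open>The truncated feedback, set to \<open>0\<close> where it exceeds the majorant, is dominated everywhere. It agrees with \<open>u\<close>
almost everywhere on \<open>O'\<close> at almost all times in \<open>S\<close>, so the two regularizations agree along the solution as long as the output stays
in \<open>O'\<close>.\<close>

lemma filippov_solution_exists:
  fixes C :: "'b \<Rightarrow>\<^sub>L 'k::euclidean_space" and u :: "real \<Rightarrow> 'k \<Rightarrow> 'm" and \<mu> :: "real \<Rightarrow> real"
  assumes x\<^sub>0: "x\<^sub>0 \<in> D" and \<gamma>: "Linfty lebesgue \<gamma>"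
    and u: "(\<lambda>(t, y). u t y) \<in> borel_measurable (lebesgue_on ({t\<^sub>0..} \<times> UNIV))"
    and \<mu>: "\<mu> \<in> borel_measurable borel" "\<And>t. 0 \<le> \<mu> t" "\<And>t. t < t\<^sub>0 \<Longrightarrow> \<mu> t = 0"
      "integrable lborel (\<lambda>t. exp (- t) * \<mu> t)"
    and O': "open O'"
    and dom: "AE t in lebesgue. t\<^sub>0 \<le> t \<and> t \<in> S \<longrightarrow> (AE y in lebesgue. y \<in> O' \<longrightarrow> norm (u t y) \<le> \<mu> t)"
  obtains x v where "mild_trajectory t\<^sub>0 x\<^sub>0 (\<lambda>t. v t + \<gamma> t) x"
    "\<And>b. set_integrable lebesgue {t\<^sub>0..b} v"
    "AE t in lebesgue. t\<^sub>0 \<le> t \<and> t \<in> S \<and> C (x t) \<in> O' \<longrightarrow> v t \<in> filippov_regularization u t (C (x t))"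
proof -
  obtain u' where u': "(\<lambda>(t, y). u' t y) \<in> borel_measurable (borel \<Otimes>\<^sub>M borel)"
    "AE t in lebesgue. t\<^sub>0 \<le> t \<longrightarrow> (AE y in lebesgue. u t y = u' t y)"
    using borel_version[OF u] by blast
  define w where "w t y = (if norm (u' t y) \<le> \<mu> t then u' t y else 0)" for t y
  have w1: "(\<lambda>(t, y). w t y) \<in> borel_measurable (borel \<Otimes>\<^sub>M borel)"
  proof -
    have [measurable]: "(\<lambda>p. u' (fst p) (snd p)) \<in> borel_measurable (borel \<Otimes>\<^sub>M borel)"
      using u'(1) by (simp add: case_prod_beta')
    have [measurable]: "\<mu> \<in> borel_measurable borel" by (rule \<mu>(1))
    have "(\<lambda>p. if norm (u' (fst p) (snd p)) \<le> \<mu> (fst p) then u' (fst p) (snd p) else 0)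
        \<in> borel_measurable (borel \<Otimes>\<^sub>M borel)"
      by measurable
    then show ?thesis by (simp add: w_def case_prod_beta')
  qed
  have w2: "norm (w t y) \<le> \<mu> t" for t y using \<mu>(2)[of t] by (simp add: w_def)
  have wu: "AE t in lebesgue. t\<^sub>0 \<le> t \<and> t \<in> S \<longrightarrow> (AE y in lebesgue. y \<in> O' \<longrightarrow> w t y = u t y)"
    using u'(2) dom
  proof eventually_elim
    case (elim t)
    show ?case
    proof
      assume t: "t\<^sub>0 \<le> t \<and> t \<in> S"
      with elim have "AE y in lebesgue. u t y = u' t y"
        "AE y in lebesgue. y \<in> O' \<longrightarrow> norm (u t y) \<le> \<mu> t" by blast+
      then show "AE y in lebesgue. y \<in> O' \<longrightarrow> w t y = u t y"
        by eventually_elim (auto simp: w_def)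
    qed
  qed
  obtain x v where x: "mild_trajectory t\<^sub>0 x\<^sub>0 (\<lambda>t. v t + \<gamma> t) x"
    "\<And>b. set_integrable lebesgue {t\<^sub>0..b} v"
    "AE t in lebesgue. t\<^sub>0 \<le> t \<longrightarrow> v t \<in> filippov_regularization w t (C (x t))"
    by (rule relaxed_solution[where C = C and t\<^sub>0 = t\<^sub>0, OF x\<^sub>0 \<gamma> \<mu> w1 w2]) (assumption | rule that)+
  have "AE t in lebesgue. t\<^sub>0 \<le> t \<and> t \<in> S \<and> C (x t) \<in> O' \<longrightarrow> v t \<in> filippov_regularization u t (C (x t))"
    using x(3) wu
  proof eventually_elim
    case (elim t)
    show ?case
    proof
      assume t: "t\<^sub>0 \<le> t \<and> t \<in> S \<and> C (x t) \<in> O'"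
      with elim have "AE y in lebesgue. y \<in> O' \<longrightarrow> w t y = u t y" by blast
      from filippov_regularization_mono[where w = w and u = u, OF O' _ this, of "C (x t)"]
      show "v t \<in> filippov_regularization u t (C (x t))" using t elim by blast
    qed
  qed
  with x(1,2) show thesis by (rule that)
qed

end

text \<open>The unit length of the time interval is arbitrary; \<open>\<alpha> = |t\<^sub>0| + 2\<close> makes it part of the domain of the integrable bound.\<close>

lemma filippov_condition_majorant:
  assumes "filippov_condition t\<^sub>0 u" "r > 0"
  obtains \<mu> :: "real \<Rightarrow> real" where "\<mu> \<in> borel_measurable borel" "\<And>t. 0 \<le> \<mu> t" "\<And>t. t < t\<^sub>0 \<Longrightarrow> \<mu> t = 0"
    "integrable lborel (\<lambda>t. exp (- t) * \<mu> t)"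
    "AE t in lebesgue. t\<^sub>0 \<le> t \<and> t \<in> {..t\<^sub>0 + 1} \<longrightarrow> (AE y in lebesgue. y \<in> ball 0 r \<longrightarrow> norm (u t y) \<le> \<mu> t)"
proof -
  define \<alpha> where "\<alpha> = \<bar>t\<^sub>0\<bar> + 2"
  have "\<alpha> > 0" by (simp add: \<alpha>_def)
  then obtain m where m: "set_integrable lebesgue {-\<alpha><..<\<alpha>} m"
    and um: "AE t in lebesgue. -\<alpha> < t \<and> t < \<alpha> \<and> t\<^sub>0 \<le> t \<longrightarrow>
        (AE y in lebesgue. y \<in> ball 0 r \<longrightarrow> norm (u t y) \<le> m t)"
    using assms unfolding filippov_condition_def by blast
  let ?m = "\<lambda>t. indicator {-\<alpha><..<\<alpha>} t *\<^sub>R m t"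
  have i: "integrable lebesgue ?m" using m by (simp add: set_integrable_def)
  obtain g where g: "g \<in> borel_measurable lborel" "AE t in lborel. ?m t = g t"
    using completion_ex_borel_measurable_real[OF borel_measurable_integrable[OF i]] by blast
  have gb: "g \<in> borel_measurable borel" using g(1) by simp
  have g': "AE t in lebesgue. ?m t = g t" using g(2) by (rule AE_completion)
  have "integrable lebesgue g"
    by (rule integrable_cong_AE_imp[OF i _ g']) (use g(1) in \<open>simp add: measurable_completion\<close>)
  then have gi: "integrable lborel g" using g(1) by (simp add: integrable_completion)
  define \<mu> where "\<mu> t = indicator {t\<^sub>0..t\<^sub>0 + 1} t * \<bar>g t\<bar>" for t
  show thesis
  proof
    show \<mu>m: "\<mu> \<in> borel_measurable borel"
      unfolding \<mu>_def using gb by (intro borel_measurable_times borel_measurable_indicator) auto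
    show "0 \<le> \<mu> t" for t by (simp add: \<mu>_def)
    show "\<mu> t = 0" if "t < t\<^sub>0" for t using that by (simp add: \<mu>_def)
    show "integrable lborel (\<lambda>t. exp (- t) * \<mu> t)"
    proof (rule Bochner_Integration.integrable_bound)
      show "integrable lborel (\<lambda>t. exp (- t\<^sub>0) * g t)" using gi by simp
      show "(\<lambda>t. exp (- t) * \<mu> t) \<in> borel_measurable lborel" using \<mu>m by measurable
      show "AE t in lborel. norm (exp (- t) * \<mu> t) \<le> norm (exp (- t\<^sub>0) * g t)"
      proof (rule AE_I2)
        fix t
        show "norm (exp (- t) * \<mu> t) \<le> norm (exp (- t\<^sub>0) * g t)"
        proof (cases "t \<in> {t\<^sub>0..t\<^sub>0 + 1}")
          case True
          then have "exp (- t) * \<bar>g t\<bar> \<le> exp (- t\<^sub>0) * \<bar>g t\<bar>" by (intro mult_right_mono) auto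
          with True show ?thesis by (simp add: \<mu>_def abs_mult)
        qed (simp add: \<mu>_def)
      qed
    qed
    show "AE t in lebesgue. t\<^sub>0 \<le> t \<and> t \<in> {..t\<^sub>0 + 1} \<longrightarrow> (AE y in lebesgue. y \<in> ball 0 r \<longrightarrow> norm (u t y) \<le> \<mu> t)"
      using um g'
    proof eventually_elim
      case (elim t)
      show ?case
      proof
        assume t: "t\<^sub>0 \<le> t \<and> t \<in> {..t\<^sub>0 + 1}"
        then have t': "-\<alpha> < t \<and> t < \<alpha> \<and> t\<^sub>0 \<le> t" by (auto simp: \<alpha>_def)
        then have "m t = g t" using elim(2) by simp
        then have "m t \<le> \<mu> t" using t by (simp add: \<mu>_def)
        moreover have "AE y in lebesgue. y \<in> ball 0 r \<longrightarrow> norm (u t y) \<le> m t" using elim(1) t' by blast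
        ultimately show "AE y in lebesgue. y \<in> ball 0 r \<longrightarrow> norm (u t y) \<le> \<mu> t"
          by (auto elim!: eventually_mono)
      qed
    qed
  qed
qed

lemma essentially_bounded_majorant:
  fixes u :: "real \<Rightarrow> 'k::euclidean_space \<Rightarrow> 'm::euclidean_space"
  assumes "esssup (lebesgue_on ({t\<^sub>0..} \<times> UNIV)) (\<lambda>(t, y). ereal (norm (u t y))) < \<infinity>"
  obtains c where "0 \<le> c" "AE t in lebesgue. t\<^sub>0 \<le> t \<longrightarrow> (AE y in lebesgue. norm (u t y) \<le> c)"
proof -
  let ?S = "{t\<^sub>0..} \<times> (UNIV :: 'k set)"
  let ?e = "esssup (lebesgue_on ?S) (\<lambda>(t, y). ereal (norm (u t y)))"
  obtain c where c: "?e \<le> ereal c" "0 \<le> c"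
  proof (cases ?e)
    case (real r)
    then show thesis by (intro that[of "max r 0"]) auto
  next
    case MInf
    then show thesis by (intro that[of 0]) auto
  qed (use assms in simp)
  have "closed ?S" by (intro closed_Times) auto
  then have S: "?S \<in> sets lebesgue" by (intro sets_completionI_sets) auto
  have "AE p in lebesgue_on ?S. (case p of (t, y) \<Rightarrow> ereal (norm (u t y))) \<le> ?e" by (rule esssup_AE)
  then have "AE p in lebesgue. p \<in> ?S \<longrightarrow> (case p of (t, y) \<Rightarrow> ereal (norm (u t y))) \<le> ?e"
    using S by (subst (asm) AE_restrict_space_iff) auto
  then have "AE p in lebesgue. t\<^sub>0 \<le> fst p \<longrightarrow> norm (u (fst p) (snd p)) \<le> c"
  proof eventually_elim
    case (elim p)
    show ?case
    proof
      assume "t\<^sub>0 \<le> fst p"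
      then have "p \<in> ?S" by (cases p) simp
      with elim have "(case p of (t, y) \<Rightarrow> ereal (norm (u t y))) \<le> ?e" by blast
      then have "(case p of (t, y) \<Rightarrow> ereal (norm (u t y))) \<le> ereal c" using c(1) by (rule order.trans)
      then show "norm (u (fst p) (snd p)) \<le> c" by (simp add: case_prod_beta')
    qed
  qed
  from AE_lebesgue_pair[where P = "\<lambda>t y. t\<^sub>0 \<le> t \<longrightarrow> norm (u t y) \<le> c", OF this]
  have "AE t in lebesgue. t\<^sub>0 \<le> t \<longrightarrow> (AE y in lebesgue. norm (u t y) \<le> c)"
    by eventually_elim auto
  with c(2) show thesis by (rule that)
qed

theorem corollary6:
  fixes D :: "'b::banach set" and A :: "'b \<Rightarrow> 'b" and \<Psi> :: "real \<Rightarrow> 'b \<Rightarrow>\<^sub>L 'b"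
    and B :: "(real^'m) \<Rightarrow>\<^sub>L 'b" and C :: "'b \<Rightarrow>\<^sub>L (real^'k)"
    and \<gamma> :: "real \<Rightarrow> real^'m" and u :: "real \<Rightarrow> real^'k \<Rightarrow> real^'m"
    and t\<^sub>0 :: real and x\<^sub>0 :: 'b
    and U :: "real \<Rightarrow> real^'k \<Rightarrow> (real^'m) set"
  assumes "closed_densely_defined_operator D A"
    and "C0_semigroup \<Psi>"
    and "generates D A \<Psi>"
    and "Linfty lebesgue \<gamma>"
    and "(\<lambda>(t, y). u t y) \<in> borel_measurable (lebesgue_on ({t\<^sub>0..} \<times> UNIV))"
    and "range B \<subseteq> D"
    and "filippov_condition t\<^sub>0 u"
    and "x\<^sub>0 \<in> D"
    and "U = utkin_first_kind u \<or> U = utkin_second_kind u"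
  shows "\<exists>T x u\<^sub>e\<^sub>q.
    utkin_solution U \<Psi> B C \<gamma> t\<^sub>0 x\<^sub>0 T x u\<^sub>e\<^sub>q \<and>
    (\<forall>t. t\<^sub>0 \<le> t \<and> ereal t < ereal t\<^sub>0 + T \<longrightarrow> x t \<in> D) \<and>
    (AE t in lebesgue. t\<^sub>0 < t \<and> ereal t < ereal t\<^sub>0 + T \<longrightarrow>
      (x has_vector_derivative A (x t) + B (u\<^sub>e\<^sub>q t + \<gamma> t)) (at t)) \<and>
    (Linfty (lebesgue_on {0<..}) (\<lambda>s. matrix (\<lambda>v. C (\<Psi> s (A (B v)))) :: real^'m^'k) \<and>
     esssup (lebesgue_on ({t\<^sub>0..} \<times> UNIV)) (\<lambda>(t, y). ereal (norm (u t y))) < \<infinity>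
     \<longrightarrow> T = \<infinity>)"
proof -
  interpret controlled_semigroup \<Psi> D A B
    by unfold_locales (use assms in auto)
  have U: "filippov_regularization u t y \<subseteq> U t y" for t y
    using assms(9) utkin_first_kind_subset_second_kind[of u t y] by (auto simp: utkin_first_kind_def)
  show ?thesis
  proof (cases "esssup (lebesgue_on ({t\<^sub>0..} \<times> UNIV)) (\<lambda>(t, y). ereal (norm (u t y))) < \<infinity>")
    case True
    then obtain c where c: "0 \<le> c" "AE t in lebesgue. t\<^sub>0 \<le> t \<longrightarrow> (AE y in lebesgue. norm (u t y) \<le> c)"
      by (rule essentially_bounded_majorant)
    have dom: "AE t in lebesgue. t\<^sub>0 \<le> t \<and> t \<in> UNIV \<longrightarrow>
        (AE y in lebesgue. y \<in> UNIV \<longrightarrow> norm (u t y) \<le> c * indicator {t\<^sub>0..} t)"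
      using c(2) by eventually_elim simp
    have \<mu>: "(\<lambda>t. c * indicator {t\<^sub>0..} t) \<in> borel_measurable borel"
      "\<And>t. 0 \<le> c * indicator {t\<^sub>0..} t" "\<And>t. t < t\<^sub>0 \<Longrightarrow> c * indicator {t\<^sub>0..} t = 0"
      using c(1) by auto
    obtain x v where x: "mild_trajectory t\<^sub>0 x\<^sub>0 (\<lambda>t. v t + \<gamma> t) x"
      "\<And>b. set_integrable lebesgue {t\<^sub>0..b} v"
      "AE t in lebesgue. t\<^sub>0 \<le> t \<and> t \<in> UNIV \<and> C (x t) \<in> UNIV \<longrightarrow> v t \<in> filippov_regularization u t (C (x t))"
      by (rule filippov_solution_exists[where C = C and t\<^sub>0 = t\<^sub>0, OF assms(8,4,5) \<mu> integrable_exp_atLeast open_UNIV dom]) (assumption | rule that)+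
    have "utkin_solution U \<Psi> B C \<gamma> t\<^sub>0 x\<^sub>0 \<infinity> x v"
    proof (rule utkin_solutionI[OF controlled_semigroup_axioms x(1,2)])
      show "AE t in lebesgue. t\<^sub>0 < t \<and> ereal t < ereal t\<^sub>0 + \<infinity> \<longrightarrow> v t \<in> U t (C (x t))"
        using x(3) by eventually_elim (use U in auto)
    qed auto
    with x(1) show ?thesis unfolding mild_trajectory_def
      by (intro exI[of _ \<infinity>] exI[of _ x] exI[of _ v]) simp
  next
    case False
    \<comment> \<open>The initial output lies well inside the ball, so continuity keeps the output there for a while.\<close>
    define r where "r = norm (C x\<^sub>0) + 1"
    have r: "r > 0" by (simp add: r_def add_nonneg_pos)
    obtain \<mu> where \<mu>: "\<mu> \<in> borel_measurable borel" "\<And>t. 0 \<le> \<mu> t" "\<And>t. t < t\<^sub>0 \<Longrightarrow> \<mu> t = 0"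
      "integrable lborel (\<lambda>t. exp (- t) * \<mu> t)"
      "AE t in lebesgue. t\<^sub>0 \<le> t \<and> t \<in> {..t\<^sub>0 + 1} \<longrightarrow> (AE y in lebesgue. y \<in> ball 0 r \<longrightarrow> norm (u t y) \<le> \<mu> t)"
      using filippov_condition_majorant[OF assms(7) r] by blast
    obtain x v where x: "mild_trajectory t\<^sub>0 x\<^sub>0 (\<lambda>t. v t + \<gamma> t) x"
      "\<And>b. set_integrable lebesgue {t\<^sub>0..b} v"
      "AE t in lebesgue. t\<^sub>0 \<le> t \<and> t \<in> {..t\<^sub>0 + 1} \<and> C (x t) \<in> ball 0 r \<longrightarrow> v t \<in> filippov_regularization u t (C (x t))"
      by (rule filippov_solution_exists[where C = C and t\<^sub>0 = t\<^sub>0, OF assms(8,4,5) \<mu>(1-4) open_ball \<mu>(5)]) (assumption | rule that)+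
    have "continuous_on {t\<^sub>0..} (\<lambda>t. C (x t))"
      using x(1) by (auto simp: mild_trajectory_def intro!: blinfun.continuous_on continuous_on_const)
    then obtain d where d: "d > 0" "\<And>t. t\<^sub>0 \<le> t \<Longrightarrow> dist t t\<^sub>0 < d \<Longrightarrow> dist (C (x t)) (C (x t\<^sub>0)) < 1"
      unfolding continuous_on_iff by (metis atLeast_iff order_refl zero_less_one)
    have in_ball: "C (x t) \<in> ball 0 r" if "t\<^sub>0 \<le> t" "t < t\<^sub>0 + min d 1" for t
    proof -
      have "dist (C (x t)) (C x\<^sub>0) < 1" using d(2)[of t] that x(1) by (simp add: mild_trajectory_def dist_real_def)
      then show ?thesis
        using norm_triangle_ineq2[of "C (x t)" "C x\<^sub>0"] by (simp add: r_def dist_norm)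
    qed
    let ?T = "ereal (min d 1)"
    have "utkin_solution U \<Psi> B C \<gamma> t\<^sub>0 x\<^sub>0 ?T x v"
    proof (rule utkin_solutionI[OF controlled_semigroup_axioms x(1,2)])
      show "0 < ?T" using d(1) by (simp add: zero_ereal_def)
      show "AE t in lebesgue. t\<^sub>0 < t \<and> ereal t < ereal t\<^sub>0 + ?T \<longrightarrow> v t \<in> U t (C (x t))"
        using x(3)
      proof eventually_elim
        case (elim t)
        show ?case
        proof
          assume "t\<^sub>0 < t \<and> ereal t < ereal t\<^sub>0 + ?T"
          then have t: "t\<^sub>0 \<le> t" "t < t\<^sub>0 + min d 1"
            by (simp_all only: plus_ereal.simps less_ereal.simps less_imp_le)
          then have "t \<in> {..t\<^sub>0 + 1}" by auto
          with elim t in_ball[OF t] U show "v t \<in> U t (C (x t))" by blast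
        qed
      qed
    qed
    moreover have "AE t in lebesgue. t\<^sub>0 < t \<and> ereal t < ereal t\<^sub>0 + ?T \<longrightarrow>
        (x has_vector_derivative A (x t) + B (v t + \<gamma> t)) (at t)"
      using x(1) by (auto simp: mild_trajectory_def elim!: eventually_mono)
    ultimately show ?thesis
      using x(1) False unfolding mild_trajectory_def by (intro exI[of _ ?T] exI[of _ x] exI[of _ v]) blast
  qed
qed

end
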